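(* Let $\mathbb{T}_0=(t^0_{k,n})$ and $\mathbb{T}_1=(t^1_{k,n})$ be matrices of transformation, and let $\{n_a^0\}_a$ and $\{n_b^1\}_b$ be subsequences of the natural numbers. Assume that for each $i\in\{0,1\}$ (at least) one of the following conditions is satisfied: (i) $\sup_{a}\|\mathcal{T}_{n_a^i}^{\mathbb{T}_i}\|_{H_1(\mathbb{I})\to L_1(\mathbb{I})}<\infty$; (ii) $\sup_{a}\|\mathcal{T}_{n_a^i}^{\mathbb{T}_i}\|_{L_\infty(\mathbb{I})\to L_\infty(\mathbb{I})}<\infty$; (iii) $\sup_{a}\upsilon(n_a^i,\mathbb{T}_i)<\infty$. Assume moreover that $t^i_{0,n_a^i}\to0$ as $n_a^i\to\infty$, for $i=0,1$. Then for each $f\in L\ln L(\mathbb{I}^2)$ and every two-dimensional Walsh–Lebesgue point $(x^0,x^1)\in\mathbb{I}^2$ of $f$, $$(\mathcal{T}_{n_a^0}^{\mathbb{T}_0}\otimes\mathcal{T}_{n_b^1}^{\mathbb{T}_1})f(x^0,x^1)\to f(x^0,x^1)\quad\text{as }\min\{n_a^0,n_b^1\}\to\infty.$$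
   Context: Notation: $\mathbb{I}=[0,1)$, $\mathbb{N}=\{0,1,2,\dots\}$, $\mu$ is Lebesgue measure on $\mathbb{I}$ and $\boldsymbol{\mu}=\mu\otimes\mu$ on $\mathbb{I}^2$. Walsh–Paley system: for $x\in\mathbb{I}$ write $x=\sum_{n\ge0}x_n2^{-(n+1)}$, $x_n\in\{0,1\}$ (for dyadic rationals take the expansion terminating in $0$'s). For $n\in\mathbb{N}$ write $n=\sum_{k\ge0}\varepsilon_k(n)2^k$, $\varepsilon_k(n)\in\{0,1\}$, and for $n\ge1$ let $|n|$ be the integer with $2^{|n|}\le n<2^{|n|+1}$. Put $w_n(x):=(-1)^{\sum_k\varepsilon_k(n)x_k}$. The dyadic (logical) sum is $x\dotplus y:=\sum_{n\ge0}|x_n-y_n|2^{-(n+1)}$. $I_n(x)$ is the dyadic interval $[l2^{-n},(l+1)2^{-n})$ containing $x$. The Walsh–Dirichlet kernels are $D_0=0$, $D_n=\sum_{k=0}^{n-1}w_k$. For $f\in L_1(\mathbb{I})$, $\widehat f(i)=\int_{\mathbb{I}}fw_i\,d\mu$ and $S_m(f)=\sum_{i=0}^{m-1}\widehat f(i)w_i$ (so $S_0(f)=0$). Dyadic Hardy space: $E^*(f):=\sup_{n\in\mathbb{N}}|S_{2^n}(f)|$ and $H_1(\mathbb{I})=\{f\in L_1(\mathbb{I}):\|f\|_{H_1}:=\|E^*(f)\|_1<\infty\}$. Matrix of transformation: an infinite matrix $\mathbb{T}=(t_{k,n})_{k,n\in\mathbb{N}}$ of reals with $t_{k,n}\ge0$,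 $t_{k+1,n}\le t_{k,n}$ for all $k,n\in\mathbb{N}$, and $\sum_{k=0}^nt_{k,n}=1$ for all $n$. Operators: $\mathcal{T}_n^{\mathbb{T}}(f):=\sum_{k=0}^nt_{n-k,n}S_k(f)$ for $f\in L_1(\mathbb{I})$; equivalently $\mathcal{T}_n^{\mathbb{T}}f(x)=\int_{\mathbb{I}}f(t)V_n^{\mathbb{T}}(x\dotplus t)\,d\mu(t)$ with kernel $V_n^{\mathbb{T}}:=\sum_{k=1}^nt_{n-k,n}D_k$. For $f\in L_1(\mathbb{I}^2)$ the tensor product is $$(\mathcal{T}_{n}^{\mathbb{T}_0}\otimes\mathcal{T}_{m}^{\mathbb{T}_1})f(x^0,x^1)=\int_{\mathbb{I}^2}f(u^0,u^1)V_n^{\mathbb{T}_0}(x^0\dotplus u^0)V_m^{\mathbb{T}_1}(x^1\dotplus u^1)\,d\boldsymbol{\mu}(u^0,u^1).$$ Variation: $\tau_{s,n}:=\sum_{l=0}^st_{l,n}$ and $\upsilon(n,\mathbb{T}):=\sum_{k=0}^{|n|}|\varepsilon_k(n)-\varepsilon_{k+1}(n)|\,\tau_{2^k,n}$ for $n\ge1$, with $\upsilon(0,\mathbb{T}):=0$. $L\ln L(\mathbb{I}^2)$ is the set of $f\in L_1(\mathbb{I}^2)$ with $\int_{\mathbb{I}^2}|f|\ln^+|f|\,d\boldsymbol{\mu}<\infty$, where $\ln^+(x)=\mathbf{1}_{\{x>1\}}\ln x$. A subsequence of the natural numbers means a strictly increasing sequence in $\mathbb{N}$. Two-dimensional Walsh–Lebesgue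 points: let $f\in L_1(\mathbb{I}^2)$ (a fixed, everywhere defined, finite-valued function) and $\Delta(f)(s^0,s^1,x^0,x^1)=|f(s^0,s^1)-f(x^0,x^1)|$. Put $$W_{n^0,n^1}f(x^0,x^1):=\sum_{i^0=0}^{n^0}\sum_{i^1=0}^{n^1}2^{i^0+i^1}\int_{I_{n^0}(x^0\dotplus2^{-i^0-1})\times I_{n^1}(x^1\dotplus2^{-i^1-1})}\Delta(f)(s^0,s^1,x^0,x^1)\,d\boldsymbol{\mu}(s^0,s^1),$$ $$H^{(1)}_{n^1}f(x^0,x^1):=\sum_{i^1=0}^{n^1}2^{i^1}\int_{\mathbb{I}\times I_{n^1}(x^1\dotplus2^{-i^1-1})}\Delta(f)(s^0,s^1,x^0,x^1)\,d\boldsymbol{\mu}(s^0,s^1),$$ $$H^{(0)}_{n^0}f(x^0,x^1):=\sum_{i^0=0}^{n^0}2^{i^0}\int_{I_{n^0}(x^0\dotplus2^{-i^0-1})\times\mathbb{I}}\Delta(f)(s^0,s^1,x^0,x^1)\,d\boldsymbol{\mu}(s^0,s^1).$$ A point $(x^0,x^1)\in\mathbb{I}^2$ is a two-dimensional Walsh–Lebesgue point of $f$ if $\lim_{\min\{n^0,n^1\}\to\infty}W_{n^0,n^1}f(x^0,x^1)=0$, $\sup_nH^{(1)}_nf(x^0,x^1)<\infty$ and $\sup_mH^{(0)}_mf(x^0,x^1)<\infty$. *)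

theory Defs
  imports
    "HOL-Analysis.Analysis"
    "HOL-Probability.Essential_Supremum"
    "HOL-Library.Discrete_Functions"
begin

abbreviation unit_I :: "real set" where
  "unit_I \<equiv> {0..<1}"

abbreviation mu :: "real measure" where
  "mu \<equiv> lebesgue_on unit_I"

text \<open>Lebesgue measure on the square, i.e. the completion of the product of \<open>mu\<close> with itself.\<close>

abbreviation mu2 :: "(real \<times> real) measure" where
  "mu2 \<equiv> lebesgue_on (unit_I \<times> unit_I)"

text \<open>
  For \<open>x \<in> [0,1)\<close> the digits \<open>xdigit x n\<close> satisfy \<open>x = (\<Sum>n. xdigit x n / 2 ^ (n+1))\<close>; at dyadic
  rationals the floor picks the expansion that ends in zeros.
\<close>

definition xdigit :: "real \<Rightarrow> nat \<Rightarrow> nat" where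
  "xdigit x n = nat (\<lfloor>2 ^ (n + 1) * x\<rfloor> mod 2)"

definition ndigit :: "nat \<Rightarrow> nat \<Rightarrow> nat" where
  "ndigit k n = n div 2 ^ k mod 2"

text \<open>The sum in the exponent may stop at \<open>n\<close>, because \<open>n < 2 ^ k\<close> for \<open>k \<ge> n\<close>.\<close>

definition walsh :: "nat \<Rightarrow> real \<Rightarrow> real" where
  "walsh n x = (-1) ^ (\<Sum>k<n. ndigit k n * xdigit x k)"

text \<open>
  The sum is taken literally: if \<open>\<bar>xdigit x n - xdigit y n\<bar>\<close> is eventually \<open>1\<close>, it is a dyadic rational,
  possibly \<open>1\<close>, whose \<open>xdigit\<close> expansion is the other one. For fixed \<open>x \<in> [0,1)\<close> this happens for
  only countably many \<open>y \<in> [0,1)\<close>, none of which is a dyadic rational.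
\<close>

definition dotplus :: "real \<Rightarrow> real \<Rightarrow> real"  (infixl \<open>\<dotplus>\<close> 65) where
  "x \<dotplus> y = (\<Sum>n. \<bar>real (xdigit x n) - real (xdigit y n)\<bar> / 2 ^ (n + 1))"

definition dyadic_interval :: "nat \<Rightarrow> real \<Rightarrow> real set" where
  "dyadic_interval n x =
     {real_of_int \<lfloor>2 ^ n * x\<rfloor> / 2 ^ n ..< (real_of_int \<lfloor>2 ^ n * x\<rfloor> + 1) / 2 ^ n}"

definition walsh_dirichlet :: "nat \<Rightarrow> real \<Rightarrow> real" where
  "walsh_dirichlet n x = (\<Sum>k<n. walsh k x)"

definition walsh_coeff :: "(real \<Rightarrow> real) \<Rightarrow> nat \<Rightarrow> real" where
  "walsh_coeff f i = (\<integral>x. f x * walsh i x \<partial>mu)"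

definition walsh_partial_sum :: "nat \<Rightarrow> (real \<Rightarrow> real) \<Rightarrow> real \<Rightarrow> real" where
  "walsh_partial_sum m f x = (\<Sum>i<m. walsh_coeff f i * walsh i x)"

definition L1_norm :: "(real \<Rightarrow> real) \<Rightarrow> ennreal" where
  "L1_norm f = (\<integral>\<^sup>+x. ennreal \<bar>f x\<bar> \<partial>mu)"

definition Linf_norm :: "(real \<Rightarrow> real) \<Rightarrow> ennreal" where
  "Linf_norm f = esssup mu (\<lambda>x. ennreal \<bar>f x\<bar>)"

definition Linf :: "(real \<Rightarrow> real) set" where
  "Linf = {f \<in> borel_measurable mu. Linf_norm f < \<infinity>}"

definition dyadic_maximal :: "(real \<Rightarrow> real) \<Rightarrow> real \<Rightarrow> ennreal" where
  "dyadic_maximal f x = (SUP n. ennreal \<bar>walsh_partial_sum (2 ^ n) f x\<bar>)"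

definition H1_norm :: "(real \<Rightarrow> real) \<Rightarrow> ennreal" where
  "H1_norm f = (\<integral>\<^sup>+x. dyadic_maximal f x \<partial>mu)"

definition H1 :: "(real \<Rightarrow> real) set" where
  "H1 = {f. integrable mu f \<and> H1_norm f < \<infinity>}"

definition op_norm ::
  "(real \<Rightarrow> real) set \<Rightarrow> ((real \<Rightarrow> real) \<Rightarrow> ennreal) \<Rightarrow> ((real \<Rightarrow> real) \<Rightarrow> ennreal) \<Rightarrow>
    ((real \<Rightarrow> real) \<Rightarrow> (real \<Rightarrow> real)) \<Rightarrow> ennreal" where
  "op_norm X normX normY T = (SUP f\<in>{f \<in> X. normX f \<le> 1}. normY (T f))"

definition ln_plus :: "real \<Rightarrow> real" where
  "ln_plus x = (if x > 1 then ln x else 0)"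

definition LlnL :: "(real \<times> real \<Rightarrow> real) set" where
  "LlnL = {f. integrable mu2 f \<and> integrable mu2 (\<lambda>x. \<bar>f x\<bar> * ln_plus \<bar>f x\<bar>)}"

text \<open>The entry \<open>t\<^sub>k\<^sub>,\<^sub>n\<close> of a matrix \<open>t\<close> is \<open>t k n\<close>.\<close>

definition transformation_matrix :: "(nat \<Rightarrow> nat \<Rightarrow> real) \<Rightarrow> bool" where
  "transformation_matrix t \<longleftrightarrow>
     (\<forall>k n. 0 \<le> t k n) \<and> (\<forall>k n. t (k + 1) n \<le> t k n) \<and> (\<forall>n. (\<Sum>k\<le>n. t k n) = 1)"

definition matrix_op ::
  "(nat \<Rightarrow> nat \<Rightarrow> real) \<Rightarrow> nat \<Rightarrow> (real \<Rightarrow> real) \<Rightarrow> real \<Rightarrow> real" where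
  "matrix_op t n f x = (\<Sum>k\<le>n. t (n - k) n * walsh_partial_sum k f x)"

definition matrix_kernel :: "(nat \<Rightarrow> nat \<Rightarrow> real) \<Rightarrow> nat \<Rightarrow> real \<Rightarrow> real" where
  "matrix_kernel t n x = (\<Sum>k=1..n. t (n - k) n * walsh_dirichlet k x)"

definition tensor_op ::
  "(nat \<Rightarrow> nat \<Rightarrow> real) \<Rightarrow> nat \<Rightarrow> (nat \<Rightarrow> nat \<Rightarrow> real) \<Rightarrow> nat \<Rightarrow>
    (real \<times> real \<Rightarrow> real) \<Rightarrow> real \<times> real \<Rightarrow> real" where
  "tensor_op t0 n t1 m f x =
     (\<integral>u. f u * matrix_kernel t0 n (fst x \<dotplus> fst u) * matrix_kernel t1 m (snd x \<dotplus> snd u) \<partial>mu2)"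

definition tau :: "(nat \<Rightarrow> nat \<Rightarrow> real) \<Rightarrow> nat \<Rightarrow> nat \<Rightarrow> real" where
  "tau t s n = (\<Sum>l\<le>s. t l n)"

definition upsilon :: "nat \<Rightarrow> (nat \<Rightarrow> nat \<Rightarrow> real) \<Rightarrow> real" where
  "upsilon n t =
     (if n = 0 then 0
      else \<Sum>k\<le>floor_log n. \<bar>real (ndigit k n) - real (ndigit (k + 1) n)\<bar> * tau t (2 ^ k) n)"

definition WL_W :: "(real \<times> real \<Rightarrow> real) \<Rightarrow> nat \<Rightarrow> nat \<Rightarrow> real \<times> real \<Rightarrow> real" where
  "WL_W f n0 n1 x =
     (\<Sum>i0\<le>n0. \<Sum>i1\<le>n1. 2 ^ (i0 + i1) *
        (LINT s:dyadic_interval n0 (fst x \<dotplus> 1 / 2 ^ (i0 + 1)) \<times>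
                dyadic_interval n1 (snd x \<dotplus> 1 / 2 ^ (i1 + 1))|mu2. \<bar>f s - f x\<bar>))"

definition WL_G1 :: "(real \<times> real \<Rightarrow> real) \<Rightarrow> nat \<Rightarrow> real \<times> real \<Rightarrow> real" where
  "WL_G1 f n1 x =
     (\<Sum>i1\<le>n1. 2 ^ i1 *
        (LINT s:unit_I \<times> dyadic_interval n1 (snd x \<dotplus> 1 / 2 ^ (i1 + 1))|mu2. \<bar>f s - f x\<bar>))"

definition WL_G0 :: "(real \<times> real \<Rightarrow> real) \<Rightarrow> nat \<Rightarrow> real \<times> real \<Rightarrow> real" where
  "WL_G0 f n0 x =
     (\<Sum>i0\<le>n0. 2 ^ i0 *
        (LINT s:dyadic_interval n0 (fst x \<dotplus> 1 / 2 ^ (i0 + 1)) \<times> unit_I|mu2. \<bar>f s - f x\<bar>))"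

definition walsh_lebesgue_point :: "(real \<times> real \<Rightarrow> real) \<Rightarrow> real \<times> real \<Rightarrow> bool" where
  "walsh_lebesgue_point f x \<longleftrightarrow>
     x \<in> unit_I \<times> unit_I \<and>
     ((\<lambda>(n0, n1). WL_W f n0 n1 x) \<longlongrightarrow> 0) (filtercomap (\<lambda>(n0, n1). min n0 n1) at_top) \<and>
     bdd_above (range (\<lambda>n. WL_G1 f n x)) \<and>
     bdd_above (range (\<lambda>m. WL_G0 f m x))"

end

theory Submission
  imports Defs
begin

text \<open>
  Fix \<open>n\<close> and write \<open>s l\<close> for the \<open>l\<close>-th entry of the \<open>n\<close>-th column of the matrix. Peeling off the binary digits
  of \<open>n\<close> from the top splits the kernel into a unimodular multiple of
  \<open>\<Sum>k. b k * (D (2 ^ (k+1)) - D (2 ^ k))\<close>, where \<open>b k\<close> vanishes unless the \<open>k\<close>-th digit of \<open>n\<close> is \<open>1\<close>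
  and is then the sum of \<open>s l\<close> over \<open>l < n mod 2 ^ (k+1)\<close>, and a remainder made of weighted sums of
  Fejer kernels. Both are dominated by \<open>\<Sum>r. c r * G r\<close>, where
  \<open>G r = (\<Sum>i\<le>r. 2 ^ i * 1\<^sub>I)\<close> with \<open>I\<close> the translate of \<open>I\<^sub>r(0)\<close> by \<open>2 ^ -(i+1)\<close>,
  and the total mass of \<open>c\<close> is at most the variation of \<open>b\<close> plus \<open>4\<close>. Integrating
  \<open>\<bar>f u - f x\<bar>\<close> against \<open>G r \<otimes> G q\<close> gives exactly \<open>W\<^sub>r\<^sub>,\<^sub>q f x\<close>. Each \<open>c r\<close> tends to \<open>0\<close> because \<open>t\<^sub>0\<^sub>,\<^sub>n\<close>
  does; so the terms with \<open>r\<close> or \<open>q\<close> small are killed by the bounds on the one-dimensional sums, and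
  the others by the smallness of \<open>W\<^sub>r\<^sub>,\<^sub>q\<close>.

  The variation of \<open>b\<close> is at most \<open>4\<close> times \<open>\<upsilon>\<close>. If one of the operator norms is bounded instead, let
  \<open>2 ^ A\<close> be the leading power of \<open>n\<close>. Testing on \<open>walsh (2 ^ A) * h\<close>, with \<open>h = D (2 ^ A)\<close> for the Hardy space and
  \<open>h\<close> the sign of the kernel of \<open>n - 2 ^ A\<close> for the bounded functions, bounds the \<open>L\<^sub>1\<close> norm of that
  kernel, and this norm controls the variation of \<open>b\<close>.
\<close>

section \<open>Walsh functions and Fejer kernels\<close>

lemma xdigit_less_2: "xdigit x n < 2"
  by (simp add: xdigit_def)

lemma xdigit_cases: "xdigit x n = 0 \<or> xdigit x n = 1"
  using xdigit_less_2[of x n] by auto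

lemma ndigit_eq_0: "n < 2 ^ K \<Longrightarrow> K \<le> k \<Longrightarrow> ndigit k n = 0"
  by (simp add: ndigit_def order_less_le_trans[of n "2 ^ K" "2 ^ k"])

text \<open>Digits of \<open>n\<close> past position \<open>K\<close> vanish, so the cut-off can be
  any dyadic level above \<open>n\<close>; this puts Walsh functions of different index on a common
  range of digits.\<close>

lemma walsh_eq_sum_upto:
  assumes "n < 2 ^ K"
  shows "walsh n x = (-1) ^ (\<Sum>k<K. ndigit k n * xdigit x k)"
proof -
  have "(\<Sum>k<n. ndigit k n * xdigit x k) = (\<Sum>k<max n K. ndigit k n * xdigit x k)"
    using ndigit_eq_0[of n n] by (intro sum.mono_neutral_left) auto
  also have "\<dots> = (\<Sum>k<K. ndigit k n * xdigit x k)"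
    using ndigit_eq_0[OF assms] by (intro sum.mono_neutral_right) auto
  finally show ?thesis
    by (simp add: walsh_def)
qed

lemma walsh_0 [simp]: "walsh 0 x = 1"
  by (simp add: walsh_def)

lemma walsh_add_pow2:
  assumes "m < 2 ^ k"
  shows "walsh (2 ^ k + m) x = (-1) ^ xdigit x k * walsh m x"
proof -
  have "ndigit i (2 ^ k + m) = ndigit i m" if "i < k" for i
  proof -
    \<comment> \<open>Adding \<open>2 ^ k\<close> changes the quotient by \<open>2 ^ i\<close> by an
      even number, hence leaves the \<open>i\<close>-th digit alone.\<close>
    have "(2::nat) ^ k = 2 ^ i * (2 * 2 ^ (k - i - 1))"
      using that by (metis Suc_diff_Suc diff_Suc_eq_diff_pred le_add_diff_inverse
          less_imp_le power_Suc power_add diff_diff_left plus_1_eq_Suc add.commute)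
    then show ?thesis
      by (simp add: ndigit_def)
  qed
  moreover have "ndigit k (2 ^ k + m) = 1"
    using assms by (simp add: ndigit_def)
  ultimately have "(\<Sum>i<Suc k. ndigit i (2 ^ k + m) * xdigit x i) =
      (\<Sum>i<k. ndigit i m * xdigit x i) + xdigit x k"
    by simp
  moreover have "walsh (2 ^ k + m) x = (-1) ^ (\<Sum>i<Suc k. ndigit i (2 ^ k + m) * xdigit x i)"
    using assms by (intro walsh_eq_sum_upto) simp
  ultimately show ?thesis
    using walsh_eq_sum_upto[OF assms, of x] by (simp add: power_add)
qed

lemma walsh_pow2: "walsh (2 ^ k) x = (-1) ^ xdigit x k"
  using walsh_add_pow2[of 0 k x] by simp

lemma walsh_pow2_cases: "walsh (2 ^ k) x = (if xdigit x k = 0 then 1 else -1)"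
  using xdigit_cases[of x k] by (auto simp: walsh_pow2)

lemma walsh_add: "m < 2 ^ k \<Longrightarrow> walsh (2 ^ k + m) x = walsh (2 ^ k) x * walsh m x"
  by (simp add: walsh_add_pow2 walsh_pow2)

lemma walsh_square [simp]: "walsh n x * walsh n x = 1" "walsh n x * (walsh n x * c) = c"
  by (simp_all add: walsh_def flip: power_mult_distrib mult.assoc)

lemma abs_walsh [simp]: "\<bar>walsh n x\<bar> = 1"
  by (simp add: walsh_def power_abs)

lemma less_pow2_SucE:
  fixes m :: nat
  assumes "m < 2 ^ Suc k"
  obtains "m < 2 ^ k" | m' where "m = 2 ^ k + m'" "m' < 2 ^ k"
  using assms by (cases "m < 2 ^ k") (auto dest!: le_Suc_ex simp: not_less)

text \<open>Passing from \<open>m\<close> to \<open>2 ^ k - 1 - m\<close> flips each of the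
  \<open>k\<close> digits, and a flipped digit means one more factor \<open>walsh (2 ^ i)\<close>.
  This allows a block of Walsh functions to be read backwards.\<close>

lemma walsh_reflect:
  "m < 2 ^ k \<Longrightarrow> walsh (2 ^ k - 1 - m) x = walsh (2 ^ k - 1) x * walsh m x"
proof (induction k arbitrary: m)
  case (Suc k)
  have top: "walsh (2 ^ Suc k - 1) x = walsh (2 ^ k) x * walsh (2 ^ k - 1) x"
    using walsh_add[of "2 ^ k - 1" k x] by (simp add: mult_2)
  show ?case
    using Suc.prems
  proof (cases rule: less_pow2_SucE)
    case 1
    then have "2 ^ Suc k - 1 - m = 2 ^ k + (2 ^ k - 1 - m)"
      by simp
    then show ?thesis
      using walsh_add[of "2 ^ k - 1 - m" k x] Suc.IH[OF 1] top by simp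
  next
    case (2 m')
    then have "2 ^ Suc k - 1 - m = 2 ^ k - 1 - m'"
      by simp
    then show ?thesis
      using walsh_add[OF 2(2), of x] Suc.IH[OF 2(2)] top 2(1) by simp
  qed
qed simp

lemma walsh_eq_1:
  assumes "m < 2 ^ k" "\<And>i. i < k \<Longrightarrow> xdigit x i = 0"
  shows "walsh m x = 1"
  using walsh_eq_sum_upto[OF assms(1), of x] assms(2) by simp

lemma walsh_cong:
  assumes "m < 2 ^ k" "\<And>i. i < k \<Longrightarrow> xdigit x i = xdigit y i"
  shows "walsh m x = walsh m y"
  using walsh_eq_sum_upto[OF assms(1)] assms(2) by simp

section \<open>Dirichlet kernels and sums of them\<close>

lemma walsh_dirichlet_0 [simp]: "walsh_dirichlet 0 x = 0"
  by (simp add: walsh_dirichlet_def)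

lemma walsh_dirichlet_add:
  assumes "m \<le> 2 ^ k"
  shows "walsh_dirichlet (2 ^ k + m) x = walsh_dirichlet (2 ^ k) x + walsh (2 ^ k) x * walsh_dirichlet m x"
proof -
  have "walsh_dirichlet (2 ^ k + m) x =
      walsh_dirichlet (2 ^ k) x + (\<Sum>j\<in>{2 ^ k..<2 ^ k + m}. walsh j x)"
    unfolding walsh_dirichlet_def
    by (subst sum.union_disjoint[symmetric]) (auto intro!: sum.cong)
  also have "(\<Sum>j\<in>{2 ^ k..<2 ^ k + m}. walsh j x) = (\<Sum>j<m. walsh (2 ^ k + j) x)"
    by (intro sum.reindex_bij_witness[of _ "\<lambda>j. 2 ^ k + j" "\<lambda>j. j - 2 ^ k"]) auto
  also have "\<dots> = (\<Sum>j<m. walsh (2 ^ k) x * walsh j x)"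
    using assms by (intro sum.cong walsh_add) auto
  finally show ?thesis
    by (simp add: walsh_dirichlet_def sum_distrib_left)
qed

lemma walsh_dirichlet_Suc_pow2:
  "walsh_dirichlet (2 ^ Suc k) x = (1 + walsh (2 ^ k) x) * walsh_dirichlet (2 ^ k) x"
  using walsh_dirichlet_add[of "2 ^ k" k x] by (simp add: algebra_simps flip: mult_2)

text \<open>Paley's formula: the kernel is the product of the factors
  \<open>1 + walsh (2 ^ i)\<close>, \<open>i < k\<close>, each of which is 2 or 0.\<close>

lemma walsh_dirichlet_pow2:
  "walsh_dirichlet (2 ^ k) x = (if \<forall>i<k. xdigit x i = 0 then 2 ^ k else 0)"
proof (induction k)
  case 0
  show ?case by (simp add: walsh_dirichlet_def)
next
  case (Suc k)
  show ?case
    unfolding walsh_dirichlet_Suc_pow2 Suc.IH walsh_pow2_cases by (auto simp: less_Suc_eq)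
qed

text \<open>The last \<open>j\<close> Walsh functions below \<open>2 ^ k\<close>, taken in reverse
  order, are a unimodular multiple of the first \<open>j\<close>.\<close>

lemma walsh_dirichlet_diff:
  assumes "j \<le> 2 ^ k"
  shows "walsh_dirichlet (2 ^ k - j) x =
    walsh_dirichlet (2 ^ k) x - walsh (2 ^ k - 1) x * walsh_dirichlet j x"
proof -
  have "walsh_dirichlet (2 ^ k) x =
      (\<Sum>i<2 ^ k - j. walsh i x) + (\<Sum>i\<in>{2 ^ k - j..<2 ^ k}. walsh i x)"
    unfolding walsh_dirichlet_def using assms
    by (subst sum.union_disjoint[symmetric]) (auto intro!: sum.cong)
  also have "(\<Sum>i\<in>{2 ^ k - j..<2 ^ k}. walsh i x) = (\<Sum>i<j. walsh (2 ^ k - 1 - i) x)"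
    using assms
    by (intro sum.reindex_bij_witness[of _ "\<lambda>i. 2 ^ k - 1 - i" "\<lambda>i. 2 ^ k - 1 - i"]) auto
  also have "\<dots> = (\<Sum>i<j. walsh (2 ^ k - 1) x * walsh i x)"
    using assms by (intro sum.cong walsh_reflect) auto
  finally show ?thesis
    by (simp add: walsh_dirichlet_def sum_distrib_left)
qed

text \<open>
  For \<open>i < r\<close> the condition describes \<open>I\<^sub>r(2 ^ -(i+1))\<close>, while for \<open>i = r\<close> it describes \<open>I\<^sub>r(0)\<close>.
\<close>

definition cyl_kernel :: "nat \<Rightarrow> real \<Rightarrow> real" where
  "cyl_kernel r z = (\<Sum>i\<le>r. 2 ^ i * of_bool (\<forall>k<r. xdigit z k = of_bool (k = i)))"

lemma cyl_kernel_nonneg: "0 \<le> cyl_kernel r z"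
  by (auto simp: cyl_kernel_def intro!: sum_nonneg)

lemma walsh_dirichlet_pow2_nonneg: "0 \<le> walsh_dirichlet (2 ^ k) z"
  by (simp add: walsh_dirichlet_pow2)

lemma walsh_dirichlet_pow2_le_cyl_kernel: "walsh_dirichlet (2 ^ k) z \<le> cyl_kernel k z"
proof -
  have "walsh_dirichlet (2 ^ k) z = (\<Sum>i\<in>{k}. 2 ^ i * of_bool (\<forall>l<k. xdigit z l = of_bool (l = i)))"
    by (auto simp: walsh_dirichlet_pow2)
  also have "\<dots> \<le> cyl_kernel k z"
    unfolding cyl_kernel_def by (intro sum_mono2) auto
  finally show ?thesis .
qed

text \<open>This is \<open>j\<close> times the Fejer kernel of order \<open>j\<close>; leaving out
  the normalisation keeps the recursions free of quotients.\<close>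

definition dirichlet_sum :: "nat \<Rightarrow> real \<Rightarrow> real" where
  "dirichlet_sum j z = (\<Sum>i\<le>j. walsh_dirichlet i z)"

lemma dirichlet_sum_add:
  assumes "m \<le> 2 ^ k"
  shows "dirichlet_sum (2 ^ k + m) z =
    dirichlet_sum (2 ^ k) z + m * walsh_dirichlet (2 ^ k) z + walsh (2 ^ k) z * dirichlet_sum m z"
  using assms
proof (induction m)
  case (Suc m)
  have "dirichlet_sum (2 ^ k + Suc m) z =
      dirichlet_sum (2 ^ k + m) z + walsh_dirichlet (2 ^ k + Suc m) z"
    by (simp add: dirichlet_sum_def)
  also have "\<dots> = dirichlet_sum (2 ^ k + m) z
      + (walsh_dirichlet (2 ^ k) z + walsh (2 ^ k) z * walsh_dirichlet (Suc m) z)"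
    by (simp only: walsh_dirichlet_add[OF Suc.prems])
  finally show ?case
    using Suc by (simp add: dirichlet_sum_def algebra_simps)
qed (simp add: dirichlet_sum_def)

lemma digits_unit_ge:
  fixes d :: "nat \<Rightarrow> nat"
  shows "k \<le> i \<Longrightarrow> (\<forall>l<k. d l = of_bool (l = i)) \<longleftrightarrow> (\<forall>l<k. d l = 0)"
  by (intro all_cong) auto

lemma digits_unit_Suc:
  fixes d :: "nat \<Rightarrow> nat"
  shows "i < k \<Longrightarrow> (\<forall>l<Suc k. d l = of_bool (l = i)) \<longleftrightarrow> d k = 0 \<and> (\<forall>l<k. d l = of_bool (l = i))"
    and "(\<forall>l<Suc k. d l = of_bool (l = k)) \<longleftrightarrow> d k = 1 \<and> (\<forall>l<k. d l = 0)"
    and "(\<forall>l<Suc k. d l = of_bool (l = Suc k)) \<longleftrightarrow> d k = 0 \<and> (\<forall>l<k. d l = 0)"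
  unfolding digits_unit_ge[OF order_refl] All_less_Suc by simp_all

text \<open>The left side has the shape of the recursion that doubles the order of a Fejer kernel,
  so this is the induction step for the bound on \<open>dirichlet_sum (2 ^ k)\<close>.\<close>

lemma cyl_kernel_Suc:
  "2 * of_bool (xdigit z k = 0) * cyl_kernel k z + walsh_dirichlet (2 ^ k) z \<le> 2 * cyl_kernel (Suc k) z"
proof -
  let ?c = "\<lambda>i k. of_bool (\<forall>l<k. xdigit z l = of_bool (l = i)) :: real"
  let ?b = "\<lambda>e. of_bool (xdigit z k = e) :: real"
  let ?A = "\<Sum>i<k. 2 ^ i * ?c i k" and ?O = "of_bool (\<forall>l<k. xdigit z l = 0) :: real"
  have "cyl_kernel (Suc k) z = (\<Sum>i<k. 2 ^ i * ?c i (Suc k)) + 2 ^ k * ?c k (Suc k)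
      + 2 ^ Suc k * ?c (Suc k) (Suc k)"
    unfolding cyl_kernel_def lessThan_Suc_atMost[symmetric] by (simp only: sum.lessThan_Suc)
  also have "(\<Sum>i<k. 2 ^ i * ?c i (Suc k)) = ?b 0 * ?A"
    unfolding sum_distrib_left
    by (intro sum.cong refl) (simp only: lessThan_iff digits_unit_Suc(1) of_bool_conj mult_ac)
  also have "?c k (Suc k) = ?b 1 * ?O"
    by (simp only: digits_unit_Suc(2) of_bool_conj)
  also have "?c (Suc k) (Suc k) = ?b 0 * ?O"
    by (simp only: digits_unit_Suc(3) of_bool_conj)
  finally have 1: "cyl_kernel (Suc k) z = ?b 0 * ?A + 2 ^ k * (?b 1 * ?O) + 2 ^ Suc k * (?b 0 * ?O)" .
  have "cyl_kernel k z = ?A + 2 ^ k * ?c k k"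
    unfolding cyl_kernel_def lessThan_Suc_atMost[symmetric] by (simp only: sum.lessThan_Suc)
  also have "?c k k = ?O"
    by (simp only: digits_unit_ge order_refl)
  finally have 2: "cyl_kernel k z = ?A + 2 ^ k * ?O" .
  have 3: "walsh_dirichlet (2 ^ k) z = 2 ^ k * ?O"
    by (simp add: walsh_dirichlet_pow2)
  \<comment> \<open>With \<open>A\<close> and \<open>P\<close> abstract, only two cases remain: for
    digit 0 the claim is \<open>2 * A + 3 * P\<close> at most \<open>2 * A + 4 * P\<close>, for
    digit 1 it is \<open>P\<close> at most \<open>2 * P\<close>.\<close>
  define A where "A = ?A"
  define P where "P = 2 ^ k * ?O"
  have "0 \<le> P"
    by (simp add: P_def)
  moreover have "?b 0 = 1 \<and> ?b 1 = 0 \<or> ?b 0 = 0 \<and> ?b 1 = 1"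
    using xdigit_cases[of z k] by auto
  moreover have "cyl_kernel (Suc k) z = ?b 0 * A + ?b 1 * P + 2 * (?b 0 * P)"
    unfolding 1 A_def P_def by (simp only: power_Suc mult_ac)
  moreover have "cyl_kernel k z = A + P" "walsh_dirichlet (2 ^ k) z = P"
    unfolding 2 3 A_def P_def by simp_all
  ultimately show ?thesis
    by (elim disjE conjE) simp_all
qed

lemma abs_dirichlet_sum_pow2_le: "\<bar>dirichlet_sum (2 ^ k) z\<bar> \<le> 2 ^ k * cyl_kernel k z"
proof (induction k)
  case 0
  show ?case by (simp add: dirichlet_sum_def walsh_dirichlet_def cyl_kernel_def)
next
  case (Suc k)
  let ?b = "of_bool (xdigit z k = 0) :: real"
  have "dirichlet_sum (2 ^ Suc k) z = 2 * ?b * dirichlet_sum (2 ^ k) z + 2 ^ k * walsh_dirichlet (2 ^ k) z"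
    using dirichlet_sum_add[of "2 ^ k" k z] xdigit_cases[of z k]
    by (auto simp: walsh_pow2_cases simp flip: mult_2)
  also have "\<bar>\<dots>\<bar> \<le> 2 * ?b * \<bar>dirichlet_sum (2 ^ k) z\<bar> + 2 ^ k * walsh_dirichlet (2 ^ k) z"
    using walsh_dirichlet_pow2_nonneg[of k z] by (auto simp: abs_mult intro: order_trans[OF abs_triangle_ineq])
  also have "\<dots> \<le> 2 * ?b * (2 ^ k * cyl_kernel k z) + 2 ^ k * walsh_dirichlet (2 ^ k) z"
    using Suc.IH by (intro add_right_mono mult_left_mono) auto
  also have "\<dots> = 2 ^ k * (2 * ?b * cyl_kernel k z + walsh_dirichlet (2 ^ k) z)"
    by (simp add: algebra_simps)
  also have "\<dots> \<le> 2 ^ k * (2 * cyl_kernel (Suc k) z)"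
    by (intro mult_left_mono cyl_kernel_Suc) auto
  finally show ?case by (simp add: algebra_simps)
qed

text \<open>Splitting off the top power \<open>2 ^ K\<close> of \<open>j\<close> costs
  \<open>2 ^ K * cyl_kernel K z\<close> twice: once for the Fejer sum of order \<open>2 ^ K\<close>
  and once for the multiple of \<open>walsh_dirichlet (2 ^ K)\<close>. The remainder is left to the
  induction.\<close>

lemma abs_dirichlet_sum_le_aux:
  "j < 2 ^ K \<Longrightarrow> \<bar>dirichlet_sum j z\<bar> \<le> 2 * (\<Sum>r | r < K \<and> 2 ^ r \<le> j. 2 ^ r * cyl_kernel r z)"
proof (induction K arbitrary: j)
  case 0
  then show ?case by (simp add: dirichlet_sum_def)
next
  case (Suc K)
  show ?case using Suc.prems
  proof (cases rule: less_pow2_SucE)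
    case 1
    then have "{r. r < Suc K \<and> 2 ^ r \<le> j} = {r. r < K \<and> 2 ^ r \<le> j}"
      by (auto simp: less_Suc_eq)
    with Suc.IH[OF 1] show ?thesis by simp
  next
    case (2 m)
    have all: "{r. r < Suc K \<and> 2 ^ r \<le> j} = {..<Suc K}"
    proof -
      have "2 ^ r \<le> (2::nat) ^ K" if "r < Suc K" for r
        using that by (intro power_increasing) auto
      then show ?thesis using 2 by (fastforce intro: trans_le_add1)
    qed
    have "\<bar>dirichlet_sum j z\<bar> \<le> \<bar>dirichlet_sum (2 ^ K) z\<bar> + m * walsh_dirichlet (2 ^ K) z + \<bar>dirichlet_sum m z\<bar>"
      unfolding 2(1) dirichlet_sum_add[OF less_imp_le[OF 2(2)]]
      using walsh_dirichlet_pow2_nonneg[of K z]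
      by (intro order_trans[OF abs_triangle_ineq] add_mono) (auto simp: abs_mult)
    also have "m * walsh_dirichlet (2 ^ K) z \<le> 2 ^ K * cyl_kernel K z"
    proof -
      have "real m \<le> 2 ^ K"
        using 2(2) by (simp add: less_imp_le flip: of_nat_less_iff of_nat_le_iff)
      then show ?thesis
        using walsh_dirichlet_pow2_le_cyl_kernel walsh_dirichlet_pow2_nonneg
        by (intro mult_mono) auto
    qed
    also note abs_dirichlet_sum_pow2_le[of K z]
    also have "\<bar>dirichlet_sum m z\<bar> \<le> 2 * (\<Sum>r<K. 2 ^ r * cyl_kernel r z)"
      by (rule order_trans[OF Suc.IH[OF 2(2)]], intro mult_left_mono sum_mono2)
        (auto simp: cyl_kernel_nonneg)
    finally show ?thesis
      unfolding all by (simp add: algebra_simps)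
  qed
qed

text \<open>The preceding bound increases only when \<open>j\<close> reaches a power of two. Writing
  it as a sum of such increments over \<open>i\<close> up to \<open>j\<close> prepares it for
  summation by parts.\<close>

lemma abs_dirichlet_sum_le:
  "\<bar>dirichlet_sum j z\<bar> \<le> (\<Sum>i\<in>{1..j}. \<Sum>r<K. of_bool (i = 2 ^ r) * (2 * 2 ^ r * cyl_kernel r z))"
  if "j < 2 ^ K"
proof -
  have "(\<Sum>i\<in>{1..j}. of_bool (i = 2 ^ r)) = (of_bool (2 ^ r \<le> j) :: real)" for r
  proof -
    have "(\<Sum>i\<in>{1..j}. of_bool (i = 2 ^ r)) = (\<Sum>i\<in>{1..j}. if i = 2 ^ r then 1 else (0::real))"
      by (intro sum.cong) auto
    then show ?thesis by (simp add: sum.delta)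
  qed
  then have "(\<Sum>i\<in>{1..j}. \<Sum>r<K. of_bool (i = 2 ^ r) * (2 * 2 ^ r * cyl_kernel r z)) =
     (\<Sum>r<K. of_bool (2 ^ r \<le> j) * (2 * 2 ^ r * cyl_kernel r z))"
    by (subst sum.swap) (simp flip: sum_distrib_right)
  also have "\<dots> = 2 * (\<Sum>r | r < K \<and> 2 ^ r \<le> j. 2 ^ r * cyl_kernel r z)"
  proof -
    have "{r. r < K \<and> 2 ^ r \<le> j} = {r\<in>{..<K}. 2 ^ r \<le> j}" by auto
    then show ?thesis
      unfolding sum_distrib_left by (simp only: sum.inter_filter[OF finite_lessThan]) (intro sum.cong; simp)
  qed
  finally show ?thesis
    using abs_dirichlet_sum_le_aux[OF that] by simp
qed

section \<open>Summation by parts against decreasing weights\<close>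

lemma abel_bound:
  fixes s d b :: "nat \<Rightarrow> real"
  assumes dec: "\<And>i. s (Suc i) \<le> s i" and nonneg: "\<And>i. 0 \<le> s i"
    and bound: "\<And>j. j \<le> m \<Longrightarrow> \<bar>\<Sum>i\<in>{1..j}. d i\<bar> \<le> (\<Sum>i\<in>{1..j}. b i)"
  shows "\<bar>\<Sum>i\<in>{1..m}. s i * d i\<bar> \<le> (\<Sum>i\<in>{1..m}. s i * b i)"
proof -
  \<comment> \<open>Subtracting the boundary term makes the induction work: from \<open>m\<close> to
    \<open>Suc m\<close> the difference gains exactly \<open>s m - s (Suc m)\<close>, which is
    nonnegative, times the partial sum up to \<open>m\<close>.\<close>
  have "\<bar>(\<Sum>i\<in>{1..m}. s i * d i) - s m * (\<Sum>i\<in>{1..m}. d i)\<bar>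
      \<le> (\<Sum>i\<in>{1..m}. s i * b i) - s m * (\<Sum>i\<in>{1..m}. b i)"
    using bound
  proof (induction m)
    case (Suc m)
    let ?d = "\<lambda>m. \<Sum>i\<in>{1..m}. d i" and ?b = "\<lambda>m. \<Sum>i\<in>{1..m}. b i"
    have "\<bar>(s m - s (Suc m)) * ?d m\<bar> \<le> (s m - s (Suc m)) * ?b m"
      using dec[of m] Suc.prems[of m] by (auto simp: abs_mult intro!: mult_left_mono)
    moreover have "\<bar>(\<Sum>i\<in>{1..m}. s i * d i) - s m * ?d m\<bar> \<le> (\<Sum>i\<in>{1..m}. s i * b i) - s m * ?b m"
      using Suc by simp
    ultimately show ?case
      by (simp add: algebra_simps)
  qed simp
  moreover have "\<bar>s m * (\<Sum>i\<in>{1..m}. d i)\<bar> \<le> s m * (\<Sum>i\<in>{1..m}. b i)"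
    using nonneg[of m] bound[of m] by (auto simp: abs_mult intro!: mult_left_mono)
  ultimately show ?thesis by linarith
qed

text \<open>The increments that dominate the Fejer sums sit at the powers of two, so after summation
  by parts only the weights \<open>s (2 ^ r)\<close> survive.\<close>

lemma abs_weighted_dirichlet_le:
  fixes s :: "nat \<Rightarrow> real"
  assumes dec: "\<And>i. s (Suc i) \<le> s i" and nonneg: "\<And>i. 0 \<le> s i"
  shows "\<bar>\<Sum>j\<in>{1..<2 ^ K}. s j * walsh_dirichlet j z\<bar> \<le> (\<Sum>r<K. 2 * 2 ^ r * s (2 ^ r) * cyl_kernel r z)"
proof -
  let ?b = "\<lambda>i. \<Sum>r<K. of_bool (i = 2 ^ r) * (2 * 2 ^ r * cyl_kernel r z)"
  have interval: "{1..<2 ^ K} = {1..2 ^ K - 1::nat}"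
    by auto
  have "\<bar>\<Sum>j\<in>{1..2 ^ K - 1}. s j * walsh_dirichlet j z\<bar> \<le> (\<Sum>j\<in>{1..2 ^ K - 1}. s j * ?b j)"
  proof (rule abel_bound)
    show "s (Suc i) \<le> s i" "0 \<le> s i" for i
      by (rule dec, rule nonneg)
    fix j :: nat assume "j \<le> 2 ^ K - 1"
    then have "j < 2 ^ K"
      by (metis Suc_pred' le_imp_less_Suc zero_less_numeral zero_less_power)
    moreover have "dirichlet_sum j z = (\<Sum>i\<in>{1..j}. walsh_dirichlet i z)"
      unfolding dirichlet_sum_def by (intro sum.mono_neutral_right) (auto simp: not_less_eq_eq)
    ultimately show "\<bar>\<Sum>i\<in>{1..j}. walsh_dirichlet i z\<bar> \<le> (\<Sum>i\<in>{1..j}. ?b i)"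
      using abs_dirichlet_sum_le[of j K z] by simp
  qed
  also have "(\<Sum>j\<in>{1..2 ^ K - 1}. s j * ?b j) =
     (\<Sum>r<K. \<Sum>j\<in>{1..2 ^ K - 1::nat}. of_bool (j = 2 ^ r) * (2 * 2 ^ r * s (2 ^ r) * cyl_kernel r z))"
    unfolding sum_distrib_left by (subst sum.swap) (intro sum.cong; simp)
  also have "\<dots> \<le> (\<Sum>r<K. 2 * 2 ^ r * s (2 ^ r) * cyl_kernel r z)"
  proof (intro sum_mono)
    fix r
    have "(\<Sum>j\<in>{1..2 ^ K - 1::nat}. of_bool (j = 2 ^ r)) = (\<Sum>j\<in>{1..2 ^ K - 1::nat}. if j = 2 ^ r then 1 else 0::real)"
      by (intro sum.cong) auto
    also have "\<dots> \<le> 1" by (simp add: sum.delta)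
    finally show "(\<Sum>j\<in>{1..2 ^ K - 1::nat}. of_bool (j = 2 ^ r) * (2 * 2 ^ r * s (2 ^ r) * cyl_kernel r z))
        \<le> 2 * 2 ^ r * s (2 ^ r) * cyl_kernel r z"
      using nonneg cyl_kernel_nonneg by (simp only: sum_distrib_right[symmetric]) (intro mult_left_le_one_le; simp add: sum_nonneg)
  qed
  finally show ?thesis
    unfolding interval .
qed

section \<open>Decomposition of the kernels\<close>

text \<open>The order \<open>m\<close> is decoupled from the column that supplies the weights:
  removing the leading digit of \<open>n\<close> lowers the order but keeps
  \<open>s\<close>.\<close>

definition nkernel :: "(nat \<Rightarrow> real) \<Rightarrow> nat \<Rightarrow> real \<Rightarrow> real" where
  "nkernel s m z = (\<Sum>l<m. s l * walsh_dirichlet (m - l) z)"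

lemma matrix_kernel_eq_nkernel: "matrix_kernel t n z = nkernel (\<lambda>l. t l n) n z"
  unfolding matrix_kernel_def nkernel_def
  by (intro sum.reindex_bij_witness[of _ "\<lambda>l. n - l" "\<lambda>k. n - k"]) auto

lemma sum_lessThan_add:
  fixes g :: "nat \<Rightarrow> real"
  shows "(\<Sum>l<a + m. g l) = (\<Sum>l<m. g l) + (\<Sum>j<a. g (m + j))"
proof -
  have "(\<Sum>l<a + m. g l) = (\<Sum>l<m. g l) + (\<Sum>l\<in>{m..<a + m}. g l)"
    by (subst sum.union_disjoint[symmetric]) (auto intro!: sum.cong)
  also have "(\<Sum>l\<in>{m..<a + m}. g l) = (\<Sum>j<a. g (m + j))"
    by (intro sum.reindex_bij_witness[of _ "\<lambda>j. m + j" "\<lambda>l. l - m"]) auto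
  finally show ?thesis .
qed

text \<open>For \<open>l < m\<close> the order is \<open>2 ^ k\<close> plus \<open>m - l\<close>;
  for \<open>l = m + j\<close> it is \<open>2 ^ k - j\<close>. The two ranges call for
  \<open>walsh_dirichlet_add\<close> and \<open>walsh_dirichlet_diff\<close>, and together they give
  the kernel at \<open>2 ^ k\<close> the full sum of the weights.\<close>

lemma nkernel_add:
  assumes "m < 2 ^ k"
  shows "nkernel s (2 ^ k + m) z = (\<Sum>l<2 ^ k + m. s l) * walsh_dirichlet (2 ^ k) z
    + walsh (2 ^ k) z * nkernel s m z
    - walsh (2 ^ k - 1) z * (\<Sum>j\<in>{1..<2 ^ k}. s (m + j) * walsh_dirichlet j z)"
proof -
  let ?D = "walsh_dirichlet (2 ^ k) z" and ?w = "walsh (2 ^ k) z" and ?v = "walsh (2 ^ k - 1) z"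
  have "nkernel s (2 ^ k + m) z = (\<Sum>l<m. s l * walsh_dirichlet (2 ^ k + (m - l)) z)
      + (\<Sum>j<2 ^ k. s (m + j) * walsh_dirichlet (2 ^ k - j) z)"
    unfolding nkernel_def sum_lessThan_add by simp
  also have "(\<Sum>l<m. s l * walsh_dirichlet (2 ^ k + (m - l)) z) =
      (\<Sum>l<m. s l * ?D + ?w * (s l * walsh_dirichlet (m - l) z))"
    using assms by (intro sum.cong refl, subst walsh_dirichlet_add) (auto simp: distrib_left mult_ac)
  also have "\<dots> = (\<Sum>l<m. s l) * ?D + ?w * nkernel s m z"
    by (simp add: sum.distrib sum_distrib_left sum_distrib_right nkernel_def)
  also have "(\<Sum>j<2 ^ k. s (m + j) * walsh_dirichlet (2 ^ k - j) z) =
      (\<Sum>j<2 ^ k. s (m + j) * ?D - ?v * (s (m + j) * walsh_dirichlet j z))"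
    by (intro sum.cong) (simp_all add: walsh_dirichlet_diff algebra_simps)
  also have "\<dots> = (\<Sum>j<2 ^ k. s (m + j)) * ?D - ?v * (\<Sum>j<2 ^ k. s (m + j) * walsh_dirichlet j z)"
    by (simp add: sum_subtractf sum_distrib_left sum_distrib_right)
  also have "(\<Sum>j<2 ^ k. s (m + j) * walsh_dirichlet j z) = (\<Sum>j\<in>{1..<2 ^ k}. s (m + j) * walsh_dirichlet j z)"
    by (intro sum.mono_neutral_right) (auto simp: not_less_eq_eq)
  finally show ?thesis
    unfolding sum_lessThan_add[of s] by (simp add: distrib_right)
qed

definition block_weight :: "(nat \<Rightarrow> real) \<Rightarrow> nat \<Rightarrow> nat \<Rightarrow> real" where
  "block_weight s n k = of_bool (odd (n div 2 ^ k)) * (\<Sum>l<n mod 2 ^ Suc k. s l)"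

text \<open>Convolution with the bracket is the \<open>k\<close>-th dyadic martingale difference, so
  this is the kernel of a martingale transform with multipliers \<open>b\<close>.\<close>

definition martingale_part :: "(nat \<Rightarrow> real) \<Rightarrow> nat \<Rightarrow> real \<Rightarrow> real" where
  "martingale_part b K z = (\<Sum>k<K. b k * (walsh_dirichlet (2 ^ Suc k) z - walsh_dirichlet (2 ^ k) z))"

lemma mod_pow2_Suc: "(n::nat) mod 2 ^ Suc k = (if odd (n div 2 ^ k) then 2 ^ k + n mod 2 ^ k else n mod 2 ^ k)"
proof -
  have "n mod 2 ^ Suc k = 2 ^ k * (n div 2 ^ k mod 2) + n mod 2 ^ k"
    using mod_mult2_eq[of n "2 ^ k" 2] by (simp add: mult.commute)
  then show ?thesis
    by (auto simp: mod2_eq_if)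
qed

text \<open>
  The step over a digit \<open>1\<close> in position \<open>k\<close> uses \<open>w * D (2 ^ k) = D (2 ^ (k+1)) - D (2 ^ k)\<close> for
  \<open>w = walsh (2 ^ k)\<close>, and that \<open>walsh m\<close> is \<open>1\<close> on the support of \<open>D (2 ^ k)\<close> when \<open>m < 2 ^ k\<close>.
\<close>

lemma nkernel_martingale_diff:
  assumes dec: "\<And>i. s (Suc i) \<le> s i" and nonneg: "\<And>i. 0 \<le> s i"
  shows "\<bar>nkernel s (n mod 2 ^ K) z - walsh (n mod 2 ^ K) z * martingale_part (block_weight s n) K z\<bar>
    \<le> (\<Sum>i<K. of_bool (odd (n div 2 ^ i)) *
        (\<Sum>r<i. 2 * 2 ^ r * s (n mod 2 ^ i + 2 ^ r) * cyl_kernel r z))"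
proof (induction K)
  case 0
  show ?case by (simp add: nkernel_def martingale_part_def)
next
  case (Suc k)
  define m where "m = n mod 2 ^ k"
  have m: "m < 2 ^ k"
    by (simp add: m_def)
  let ?M = "martingale_part (block_weight s n)"
  show ?case
  proof (cases "odd (n div 2 ^ k)")
    case False
    then show ?thesis
      using Suc.IH by (simp add: mod_pow2_Suc martingale_part_def block_weight_def del: power_Suc)
  next
    case True
    let ?D = "walsh_dirichlet (2 ^ k) z" and ?w = "walsh (2 ^ k) z"
    let ?Q = "\<Sum>j\<in>{1..<2 ^ k}. s (m + j) * walsh_dirichlet j z"
    have n: "n mod 2 ^ Suc k = 2 ^ k + m"
      using True by (simp add: mod_pow2_Suc m_def del: power_Suc)
    have D: "walsh_dirichlet (2 ^ Suc k) z - ?D = ?w * ?D"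
      unfolding walsh_dirichlet_Suc_pow2 by (simp add: algebra_simps)
    have wD: "walsh m z * ?D = ?D"
      using walsh_eq_1[OF m] by (auto simp: walsh_dirichlet_pow2)
    have "?M (Suc k) z = ?M k z + (\<Sum>l<2 ^ k + m. s l) * (?w * ?D)"
      using True by (simp add: martingale_part_def block_weight_def n D del: power_Suc)
    then have "walsh (2 ^ k + m) z * ?M (Suc k) z =
        ?w * (walsh m z * ?M k z) + (\<Sum>l<2 ^ k + m. s l) * ((?w * ?w) * (walsh m z * ?D))"
      unfolding walsh_add[OF m] by (simp only: distrib_left mult_ac)
    then have M: "walsh (2 ^ k + m) z * ?M (Suc k) z =
        ?w * (walsh m z * ?M k z) + (\<Sum>l<2 ^ k + m. s l) * ?D"
      by (simp only: wD walsh_square mult_1)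
    have "nkernel s (2 ^ k + m) z - walsh (2 ^ k + m) z * ?M (Suc k) z =
       ?w * (nkernel s m z - walsh m z * ?M k z) - walsh (2 ^ k - 1) z * ?Q"
      unfolding M nkernel_add[OF m] by (simp add: algebra_simps)
    also have "\<bar>\<dots>\<bar> \<le> \<bar>nkernel s m z - walsh m z * ?M k z\<bar> + \<bar>?Q\<bar>"
      by (rule order_trans[OF abs_triangle_ineq4]) (simp add: abs_mult)
    also have "\<bar>?Q\<bar> \<le> (\<Sum>r<k. 2 * 2 ^ r * s (m + 2 ^ r) * cyl_kernel r z)"
      by (rule abs_weighted_dirichlet_le) (use dec nonneg in auto)
    also note Suc.IH[folded m_def]
    finally show ?thesis
      using True unfolding n by (simp add: m_def)
  qed
qed

section \<open>Upper bound and values of the martingale part\<close>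

definition jump :: "(nat \<Rightarrow> real) \<Rightarrow> nat \<Rightarrow> real" where
  "jump b r = (case r of 0 \<Rightarrow> b 0 | Suc p \<Rightarrow> b (Suc p) - b p)"

lemma jump_simps [simp]: "jump b 0 = b 0" "jump b (Suc p) = b (Suc p) - b p"
  by (simp_all add: jump_def)

lemma martingale_part_Abel:
  "martingale_part b K z = b K * walsh_dirichlet (2 ^ K) z - (\<Sum>r\<le>K. jump b r * walsh_dirichlet (2 ^ r) z)"
  by (induction K) (simp_all add: martingale_part_def algebra_simps del: power_Suc)

text \<open>With the boundary term gone, summation by parts bounds the kernel through the variation
  of \<open>b\<close>, the first jump being counted from 0.\<close>

lemma abs_martingale_part_le:
  assumes "b K = 0"
  shows "\<bar>martingale_part b K z\<bar> \<le> (\<Sum>r\<le>K. \<bar>jump b r\<bar> * cyl_kernel r z)"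
proof -
  have "\<bar>martingale_part b K z\<bar> \<le> (\<Sum>r\<le>K. \<bar>jump b r * walsh_dirichlet (2 ^ r) z\<bar>)"
    unfolding martingale_part_Abel using assms by simp
  also have "\<dots> \<le> (\<Sum>r\<le>K. \<bar>jump b r\<bar> * cyl_kernel r z)"
    using walsh_dirichlet_pow2_nonneg walsh_dirichlet_pow2_le_cyl_kernel
    by (intro sum_mono) (auto simp: abs_mult intro!: mult_left_mono)
  finally show ?thesis .
qed

text \<open>The digits place \<open>z\<close> in the shell from \<open>2 ^ -(p+1)\<close> to
  \<open>2 ^ -p\<close>. There \<open>walsh_dirichlet (2 ^ k)\<close> is \<open>2 ^ k\<close> up to
  \<open>k = p\<close> and 0 beyond, so the difference with index \<open>p\<close> is the only
  negative one and all later ones vanish.\<close>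

lemma martingale_part_value:
  assumes "p < K" "\<And>i. i < p \<Longrightarrow> xdigit z i = 0" "xdigit z p = 1"
  shows "martingale_part b K z = (\<Sum>k<p. b k * 2 ^ k) - b p * 2 ^ p"
proof -
  have D: "walsh_dirichlet (2 ^ k) z = (if k \<le> p then 2 ^ k else 0)" for k
    unfolding walsh_dirichlet_pow2 using assms(2,3) by (auto simp: not_le)
  have "martingale_part b K z = (\<Sum>k<Suc p. b k * (walsh_dirichlet (2 ^ Suc k) z - walsh_dirichlet (2 ^ k) z))"
    unfolding martingale_part_def using assms(1)
    by (intro sum.mono_neutral_right) (auto simp: D simp del: power_Suc)
  also have "\<dots> = (\<Sum>k<p. b k * 2 ^ k) - b p * 2 ^ p"
    by (simp add: D del: power_Suc) (simp add: algebra_simps)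
  finally show ?thesis .
qed

definition tail_coeff :: "(nat \<Rightarrow> real) \<Rightarrow> nat \<Rightarrow> nat \<Rightarrow> nat \<Rightarrow> real" where
  "tail_coeff s n K r =
     2 * 2 ^ r * (\<Sum>i\<in>{Suc r..<K}. of_bool (odd (n div 2 ^ i)) * s (n mod 2 ^ i + 2 ^ r))"

text \<open>Exchanging the sums collects everything that multiplies \<open>g r\<close>. The index
  \<open>r = K\<close> only adds an empty sum; it aligns the range with that of the jumps.\<close>

lemma tail_coeff_sum:
  "(\<Sum>i<K. of_bool (odd (n div 2 ^ i)) * (\<Sum>r<i. 2 * 2 ^ r * s (n mod 2 ^ i + 2 ^ r) * g r)) =
   (\<Sum>r\<le>K. tail_coeff s n K r * g r)"
proof -
  let ?h = "\<lambda>i r. of_bool (odd (n div 2 ^ i)) * (2 * 2 ^ r * s (n mod 2 ^ i + 2 ^ r) * g r)"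
  have "(\<Sum>i<K. \<Sum>r<i. ?h i r) = (\<Sum>r<K. \<Sum>i\<in>{Suc r..<K}. ?h i r)"
    unfolding sum.Sigma[OF finite_lessThan ballI[OF finite_lessThan]] sum.Sigma[OF finite_lessThan ballI[OF finite_atLeastLessThan]]
    by (intro sum.reindex_bij_witness[of _ "\<lambda>(r, i). (i, r)" "\<lambda>(i, r). (r, i)"]) auto
  also have "\<dots> = (\<Sum>r<K. tail_coeff s n K r * g r)"
    unfolding tail_coeff_def sum_distrib_left sum_distrib_right by (intro sum.cong refl) (simp add: mult_ac)
  also have "\<dots> = (\<Sum>r\<le>K. tail_coeff s n K r * g r)"
    by (intro sum.mono_neutral_left) (auto simp: tail_coeff_def)
  finally show ?thesis
    by (simp add: sum_distrib_left)
qed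

section \<open>Size of the dominating coefficients for a single column\<close>

locale averaging_weights =
  fixes s :: "nat \<Rightarrow> real" and n :: nat
  assumes nonneg: "0 \<le> s i" and Suc_le: "s (Suc i) \<le> s i" and sum_1: "(\<Sum>l\<le>n. s l) = 1"
begin

abbreviation b :: "nat \<Rightarrow> real" where "b \<equiv> block_weight s n"

definition coeff :: "nat \<Rightarrow> real" where
  "coeff r = \<bar>jump b r\<bar> + tail_coeff s n (Suc (floor_log n)) r"

definition variation :: real where
  "variation = (\<Sum>r\<le>Suc (floor_log n). \<bar>jump b r\<bar>)"

lemma antimono: "i \<le> j \<Longrightarrow> s j \<le> s i"
  using Suc_le by (rule lift_Suc_antimono_le)

lemma sum_le_1: "m \<le> Suc n \<Longrightarrow> (\<Sum>l<m. s l) \<le> 1"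
  using sum_mono2[of "{..n}" "{..<m}" s] nonneg sum_1 by fastforce

lemma le_inverse:
  assumes "l \<le> n"
  shows "s l \<le> 1 / real (Suc l)"
proof -
  have "real (Suc l) * s l = (\<Sum>j<Suc l. s l)"
    by simp
  also have "\<dots> \<le> (\<Sum>j<Suc l. s j)"
    by (intro sum_mono antimono) auto
  also have "\<dots> \<le> 1"
    using assms by (intro sum_le_1) simp
  finally show ?thesis
    by (simp add: field_simps del: of_nat_Suc)
qed

lemma less_pow2_floor_log: "n < 2 ^ Suc (floor_log n)"
proof (cases "n = 0")
  case False
  then show ?thesis
    using floor_log_exp2_gt[of n] by simp
qed simp

lemma div_pow2_eq_0: "Suc (floor_log n) \<le> k \<Longrightarrow> n div 2 ^ k = 0"
  using less_pow2_floor_log power_increasing[of "Suc (floor_log n)" k "2::nat"] by simp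

lemma b_eq_0: "Suc (floor_log n) \<le> k \<Longrightarrow> b k = 0"
  using div_pow2_eq_0 by (simp add: block_weight_def)

lemma b_nonneg: "0 \<le> b k"
  by (auto simp: block_weight_def intro!: sum_nonneg nonneg)

lemma b_le_1: "b k \<le> 1"
  using sum_le_1[of "n mod 2 ^ Suc k"] mod_less_eq_dividend[of n "2 ^ Suc k"]
  by (auto simp: block_weight_def simp del: power_Suc)

lemma b_le: "b k \<le> 2 ^ Suc k * s 0"
proof -
  have "(\<Sum>l<n mod 2 ^ Suc k. s l) \<le> (\<Sum>l<n mod 2 ^ Suc k. s 0)"
    by (intro sum_mono antimono) auto
  also have "\<dots> \<le> 2 ^ Suc k * s 0"
  proof -
    have "real (n mod 2 ^ Suc k) \<le> real (2 ^ Suc k)"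
      unfolding of_nat_le_iff by (intro less_imp_le mod_less_divisor) simp
    then show ?thesis
      using nonneg[of 0] by (auto simp del: power_Suc intro!: mult_right_mono)
  qed
  finally show ?thesis
    using nonneg[of 0] by (auto simp: block_weight_def)
qed

lemma tail_coeff_nonneg: "0 \<le> tail_coeff s n K r"
  by (auto simp: tail_coeff_def intro!: sum_nonneg mult_nonneg_nonneg nonneg)

lemma coeff_nonneg: "0 \<le> coeff r"
  using tail_coeff_nonneg by (simp add: coeff_def)

text \<open>Cauchy condensation: by monotonicity \<open>2 ^ r * s (m + 2 ^ r)\<close> is at most
  twice the sum of \<open>s\<close> over the dyadic block ending at \<open>m + 2 ^ r\<close>, and
  these blocks are disjoint.\<close>

lemma block_sum_le:
  "(\<Sum>r<k. 2 * 2 ^ r * s (m + 2 ^ r)) \<le> 4 * (\<Sum>l\<in>{m..<m + 2 ^ k}. s l)"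
proof (cases k)
  case (Suc k')
  have *: "(\<Sum>r<Suc i. 2 ^ r * s (m + 2 ^ r)) \<le> 2 * (\<Sum>l\<in>{m..<m + 2 ^ i}. s l)" for i
  proof (induction i)
    case 0
    show ?case using Suc_le[of m] nonneg[of m] by simp
  next
    case (Suc i)
    have "2 ^ i * s (m + 2 ^ Suc i) = (\<Sum>l\<in>{m + 2 ^ i..<m + 2 ^ Suc i}. s (m + 2 ^ Suc i))"
      by simp
    also have "\<dots> \<le> (\<Sum>l\<in>{m + 2 ^ i..<m + 2 ^ Suc i}. s l)"
      by (intro sum_mono antimono) auto
    finally have *: "2 ^ Suc i * s (m + 2 ^ Suc i) \<le> 2 * (\<Sum>l\<in>{m + 2 ^ i..<m + 2 ^ Suc i}. s l)"
      by simp
    have "(\<Sum>l\<in>{m..<m + 2 ^ Suc i}. s l) = (\<Sum>l\<in>{m..<m + 2 ^ i}. s l) + (\<Sum>l\<in>{m + 2 ^ i..<m + 2 ^ Suc i}. s l)"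
      by (rule sum.atLeastLessThan_concat[symmetric]) auto
    with Suc.IH * show ?case
      unfolding sum.lessThan_Suc[of _ "Suc i"] by linarith
  qed
  have "(\<Sum>r<k. 2 * 2 ^ r * s (m + 2 ^ r)) = 2 * (\<Sum>r<Suc k'. 2 ^ r * s (m + 2 ^ r))"
    unfolding sum_distrib_left Suc by (simp only: mult.assoc)
  also have "\<dots> \<le> 4 * (\<Sum>l\<in>{m..<m + 2 ^ k'}. s l)"
    using *[of k'] by linarith
  also have "\<dots> \<le> 4 * (\<Sum>l\<in>{m..<m + 2 ^ k}. s l)"
    using nonneg by (intro mult_left_mono sum_mono2) (auto simp: Suc)
  finally show ?thesis .
qed (use nonneg in simp)

text \<open>Each digit 1 in position \<open>i\<close> owns the indices from
  \<open>n mod 2 ^ i\<close> to \<open>n mod 2 ^ Suc i\<close>. These ranges tile the indices below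
  \<open>n mod 2 ^ K\<close>, so condensation on each costs in total 4 times a mass of at most
  1.\<close>

lemma sum_tail_coeff_le: "(\<Sum>r\<le>K. tail_coeff s n K r) \<le> 4"
proof -
  have "(\<Sum>i<K. of_bool (odd (n div 2 ^ i)) * (\<Sum>r<i. 2 * 2 ^ r * s (n mod 2 ^ i + 2 ^ r) * 1))
      \<le> 4 * (\<Sum>l<n mod 2 ^ K. s l)"
  proof (induction K)
    case (Suc K)
    show ?case
    proof (cases "odd (n div 2 ^ K)")
      case True
      then have "n mod 2 ^ Suc K = n mod 2 ^ K + 2 ^ K"
        by (simp add: mod_pow2_Suc del: power_Suc)
      moreover have "(\<Sum>l<n mod 2 ^ K + 2 ^ K. s l) =
          (\<Sum>l<n mod 2 ^ K. s l) + (\<Sum>l\<in>{n mod 2 ^ K..<n mod 2 ^ K + 2 ^ K}. s l)"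
        by (subst sum.union_disjoint[symmetric]) (auto intro!: sum.cong)
      ultimately show ?thesis
        using Suc.IH block_sum_le[where k = K and m = "n mod 2 ^ K"] True by (simp del: power_Suc)
    next
      case False
      then show ?thesis
        using Suc.IH by (simp add: mod_pow2_Suc del: power_Suc)
    qed
  qed simp
  moreover have "(\<Sum>l<n mod 2 ^ K. s l) \<le> 1"
    by (intro sum_le_1) (simp add: le_Suc_eq mod_less_eq_dividend le_SucI)
  ultimately show ?thesis
    using tail_coeff_sum[of n s "\<lambda>_. 1" K] by simp
qed

lemma sum_coeff_le: "(\<Sum>r\<le>Suc (floor_log n). coeff r) \<le> variation + 4"
  using sum_tail_coeff_le[of "Suc (floor_log n)"] unfolding coeff_def variation_def sum.distrib by simp

text \<open>At the level above the leading digit, \<open>n mod 2 ^ ?K\<close> is \<open>n\<close>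
  itself and \<open>b ?K\<close> is 0, so the decomposition covers the whole kernel and the boundary
  term of the martingale part disappears.\<close>

lemma abs_nkernel_le:
  "\<bar>nkernel s n z\<bar> \<le> (\<Sum>r\<le>Suc (floor_log n). coeff r * cyl_kernel r z)"
proof -
  let ?K = "Suc (floor_log n)"
  have n: "n mod 2 ^ ?K = n"
    using less_pow2_floor_log by (intro mod_less)
  have "\<bar>nkernel s n z\<bar> \<le> \<bar>nkernel s n z - walsh n z * martingale_part b ?K z\<bar> + \<bar>martingale_part b ?K z\<bar>"
    using abs_triangle_ineq[of "nkernel s n z - walsh n z * martingale_part b ?K z" "walsh n z * martingale_part b ?K z"]
    by (simp add: abs_mult)
  also have "\<dots> \<le> (\<Sum>r\<le>?K. tail_coeff s n ?K r * cyl_kernel r z) + (\<Sum>r\<le>?K. \<bar>jump b r\<bar> * cyl_kernel r z)"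
    using nkernel_martingale_diff[where s = s and n = n and K = ?K and z = z, OF Suc_le nonneg]
    unfolding n tail_coeff_sum[where g = "\<lambda>r. cyl_kernel r z"]
    by (intro add_mono abs_martingale_part_le b_eq_0 order_refl)
  also have "\<dots> = (\<Sum>r\<le>?K. coeff r * cyl_kernel r z)"
    unfolding coeff_def distrib_right sum.distrib by (rule add.commute)
  finally show ?thesis .
qed

text \<open>
  Moving from a digit \<open>1\<close> in position \<open>i\<close> to the next one costs a single \<open>s 0\<close> and replaces
  \<open>n mod 2 ^ i\<close> by \<open>n mod 2 ^ (i+1) \<ge> 2 ^ i\<close>, where \<open>s\<close> is at most \<open>2 ^ -i\<close>.
\<close>

lemma sum_block_starts_le: "(\<Sum>i<K. of_bool (odd (n div 2 ^ i)) * s (n mod 2 ^ i)) \<le> (real M + 1) * s 0 + 2 / 2 ^ M"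
proof -
  let ?o = "\<lambda>i. of_bool (odd (n div 2 ^ i)) :: real"
  have shift: "(\<Sum>i<K. ?o i * s (n mod 2 ^ i)) + s (n mod 2 ^ K) \<le> s 0 + (\<Sum>i<K. ?o i * s (n mod 2 ^ Suc i))"
  proof (induction K)
    case (Suc K)
    then show ?case
      by (cases "odd (n div 2 ^ K)") (simp_all add: mod_pow2_Suc del: power_Suc)
  qed simp
  have le_s0: "?o i * s (n mod 2 ^ Suc i) \<le> s 0" for i
    using antimono[of 0 "n mod 2 ^ Suc i"] nonneg[of 0] by (auto simp del: power_Suc)
  have le_geom: "?o i * s (n mod 2 ^ Suc i) \<le> 1 / 2 ^ i" for i
  proof (cases "odd (n div 2 ^ i)")
    case True
    have "s (n mod 2 ^ Suc i) \<le> 1 / real (Suc (n mod 2 ^ Suc i))"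
      by (intro le_inverse mod_less_eq_dividend)
    also have "\<dots> \<le> 1 / 2 ^ i"
      using True by (intro frac_le) (simp_all add: mod_pow2_Suc del: power_Suc)
    finally show ?thesis
      using True by simp
  qed simp
  have "(\<Sum>i<K. ?o i * s (n mod 2 ^ Suc i)) \<le> (\<Sum>i<K. (if i < M then s 0 else 0) + (if i < M then 0 else 1 / 2 ^ i))"
    using le_s0 le_geom by (intro sum_mono) auto
  also have "\<dots> = (\<Sum>i<K. if i < M then s 0 else 0) + (\<Sum>i<K. if i < M then 0 else 1 / 2 ^ i)"
    by (rule sum.distrib)
  also have "(\<Sum>i<K. if i < M then s 0 else 0) \<le> (\<Sum>i<M. s 0)"
  proof -
    have "{i \<in> {..<K}. i < M} \<subseteq> {..<M}"
      by auto
    then show ?thesis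
      unfolding sum.inter_filter[OF finite_lessThan, symmetric]
      using nonneg[of 0] by (intro sum_mono2) auto
  qed
  also have "(\<Sum>i<K. if i < M then 0 else 1 / 2 ^ i) \<le> (2 / 2 ^ M :: real)"
  proof -
    have "(\<Sum>i<K. if i < M then 0 else 1 / 2 ^ i) \<le> (if K \<le> M then 0 else 2 / 2 ^ M - 2 / 2 ^ K :: real)"
    proof (induction K)
      case (Suc K)
      consider "K < M" | "K = M" | "M < K" by linarith
      then show ?case
        using Suc by cases simp_all
    qed simp
    also have "\<dots> \<le> 2 / 2 ^ M"
      by simp
    finally show ?thesis .
  qed
  finally have "(\<Sum>i<K. ?o i * s (n mod 2 ^ Suc i)) \<le> M * s 0 + 2 / 2 ^ M"
    by simp
  with shift nonneg[of "n mod 2 ^ K"] show ?thesis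
    by (simp only: distrib_right mult_1)
qed

lemma tail_coeff_le: "tail_coeff s n K r \<le> 2 * 2 ^ r * ((real M + 1) * s 0 + 2 / 2 ^ M)"
proof -
  \<comment> \<open>Dropping the shift by \<open>2 ^ r\<close> only enlarges the weights and removes
    the dependence on \<open>r\<close> inside the sum.\<close>
  have "(\<Sum>i\<in>{Suc r..<K}. of_bool (odd (n div 2 ^ i)) * s (n mod 2 ^ i + 2 ^ r)) \<le>
      (\<Sum>i\<in>{Suc r..<K}. of_bool (odd (n div 2 ^ i)) * s (n mod 2 ^ i))"
    by (intro sum_mono mult_left_mono antimono) auto
  also have "\<dots> \<le> (\<Sum>i<K. of_bool (odd (n div 2 ^ i)) * s (n mod 2 ^ i))"
    using nonneg by (intro sum_mono2) auto
  also note sum_block_starts_le[of K M]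
  finally show ?thesis
    unfolding tail_coeff_def by (intro mult_left_mono) auto
qed

lemma abs_jump_le: "\<bar>jump b r\<bar> \<le> 2 * 2 ^ r * s 0"
proof (cases r)
  case 0
  then show ?thesis using b_le[of 0] b_nonneg[of 0] by simp
next
  case (Suc p)
  have "0 \<le> 2 ^ r * s 0"
    using nonneg[of 0] by simp
  then show ?thesis
    using b_le[of r] b_le[of p] b_nonneg[of r] b_nonneg[of p] by (simp add: Suc abs_le_iff)
qed

text \<open>The parameter \<open>M\<close> is free: a large \<open>M\<close> makes the second term
  small, and then a small \<open>s 0\<close> takes care of the first.\<close>

lemma coeff_le: "coeff r \<le> 2 * 2 ^ r * ((real M + 2) * s 0 + 2 / 2 ^ M)"
  using abs_jump_le[of r] tail_coeff_le[of "Suc (floor_log n)" r M]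
  by (simp add: coeff_def algebra_simps)

text \<open>Inside a run of ones the range of summation \<open>n mod 2 ^ Suc k\<close> grows with
  \<open>k\<close>, and at a digit 0 the sequence is 0.\<close>

lemma b_Suc_ge:
  assumes "\<not> (odd (n div 2 ^ k) \<and> even (n div 2 ^ Suc k))"
  shows "b k \<le> b (Suc k)"
proof (cases "odd (n div 2 ^ k)")
  case True
  then have "n mod 2 ^ Suc k \<le> n mod 2 ^ Suc (Suc k)" "odd (n div 2 ^ Suc k)"
    using assms mod_pow2_Suc[of n "Suc k"] by auto
  then show ?thesis
    using True nonneg unfolding block_weight_def by (auto intro!: sum_mono2 simp del: power_Suc)
next
  case False
  then show ?thesis
    using b_nonneg[of "Suc k"] by (simp add: block_weight_def)
qed

text \<open>
  The sequence \<open>b\<close> decreases only at the end of a run of ones.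
\<close>

lemma variation_le_drops:
  "(\<Sum>r\<le>K. \<bar>jump b r\<bar>) \<le> b K + 2 * (\<Sum>k<K. of_bool (odd (n div 2 ^ k) \<and> even (n div 2 ^ Suc k)) * b k)"
proof (induction K)
  case 0
  show ?case using b_nonneg[of 0] by simp
next
  case (Suc K)
  show ?case
  proof (cases "odd (n div 2 ^ K) \<and> even (n div 2 ^ Suc K)")
    case True
    then have "b (Suc K) = 0"
      by (simp add: block_weight_def)
    with Suc True b_nonneg[of K] show ?thesis
      by (simp del: power_Suc)
  next
    case False
    with Suc b_Suc_ge[OF False] show ?thesis
      unfolding sum.lessThan_Suc sum.atMost_Suc jump_simps
      by (simp only: False of_bool_eq mult_zero_left add_0_right)
  qed
qed

text \<open>Fewer than \<open>2 ^ Suc k\<close> weights are summed, and the second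
  \<open>2 ^ k\<close> of them are dominated by the first.\<close>

lemma b_le_partial_sum: "b k \<le> 2 * (\<Sum>l\<le>2 ^ k. s l)"
proof -
  have "b k \<le> (\<Sum>l<n mod 2 ^ Suc k. s l)"
    using nonneg by (simp add: block_weight_def sum_nonneg)
  also have "\<dots> \<le> (\<Sum>l<2 ^ k + 2 ^ k. s l)"
    using nonneg mod_less_divisor[of "2 ^ Suc k" n]
    by (intro sum_mono2) (simp_all flip: mult_2 add: less_imp_le)
  also have "\<dots> = (\<Sum>l<2 ^ k. s l) + (\<Sum>l<2 ^ k. s (2 ^ k + l))"
    by (rule sum_lessThan_add)
  also have "\<dots> \<le> (\<Sum>l<2 ^ k. s l) + (\<Sum>l<2 ^ k. s l)"
    by (intro add_left_mono sum_mono antimono) auto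
  also have "(\<Sum>l<2 ^ k. s l) \<le> (\<Sum>l\<le>2 ^ k. s l)"
    using nonneg by (intro sum_mono2) auto
  finally show ?thesis by simp
qed

text \<open>Since \<open>b\<close> ends at 0, its variation is at most twice the total of its drops.
  A drop is a change of digit, and its size is at most twice a partial sum of
  \<open>s\<close>.\<close>

lemma variation_le_digit_changes:
  "variation \<le> 4 * (\<Sum>k\<le>floor_log n. \<bar>real (ndigit k n) - real (ndigit (k + 1) n)\<bar> * (\<Sum>l\<le>2 ^ k. s l))"
proof -
  let ?K = "Suc (floor_log n)"
  have "variation \<le> 2 * (\<Sum>k<?K. of_bool (odd (n div 2 ^ k) \<and> even (n div 2 ^ Suc k)) * b k)"
    using variation_le_drops[of ?K] by (simp add: variation_def b_eq_0 del: power_Suc)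
  also have "\<dots> \<le> 2 * (\<Sum>k<?K. \<bar>real (ndigit k n) - real (ndigit (k + 1) n)\<bar> * (2 * (\<Sum>l\<le>2 ^ k. s l)))"
  proof (intro mult_left_mono sum_mono mult_mono b_le_partial_sum b_nonneg)
    fix k
    show "of_bool (odd (n div 2 ^ k) \<and> even (n div 2 ^ Suc k)) \<le> \<bar>real (ndigit k n) - real (ndigit (k + 1) n)\<bar>"
      by (auto simp: ndigit_def mod2_eq_if)
  qed auto
  also have "\<dots> = 4 * (\<Sum>k<?K. \<bar>real (ndigit k n) - real (ndigit (k + 1) n)\<bar> * (\<Sum>l\<le>2 ^ k. s l))"
    unfolding sum_distrib_left by (intro sum.cong) simp_all
  finally show ?thesis
    unfolding lessThan_Suc_atMost .
qed

end

text \<open>Chosen so that \<open>2 ^ Suc p\<close> times the difference of the means at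
  \<open>p\<close> and \<open>Suc p\<close> is the value of \<open>martingale_part\<close> on the
  shell from \<open>2 ^ -(p+1)\<close> to \<open>2 ^ -p\<close>.\<close>

definition dyadic_mean :: "(nat \<Rightarrow> real) \<Rightarrow> nat \<Rightarrow> real" where
  "dyadic_mean b p = (\<Sum>k<p. b k * 2 ^ k) / 2 ^ p"

lemma dyadic_mean_Suc: "dyadic_mean b (Suc p) = (dyadic_mean b p + b p) / 2"
  by (simp add: dyadic_mean_def field_simps)

text \<open>The means determine the sequence through \<open>b p = 2 * ?m (Suc p) - ?m p\<close>, so
  a jump of \<open>b\<close> is at most twice one increment of the means plus the preceding
  one.\<close>

lemma sum_jumps_le_dyadic_mean:
  "(\<Sum>p<A. \<bar>b (Suc p) - b p\<bar>) \<le> 3 * (\<Sum>p<Suc A. \<bar>dyadic_mean b p - dyadic_mean b (Suc p)\<bar>)"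
proof -
  let ?m = "dyadic_mean b"
  let ?e = "\<lambda>p. \<bar>?m p - ?m (Suc p)\<bar>"
  have "b p = 2 * ?m (Suc p) - ?m p" for p
    by (simp add: dyadic_mean_Suc field_simps)
  then have "(\<Sum>p<A. \<bar>b (Suc p) - b p\<bar>) \<le> (\<Sum>p<A. 2 * ?e (Suc p) + ?e p)"
    by (intro sum_mono) (smt (verit))
  also have "\<dots> = 2 * (\<Sum>p<A. ?e (Suc p)) + (\<Sum>p<A. ?e p)"
    by (simp add: sum.distrib sum_distrib_left)
  also have "(\<Sum>p<A. ?e (Suc p)) \<le> (\<Sum>p<Suc A. ?e p)"
    by (subst sum.lessThan_Suc_shift) simp
  also have "(\<Sum>p<A. ?e p) \<le> (\<Sum>p<Suc A. ?e p)"
    by simp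
  finally show ?thesis by simp
qed

context averaging_weights
begin

text \<open>Three jumps are estimated by 1: the initial one and the last two. The latter need
  increments of the means beyond those available below the leading digit.\<close>

lemma variation_le_dyadic_mean:
  "variation \<le> 3 + 3 * (\<Sum>p<floor_log n. \<bar>dyadic_mean b p - dyadic_mean b (Suc p)\<bar>)"
proof -
  have one: "\<bar>b (Suc p) - b p\<bar> \<le> 1" for p
    using b_nonneg[of p] b_nonneg[of "Suc p"] b_le_1[of p] b_le_1[of "Suc p"] by linarith
  have "variation = b 0 + (\<Sum>p<Suc (floor_log n). \<bar>b (Suc p) - b p\<bar>)"
    unfolding variation_def lessThan_Suc_atMost[symmetric] sum.lessThan_Suc_shift[of _ "Suc (floor_log n)"]
    using b_nonneg[of 0] by simp
  also have "\<dots> \<le> 1 + (\<Sum>p<floor_log n. \<bar>b (Suc p) - b p\<bar>) + 1"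
    using b_le_1[of 0] one[of "floor_log n"] by simp
  also have "(\<Sum>p<floor_log n. \<bar>b (Suc p) - b p\<bar>) \<le>
      1 + 3 * (\<Sum>p<floor_log n. \<bar>dyadic_mean b p - dyadic_mean b (Suc p)\<bar>)"
  proof (cases "floor_log n")
    case (Suc A)
    then show ?thesis
      using sum_jumps_le_dyadic_mean[where b = b and A = A] one[of A] by simp
  qed simp
  finally show ?thesis by simp
qed

text \<open>The decomposition read in the other direction: a bound on the kernel of the truncated
  order yields one on the martingale part, because the remainder is controlled.\<close>

lemma abs_martingale_part_le_nkernel:
  "\<bar>martingale_part b A z\<bar> \<le> \<bar>nkernel s (n mod 2 ^ A) z\<bar> + (\<Sum>r\<le>A. tail_coeff s n A r * cyl_kernel r z)"
proof -
  have "\<bar>martingale_part b A z\<bar> = \<bar>walsh (n mod 2 ^ A) z * martingale_part b A z\<bar>"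
    by (simp add: abs_mult)
  also have "\<dots> \<le> \<bar>nkernel s (n mod 2 ^ A) z\<bar> +
      \<bar>nkernel s (n mod 2 ^ A) z - walsh (n mod 2 ^ A) z * martingale_part b A z\<bar>"
    by linarith
  finally show ?thesis
    using nkernel_martingale_diff[where s = s and n = n and K = A and z = z, OF Suc_le nonneg]
    unfolding tail_coeff_sum[where g = "\<lambda>r. cyl_kernel r z"] by linarith
qed

end

section \<open>Dyadic step functions\<close>

lemma floor_pow2_div: "k \<le> A \<Longrightarrow> \<lfloor>2 ^ k * z\<rfloor> = \<lfloor>2 ^ A * z\<rfloor> div 2 ^ (A - k)" for z :: real
proof -
  assume "k \<le> A"
  then have "(2::real) ^ A = 2 ^ k * 2 ^ (A - k)"
    by (simp flip: power_add)
  then have "2 ^ k * z = 2 ^ A * z / real_of_int (2 ^ (A - k))"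
    by simp
  then show ?thesis
    by (simp only: floor_divide_real_eq_div zero_le_power zero_le_numeral)
qed

lemma int_xdigit: "int (xdigit x k) = \<lfloor>2 ^ Suc k * x\<rfloor> mod 2"
  by (simp add: xdigit_def)

lemma floor_pow2_Suc: "\<lfloor>2 ^ Suc r * z\<rfloor> = 2 * \<lfloor>2 ^ r * z\<rfloor> + int (xdigit z r)"
  using floor_pow2_div[of r "Suc r" z] by (simp add: int_xdigit del: power_Suc)

lemma floor_pow2_cong:
  assumes "z \<in> {0..<1}" "y \<in> {0..<1}" "\<And>k. k < r \<Longrightarrow> xdigit z k = xdigit y k"
  shows "\<lfloor>2 ^ r * z\<rfloor> = \<lfloor>2 ^ r * y\<rfloor>"
  using assms(3)
proof (induction r)
  case 0
  have "\<lfloor>z\<rfloor> = 0" "\<lfloor>y\<rfloor> = 0"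
    using assms(1,2) by (simp_all add: floor_eq_iff)
  then show ?case by simp
next
  case (Suc r)
  then show ?case by (simp add: floor_pow2_Suc del: power_Suc)
qed

lemma xdigit_floor: "k < A \<Longrightarrow> xdigit (\<lfloor>2 ^ A * z\<rfloor> / 2 ^ A) k = xdigit z k"
proof -
  assume "k < A"
  then have k: "Suc k \<le> A" by simp
  have "\<lfloor>2 ^ A * (real_of_int \<lfloor>2 ^ A * z\<rfloor> / 2 ^ A)\<rfloor> = \<lfloor>2 ^ A * z\<rfloor>"
    by simp
  then have "int (xdigit (\<lfloor>2 ^ A * z\<rfloor> / 2 ^ A) k) = int (xdigit z k)"
    unfolding int_xdigit floor_pow2_div[OF k] by simp
  then show ?thesis by simp
qed

text \<open>Constancy on dyadic intervals of length \<open>2 ^ -A\<close>, stated through their left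
  endpoints. As an equation between values of \<open>h\<close> it passes immediately to pointwise
  combinations.\<close>

definition dyadic_step :: "nat \<Rightarrow> (real \<Rightarrow> real) \<Rightarrow> bool" where
  "dyadic_step A h \<longleftrightarrow> (\<forall>z. h z = h (\<lfloor>2 ^ A * z\<rfloor> / 2 ^ A))"

lemma dyadic_step_digits:
  "(\<And>y z. (\<And>k. k < A \<Longrightarrow> xdigit y k = xdigit z k) \<Longrightarrow> h y = h z) \<Longrightarrow> dyadic_step A h"
  unfolding dyadic_step_def using xdigit_floor by metis

lemma dyadic_step_walsh: "m < 2 ^ A \<Longrightarrow> dyadic_step A (walsh m)"
  by (rule dyadic_step_digits) (rule walsh_cong)

lemma dyadic_step_const: "dyadic_step A (\<lambda>z. c)"
  by (simp add: dyadic_step_def)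

lemma dyadic_step_comp: "dyadic_step A h \<Longrightarrow> dyadic_step A (\<lambda>z. F (h z))"
  unfolding dyadic_step_def by metis

lemma dyadic_step_comp2: "dyadic_step A h \<Longrightarrow> dyadic_step A g \<Longrightarrow> dyadic_step A (\<lambda>z. F (h z) (g z))"
  unfolding dyadic_step_def by metis

lemma dyadic_step_mult: "dyadic_step A h \<Longrightarrow> dyadic_step A g \<Longrightarrow> dyadic_step A (\<lambda>z. h z * g z)"
  by (rule dyadic_step_comp2)

lemma dyadic_step_abs: "dyadic_step A h \<Longrightarrow> dyadic_step A (\<lambda>z. \<bar>h z\<bar>)"
  by (rule dyadic_step_comp)

lemma dyadic_step_diff: "dyadic_step A h \<Longrightarrow> dyadic_step A g \<Longrightarrow> dyadic_step A (\<lambda>z. h z - g z)"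
  by (rule dyadic_step_comp2)

lemma dyadic_step_sum:
  "(\<And>i. i \<in> I \<Longrightarrow> dyadic_step A (h i)) \<Longrightarrow> dyadic_step A (\<lambda>z. \<Sum>i\<in>I. h i z)"
  unfolding dyadic_step_def by (intro allI sum.cong refl) blast

lemma dyadic_step_dirichlet: "m \<le> 2 ^ A \<Longrightarrow> dyadic_step A (walsh_dirichlet m)"
  unfolding walsh_dirichlet_def by (intro dyadic_step_sum dyadic_step_walsh) auto

lemma dyadic_step_mono:
  assumes "dyadic_step A h" "A \<le> B"
  shows "dyadic_step B h"
proof -
  have "\<lfloor>2 ^ A * (real_of_int \<lfloor>2 ^ B * z\<rfloor> / 2 ^ B)\<rfloor> = \<lfloor>2 ^ A * z\<rfloor>" for z :: real
  proof -
    have "\<lfloor>2 ^ B * (real_of_int \<lfloor>2 ^ B * z\<rfloor> / 2 ^ B)\<rfloor> = \<lfloor>2 ^ B * z\<rfloor>"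
      by simp
    then show ?thesis
      unfolding floor_pow2_div[OF assms(2)] by simp
  qed
  then show ?thesis
    using assms(1) unfolding dyadic_step_def by metis
qed

section \<open>Integrals of dyadic step functions\<close>

lemma space_mu [simp]: "space mu = {0..<1}"
  by (simp add: space_restrict_space)

lemma emeasure_mu_interval: "0 \<le> a \<Longrightarrow> a \<le> b \<Longrightarrow> b \<le> 1 \<Longrightarrow> emeasure mu {a..<b} = ennreal (b - a)"
  by (subst emeasure_restrict_space) (auto simp: emeasure_lborel_Ico)

lemma has_integral_mu_interval:
  "0 \<le> a \<Longrightarrow> a \<le> b \<Longrightarrow> b \<le> 1 \<Longrightarrow> has_bochner_integral mu (indicator {a..<b}) (b - a)"
  using has_bochner_integral_real_indicator[of "{a..<b}" mu] emeasure_mu_interval[of a b]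
  by (auto simp: measure_def sets_restrict_space_iff)

text \<open>On the unit interval \<open>g\<close> is a finite combination of indicators, which
  yields measurability, integrability and the value at once.\<close>

lemma dyadic_step_has_integral:
  assumes "dyadic_step N g"
  shows "has_bochner_integral mu g (\<Sum>p<2 ^ N. g (real p / 2 ^ N) / 2 ^ N)"
proof -
  let ?J = "\<lambda>p::nat. {real p / 2 ^ N ..< (real p + 1) / 2 ^ N}"
  have "has_bochner_integral mu (\<lambda>z. \<Sum>p<2 ^ N. g (real p / 2 ^ N) * indicator (?J p) z)
     (\<Sum>p<2 ^ N. g (real p / 2 ^ N) * ((real p + 1) / 2 ^ N - real p / 2 ^ N))"
  proof (intro has_bochner_integral_sum has_bochner_integral_mult_right has_integral_mu_interval)
    fix p :: nat assume "p \<in> {..<2 ^ N}"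
    then have "real (p + 1) \<le> real (2 ^ N)"
      unfolding of_nat_le_iff by simp
    then show "(real p + 1) / 2 ^ N \<le> 1"
      by simp
  qed (auto simp: divide_right_mono)
  also have "(\<Sum>p<2 ^ N. g (real p / 2 ^ N) * ((real p + 1) / 2 ^ N - real p / 2 ^ N)) = (\<Sum>p<2 ^ N. g (real p / 2 ^ N) / 2 ^ N)"
    by (intro sum.cong refl) (simp add: field_simps)
  also have "has_bochner_integral mu (\<lambda>z. \<Sum>p<2 ^ N. g (real p / 2 ^ N) * indicator (?J p) z) x \<longleftrightarrow>
      has_bochner_integral mu g x" for x
  proof (intro has_bochner_integral_cong refl)
    fix z assume "z \<in> space mu"
    then have z: "0 \<le> z" "z < 1" by auto
    define q where "q = nat \<lfloor>2 ^ N * z\<rfloor>"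
    have q: "real q = \<lfloor>2 ^ N * z\<rfloor>"
      using z by (simp add: q_def)
    have "\<lfloor>2 ^ N * z\<rfloor> < 2 ^ N"
      using z by (simp add: floor_less_iff)
    then have q_less: "q < 2 ^ N"
      unfolding q_def using z by (simp add: nat_less_iff)
    have iff: "z \<in> ?J p \<longleftrightarrow> p = q" for p
    proof -
      have "z \<in> ?J p \<longleftrightarrow> \<lfloor>2 ^ N * z\<rfloor> = int p"
        by (auto simp: floor_eq_iff field_simps)
      then show ?thesis
        using q by auto
    qed
    have "(\<Sum>p<2 ^ N. g (real p / 2 ^ N) * indicator (?J p) z) = (\<Sum>p<2 ^ N. if p = q then g (real q / 2 ^ N) else 0)"
      by (intro sum.cong refl) (simp add: iff indicator_def del: atLeastLessThan_iff)
    also have "\<dots> = g (real q / 2 ^ N)"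
      using q_less by (simp add: sum.delta)
    also have "\<dots> = g z"
      using assms unfolding dyadic_step_def q by simp
    finally show "(\<Sum>p<2 ^ N. g (real p / 2 ^ N) * indicator (?J p) z) = g z" .
  qed
  finally show ?thesis .
qed

lemma dyadic_step_integrable: "dyadic_step N g \<Longrightarrow> integrable mu g"
  using dyadic_step_has_integral by (auto intro: integrable.intros)

lemma dyadic_step_integral: "dyadic_step N g \<Longrightarrow> (\<integral>z. g z \<partial>mu) = (\<Sum>p<2 ^ N. g (real p / 2 ^ N) / 2 ^ N)"
  using dyadic_step_has_integral by (rule has_bochner_integral_integral_eq)

text \<open>On each interval where \<open>h\<close> is constant, \<open>walsh (2 ^ A)\<close> is 1
  on the left half and -1 on the right half.\<close>

lemma integral_walsh_pow2_mult:
  assumes "dyadic_step A h"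
  shows "(\<integral>z. walsh (2 ^ A) z * h z \<partial>mu) = 0"
proof -
  let ?g = "\<lambda>z. walsh (2 ^ A) z * h z"
  let ?f = "\<lambda>p. ?g (real p / 2 ^ Suc A) / 2 ^ Suc A"
  have "dyadic_step (Suc A) ?g"
    by (intro dyadic_step_mult dyadic_step_walsh dyadic_step_mono[OF assms]) auto
  then have "(\<integral>z. ?g z \<partial>mu) = (\<Sum>p<2 ^ Suc A. ?f p)"
    by (rule dyadic_step_integral)
  \<comment> \<open>Both branches agree; this shape matches \<open>sum_split_even_odd\<close>, which
    pairs the two halves of each interval.\<close>
  also have "\<dots> = (\<Sum>p<2 * 2 ^ A. if even p then ?f p else ?f p)"
    by (intro sum.cong) auto
  also have "\<dots> = (\<Sum>q<2 ^ A. ?f (2 * q)) + (\<Sum>q<2 ^ A. ?f (2 * q + 1))"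
    by (rule sum_split_even_odd)
  also have "\<dots> = (\<Sum>q<2 ^ A. ?f (2 * q) + ?f (2 * q + 1))"
    by (rule sum.distrib[symmetric])
  also have "\<dots> = 0"
  proof (intro sum.neutral ballI)
    fix q :: nat
    have w: "walsh (2 ^ A) (real p / 2 ^ Suc A) = (if even p then 1 else -1)" for p
    proof -
      have "\<lfloor>2 ^ Suc A * (real p / 2 ^ Suc A)\<rfloor> = int p"
        by simp
      then have "int (xdigit (real p / 2 ^ Suc A) A) = int p mod 2"
        unfolding int_xdigit by simp
      then have "xdigit (real p / 2 ^ Suc A) A = p mod 2"
        by (metis of_nat_eq_iff of_nat_mod of_nat_numeral)
      then show ?thesis
        unfolding walsh_pow2_cases by (simp add: even_iff_mod_2_eq_zero)
    qed
    have "\<lfloor>2 ^ A * (real (2 * q + 1) / 2 ^ Suc A)\<rfloor> = int q"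
      by (simp add: floor_eq_iff)
    then have "h (real (2 * q + 1) / 2 ^ Suc A) = h (real q / 2 ^ A)"
      using assms unfolding dyadic_step_def by (metis of_int_of_nat_eq)
    moreover have "real (2 * q) / 2 ^ Suc A = real q / 2 ^ A"
      by simp
    ultimately show "?f (2 * q) + ?f (2 * q + 1) = 0"
      unfolding w by simp
  qed
  finally show ?thesis .
qed

lemma pow2_split:
  fixes m :: nat
  assumes "m \<noteq> 0"
  obtains B m' where "m = 2 ^ B + m'" "m' < 2 ^ B" "B = floor_log m"
  using floor_log_exp2_le[of m] floor_log_exp2_gt[of m] assms
  by (intro that[of "floor_log m" "m - 2 ^ floor_log m"]) auto

lemma integral_walsh: "(\<integral>z. walsh m z \<partial>mu) = of_bool (m = 0)"
proof (cases "m = 0")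
  case True
  then show ?thesis
    using emeasure_mu_interval[of 0 1] by (simp add: measure_def walsh_def)
next
  case False
  then obtain B m' where m: "m = 2 ^ B + m'" "m' < 2 ^ B"
    using pow2_split by metis
  show ?thesis
    unfolding m(1) walsh_add[OF m(2)] using integral_walsh_pow2_mult[OF dyadic_step_walsh[OF m(2)]] by simp
qed

lemma walsh_dirichlet_pow2_indicator:
  assumes "z \<in> {0..<1}"
  shows "walsh_dirichlet (2 ^ A) z = 2 ^ A * indicator {0..<1 / 2 ^ A} z"
proof -
  have zero: "xdigit 0 k = 0" for k
    by (simp add: xdigit_def)
  have "(\<forall>i<A. xdigit z i = 0) \<longleftrightarrow> z < 1 / 2 ^ A"
  proof
    assume "\<forall>i<A. xdigit z i = 0"
    then have "\<lfloor>2 ^ A * z\<rfloor> = \<lfloor>2 ^ A * 0 :: real\<rfloor>"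
      using assms by (intro floor_pow2_cong) (auto simp: zero)
    then show "z < 1 / 2 ^ A"
      by (simp add: floor_eq_iff field_simps)
  next
    assume "z < 1 / 2 ^ A"
    then have "\<lfloor>2 ^ A * z\<rfloor> = 0"
      using assms by (simp add: floor_eq_iff field_simps)
    then show "\<forall>i<A. xdigit z i = 0"
      using xdigit_floor[of _ A z] by (auto simp: zero)
  qed
  then show ?thesis
    using assms by (auto simp: walsh_dirichlet_pow2 indicator_def)
qed

lemma integral_dirichlet_walsh:
  assumes "i < 2 ^ A"
  shows "(\<integral>z. walsh_dirichlet (2 ^ A) z * walsh i z \<partial>mu) = 1"
proof -
  have "(\<integral>z. walsh_dirichlet (2 ^ A) z * walsh i z \<partial>mu) = (\<integral>z. 2 ^ A * indicator {0..<1 / 2 ^ A} z \<partial>mu)"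
  proof (intro Bochner_Integration.integral_cong refl)
    fix z assume z: "z \<in> space mu"
    have "walsh_dirichlet (2 ^ A) z * walsh i z = walsh_dirichlet (2 ^ A) z"
      using walsh_eq_1[OF assms] by (auto simp: walsh_dirichlet_pow2)
    with z show "walsh_dirichlet (2 ^ A) z * walsh i z = 2 ^ A * indicator {0..<1 / 2 ^ A} z"
      by (simp add: walsh_dirichlet_pow2_indicator)
  qed
  also have "\<dots> = 2 ^ A * (1 / 2 ^ A - 0)"
    using has_bochner_integral_integral_eq[OF has_integral_mu_interval[of 0 "1 / 2 ^ A"]] by simp
  finally show ?thesis by simp
qed

lemma of_bool_le_indicator: "(P \<Longrightarrow> z \<in> J) \<Longrightarrow> of_bool P \<le> (indicator J z :: real)"
  by (auto simp: indicator_def)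

text \<open>A nonempty set of prescribed first \<open>r\<close> digits lies in the dyadic interval
  of any of its points, so its measure is at most \<open>2 ^ -r\<close>; an empty one contributes 0.
  The weights \<open>2 ^ i\<close> then add up to less than \<open>2 * 2 ^ r\<close>.\<close>

lemma integral_cyl_kernel_le:
  shows "integrable mu (cyl_kernel r)" and "(\<integral>z. cyl_kernel r z \<partial>mu) \<le> 2"
proof -
  let ?c = "\<lambda>i z. of_bool (\<forall>k<r. xdigit z k = of_bool (k = i)) :: real"
  have step: "dyadic_step r (?c i)" for i
    by (rule dyadic_step_digits) simp
  have le: "(\<integral>z. ?c i z \<partial>mu) \<le> 1 / 2 ^ r" for i
  proof (cases "\<exists>y\<in>{0..<1::real}. \<forall>k<r. xdigit y k = of_bool (k = i)")
    case True
    then obtain y :: real where y: "y \<in> {0..<1}" "\<And>k. k < r \<Longrightarrow> xdigit y k = of_bool (k = i)"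
      by blast
    let ?d = "real_of_int \<lfloor>2 ^ r * y\<rfloor>"
    have "\<lfloor>2 ^ r * y\<rfloor> < 2 ^ r"
      using y(1) by (simp add: floor_less_iff)
    then have "\<lfloor>2 ^ r * y\<rfloor> + 1 \<le> 2 ^ r"
      by simp
    then have "?d + 1 \<le> 2 ^ r"
      by (simp flip: of_int_le_iff[where 'a = real])
    then have *: "has_bochner_integral mu (indicator {?d / 2 ^ r..<(?d + 1) / 2 ^ r}) ((?d + 1) / 2 ^ r - ?d / 2 ^ r)"
      using y(1) by (intro has_integral_mu_interval divide_right_mono) auto
    have "(\<integral>z. ?c i z \<partial>mu) \<le> (\<integral>z. indicator {?d / 2 ^ r..<(?d + 1) / 2 ^ r} z \<partial>mu)"
    proof (intro integral_mono dyadic_step_integrable[OF step])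
      show "integrable mu (indicator {?d / 2 ^ r..<(?d + 1) / 2 ^ r} :: real \<Rightarrow> real)"
        using * by (auto intro: integrable.intros)
      fix z assume "z \<in> space mu"
      then have "\<forall>k<r. xdigit z k = of_bool (k = i) \<Longrightarrow> \<lfloor>2 ^ r * z\<rfloor> = \<lfloor>2 ^ r * y\<rfloor>"
        using y by (intro floor_pow2_cong) auto
      moreover have "\<lfloor>2 ^ r * z\<rfloor> = \<lfloor>2 ^ r * y\<rfloor> \<Longrightarrow> z \<in> {?d / 2 ^ r..<(?d + 1) / 2 ^ r}"
        by (simp add: field_simps floor_eq_iff)
      ultimately show "?c i z \<le> indicator {?d / 2 ^ r..<(?d + 1) / 2 ^ r} z"
        by (intro of_bool_le_indicator) blast
    qed
    also have "\<dots> = 1 / 2 ^ r"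
      using has_bochner_integral_integral_eq[OF *] by (simp add: field_simps)
    finally show ?thesis .
  next
    case False
    have "(\<integral>z. ?c i z \<partial>mu) = (\<integral>z. 0 \<partial>mu)"
    proof (intro Bochner_Integration.integral_cong refl)
      fix z assume "z \<in> space mu"
      with False have "\<not> (\<forall>k<r. xdigit z k = of_bool (k = i))"
        unfolding space_mu by blast
      then show "?c i z = 0"
        unfolding of_bool_eq_0_iff .
    qed
    then show ?thesis by simp
  qed
  have cyl: "cyl_kernel r = (\<lambda>z. \<Sum>i\<le>r. 2 ^ i * ?c i z)"
    by (simp add: cyl_kernel_def fun_eq_iff del: sum_mult_of_bool_eq)
  have "(\<integral>z. cyl_kernel r z \<partial>mu) = (\<Sum>i\<le>r. 2 ^ i * (\<integral>z. ?c i z \<partial>mu))"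
    unfolding cyl
    by (simp only: Bochner_Integration.integral_sum integral_mult_right_zero integrable_mult_right
        dyadic_step_integrable[OF step])
  also have "\<dots> \<le> (\<Sum>i\<le>r. 2 ^ i * (1 / 2 ^ r))"
    by (intro sum_mono mult_left_mono le) simp
  also have "\<dots> = (2 ^ Suc r - 1) / 2 ^ r"
    by (simp add: sum_divide_distrib[symmetric] lessThan_Suc_atMost[symmetric] sum_gp_strict)
  also have "\<dots> \<le> 2"
    by (simp add: field_simps)
  finally show "(\<integral>z. cyl_kernel r z \<partial>mu) \<le> 2" .
  show "integrable mu (cyl_kernel r)"
    unfolding cyl using dyadic_step_integrable[OF step] by (intro Bochner_Integration.integrable_sum integrable_mult_right)
qed

section \<open>Lower bounds for the operator norms\<close>

lemma dyadic_step_nkernel: "m \<le> 2 ^ A \<Longrightarrow> dyadic_step A (nkernel s m)"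
  unfolding nkernel_def by (intro dyadic_step_sum dyadic_step_mult dyadic_step_const dyadic_step_dirichlet) auto

lemma nkernel_scaled: "(\<Sum>l<m. s l * (\<Sum>i<m - l. c * walsh i z)) = c * nkernel s m z"
  by (simp add: nkernel_def walsh_dirichlet_def sum_distrib_left mult_ac)

text \<open>Multiplication by \<open>walsh (2 ^ A)\<close> moves the spectrum of a step function of
  level \<open>A\<close> from the indices below \<open>2 ^ A\<close> to the block from
  \<open>2 ^ A\<close> to \<open>2 ^ Suc A\<close>.\<close>

lemma walsh_coeff_lift:
  assumes "dyadic_step A h"
  shows "i < 2 ^ A \<Longrightarrow> walsh_coeff (\<lambda>z. walsh (2 ^ A) z * h z) i = 0"
    and "j < 2 ^ A \<Longrightarrow> walsh_coeff (\<lambda>z. walsh (2 ^ A) z * h z) (2 ^ A + j) = walsh_coeff h j"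
    and "2 ^ Suc A \<le> i \<Longrightarrow> walsh_coeff (\<lambda>z. walsh (2 ^ A) z * h z) i = 0"
proof -
  assume "i < 2 ^ A"
  then show "walsh_coeff (\<lambda>z. walsh (2 ^ A) z * h z) i = 0"
    unfolding walsh_coeff_def mult.assoc
    by (intro integral_walsh_pow2_mult dyadic_step_mult assms dyadic_step_walsh)
next
  assume "j < 2 ^ A"
  then have "walsh (2 ^ A) z * h z * walsh (2 ^ A + j) z = h z * walsh j z" for z
    by (simp add: walsh_add mult_ac)
  then show "walsh_coeff (\<lambda>z. walsh (2 ^ A) z * h z) (2 ^ A + j) = walsh_coeff h j"
    unfolding walsh_coeff_def by (simp only:)
next
  assume i: "2 ^ Suc A \<le> i"
  moreover have "0 < (2::nat) ^ Suc A"
    by simp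
  ultimately have "i \<noteq> 0"
    by linarith
  then obtain B m where m: "i = 2 ^ B + m" "m < 2 ^ B"
    using pow2_split by metis
  have "i < 2 ^ Suc B"
    using m by simp
  with i have "(2::nat) ^ Suc A < 2 ^ Suc B"
    by (rule le_less_trans)
  then have "Suc A \<le> B"
    by (simp add: less_Suc_eq_le power_strict_increasing_iff del: power_Suc)
  then have "dyadic_step B (\<lambda>z. walsh (2 ^ A) z * h z * walsh m z)"
    using m(2) by (intro dyadic_step_mult dyadic_step_walsh dyadic_step_mono[OF assms]) auto
  then have "(\<integral>z. walsh (2 ^ B) z * (walsh (2 ^ A) z * h z * walsh m z) \<partial>mu) = 0"
    by (rule integral_walsh_pow2_mult)
  then show "walsh_coeff (\<lambda>z. walsh (2 ^ A) z * h z) i = 0"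
    unfolding walsh_coeff_def m(1) walsh_add[OF m(2)] by (simp add: mult_ac)
qed

lemma walsh_partial_sum_lift:
  assumes "dyadic_step A h"
  shows "k \<le> 2 ^ A \<Longrightarrow> walsh_partial_sum k (\<lambda>z. walsh (2 ^ A) z * h z) u = 0"
    and "j \<le> 2 ^ A \<Longrightarrow> walsh_partial_sum (2 ^ A + j) (\<lambda>z. walsh (2 ^ A) z * h z) u =
           walsh (2 ^ A) u * walsh_partial_sum j h u"
    and "2 ^ Suc A \<le> i \<Longrightarrow> walsh_partial_sum i (\<lambda>z. walsh (2 ^ A) z * h z) u =
           walsh (2 ^ A) u * walsh_partial_sum (2 ^ A) h u"
proof -
  let ?g = "\<lambda>z. walsh (2 ^ A) z * h z"
  show low: "k \<le> 2 ^ A \<Longrightarrow> walsh_partial_sum k ?g u = 0" for k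
    unfolding walsh_partial_sum_def using walsh_coeff_lift(1)[OF assms] by (intro sum.neutral) auto
  show mid: "j \<le> 2 ^ A \<Longrightarrow> walsh_partial_sum (2 ^ A + j) ?g u = walsh (2 ^ A) u * walsh_partial_sum j h u" for j
  proof -
    assume j: "j \<le> 2 ^ A"
    have "walsh_partial_sum (2 ^ A + j) ?g u =
        walsh_partial_sum (2 ^ A) ?g u + (\<Sum>i<j. walsh_coeff ?g (2 ^ A + i) * walsh (2 ^ A + i) u)"
      unfolding walsh_partial_sum_def by (subst add.commute) (rule sum_lessThan_add)
    also have "\<dots> = (\<Sum>i<j. walsh_coeff h i * (walsh (2 ^ A) u * walsh i u))"
      using j by (simp add: low walsh_coeff_lift(2)[OF assms] walsh_add)
    finally show ?thesis
      by (simp add: walsh_partial_sum_def sum_distrib_left mult_ac)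
  qed
  assume "2 ^ Suc A \<le> i"
  then have "walsh_partial_sum i ?g u = walsh_partial_sum (2 ^ Suc A) ?g u"
    unfolding walsh_partial_sum_def using walsh_coeff_lift(3)[OF assms]
    by (intro sum.mono_neutral_right) (auto simp: not_less simp del: power_Suc)
  also have "\<dots> = walsh_partial_sum (2 ^ A + 2 ^ A) ?g u"
    by (simp add: mult_2)
  finally show "walsh_partial_sum i ?g u = walsh (2 ^ A) u * walsh_partial_sum (2 ^ A) h u"
    using mid[of "2 ^ A"] by simp
qed

text \<open>Partial sums of order at most \<open>2 ^ A\<close> vanish on a lifted function, so only
  the weights with \<open>l < m\<close> act. This isolates the part of the operator that belongs to
  the order without its leading digit.\<close>

lemma matrix_op_lift:
  assumes "dyadic_step A h" "m < 2 ^ A"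
  shows "matrix_op t (2 ^ A + m) (\<lambda>z. walsh (2 ^ A) z * h z) u =
    walsh (2 ^ A) u * (\<Sum>l<m. t l (2 ^ A + m) * walsh_partial_sum (m - l) h u)"
proof -
  let ?n = "2 ^ A + m" and ?g = "\<lambda>z. walsh (2 ^ A) z * h z"
  have "matrix_op t ?n ?g u = (\<Sum>l\<le>?n. t l ?n * walsh_partial_sum (?n - l) ?g u)"
    unfolding matrix_op_def by (intro sum.reindex_bij_witness[of _ "\<lambda>l. ?n - l" "\<lambda>l. ?n - l"]) auto
  also have "\<dots> = (\<Sum>l<m. t l ?n * walsh_partial_sum (?n - l) ?g u)"
    using walsh_partial_sum_lift(1)[OF assms(1)] by (intro sum.mono_neutral_right) auto
  also have "\<dots> = (\<Sum>l<m. t l ?n * (walsh (2 ^ A) u * walsh_partial_sum (m - l) h u))"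
  proof (intro sum.cong refl)
    fix l assume "l \<in> {..<m}"
    then have l: "?n - l = 2 ^ A + (m - l)" "m - l \<le> 2 ^ A"
      using assms(2) by auto
    show "t l ?n * walsh_partial_sum (?n - l) ?g u = t l ?n * (walsh (2 ^ A) u * walsh_partial_sum (m - l) h u)"
      unfolding l(1) walsh_partial_sum_lift(2)[OF assms(1) l(2)] ..
  qed
  finally show ?thesis
    by (simp add: sum_distrib_left mult_ac)
qed

lemma nn_integral_abs_step:
  "dyadic_step A h \<Longrightarrow> (\<integral>\<^sup>+z. ennreal \<bar>h z\<bar> \<partial>mu) = ennreal (\<integral>z. \<bar>h z\<bar> \<partial>mu)"
  by (intro nn_integral_eq_integral dyadic_step_integrable[of A] dyadic_step_abs) auto

text \<open>The dyadic partial sums of the lifted Dirichlet kernel are 0 or the function itself. Its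
  maximal function is thus bounded by \<open>?D\<close>, which has integral 1, while its image is
  \<open>?V\<close> up to a unimodular factor.\<close>

lemma integral_nkernel_le_H1:
  assumes "m < 2 ^ A"
  shows "ennreal (\<integral>z. \<bar>nkernel (\<lambda>l. t l (2 ^ A + m)) m z\<bar> \<partial>mu) \<le>
    op_norm H1 H1_norm L1_norm (matrix_op t (2 ^ A + m))"
proof -
  let ?D = "walsh_dirichlet (2 ^ A)"
  let ?g = "\<lambda>z. walsh (2 ^ A) z * ?D z" and ?V = "nkernel (\<lambda>l. t l (2 ^ A + m)) m"
  have D: "dyadic_step A ?D"
    by (rule dyadic_step_dirichlet) simp
  have g: "dyadic_step (Suc A) ?g"
    by (intro dyadic_step_mult dyadic_step_walsh dyadic_step_mono[OF D]) auto
  have coeff: "walsh_coeff ?D i = 1" if "i < 2 ^ A" for i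
    using integral_dirichlet_walsh[OF that] by (simp add: walsh_coeff_def)
  then have ps: "walsh_partial_sum j ?D u = walsh_dirichlet j u" if "j \<le> 2 ^ A" for j u
    using that by (simp add: walsh_partial_sum_def walsh_dirichlet_def)
  have "dyadic_maximal ?g u \<le> ennreal \<bar>?D u\<bar>" for u
    unfolding dyadic_maximal_def
  proof (rule SUP_least)
    fix k
    show "ennreal \<bar>walsh_partial_sum (2 ^ k) ?g u\<bar> \<le> ennreal \<bar>?D u\<bar>"
    proof (cases "k \<le> A")
      case True
      then have "(2::nat) ^ k \<le> 2 ^ A" by simp
      then show ?thesis
        using walsh_partial_sum_lift(1)[OF D] by simp
    next
      case False
      then have "(2::nat) ^ Suc A \<le> 2 ^ k"
        by (intro power_increasing) auto
      then show ?thesis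
        using walsh_partial_sum_lift(3)[OF D] ps[of "2 ^ A" u] by (simp add: abs_mult)
    qed
  qed
  then have "H1_norm ?g \<le> (\<integral>\<^sup>+u. ennreal \<bar>?D u\<bar> \<partial>mu)"
    unfolding H1_norm_def by (intro nn_integral_mono)
  also have "\<dots> = ennreal (\<integral>u. ?D u * walsh 0 u \<partial>mu)"
    using nn_integral_abs_step[OF D] walsh_dirichlet_pow2_nonneg by simp
  also have "\<dots> = 1"
    using integral_dirichlet_walsh[of 0 A] by simp
  finally have norm: "H1_norm ?g \<le> 1" .
  then have "H1_norm ?g < \<infinity>"
    using order.strict_trans1[of _ 1 "\<infinity>::ennreal"] by simp
  with norm dyadic_step_integrable[OF g] have "?g \<in> {f \<in> H1. H1_norm f \<le> 1}"
    by (simp add: H1_def)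
  then have "L1_norm (matrix_op t (2 ^ A + m) ?g) \<le> op_norm H1 H1_norm L1_norm (matrix_op t (2 ^ A + m))"
    unfolding op_norm_def by (rule SUP_upper)
  also have "matrix_op t (2 ^ A + m) ?g = (\<lambda>u. walsh (2 ^ A) u * ?V u)"
    using assms by (auto simp: matrix_op_lift[OF D assms] nkernel_def ps intro!: sum.cong)
  also have "L1_norm \<dots> = ennreal (\<integral>z. \<bar>?V z\<bar> \<partial>mu)"
    using assms by (simp add: L1_norm_def abs_mult nn_integral_abs_step[OF dyadic_step_nkernel[of m A]])
  finally show ?thesis .
qed

text \<open>The lifted sign of \<open>?V\<close> has norm at most 1, and near 0 its image equals the
  integral of \<open>?V\<close> times its sign.\<close>

lemma integral_nkernel_le_Linf:
  assumes "m < 2 ^ A"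
  shows "ennreal (\<integral>z. \<bar>nkernel (\<lambda>l. t l (2 ^ A + m)) m z\<bar> \<partial>mu) \<le>
    op_norm Linf Linf_norm Linf_norm (matrix_op t (2 ^ A + m))"
proof -
  let ?s = "\<lambda>l. t l (2 ^ A + m)"
  let ?V = "nkernel ?s m"
  let ?h = "\<lambda>z. sgn (?V z)"
  let ?g = "\<lambda>z. walsh (2 ^ A) z * ?h z"
  let ?I = "\<integral>z. \<bar>?V z\<bar> \<partial>mu"
  have V: "dyadic_step A ?V"
    using assms by (intro dyadic_step_nkernel) simp
  then have h: "dyadic_step A ?h"
    by (rule dyadic_step_comp)
  have g: "dyadic_step (Suc A) ?g"
    by (intro dyadic_step_mult dyadic_step_walsh dyadic_step_mono[OF h]) auto
  have "?g \<in> borel_measurable mu"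
    using dyadic_step_integrable[OF g] by (rule borel_measurable_integrable)
  moreover have norm: "Linf_norm ?g \<le> 1"
    unfolding Linf_norm_def
  proof (rule esssup_I)
    show "(\<lambda>z. ennreal \<bar>?g z\<bar>) \<in> borel_measurable mu"
      using \<open>?g \<in> borel_measurable mu\<close> by measurable
  qed (auto simp: abs_mult abs_sgn_eq)
  moreover have "Linf_norm ?g < \<infinity>"
    using norm order.strict_trans1[of _ 1 "\<infinity>::ennreal"] by simp
  ultimately have "?g \<in> {f \<in> Linf. Linf_norm f \<le> 1}"
    by (simp add: Linf_def)
  then have "Linf_norm (matrix_op t (2 ^ A + m) ?g) \<le> op_norm Linf Linf_norm Linf_norm (matrix_op t (2 ^ A + m))"
    unfolding op_norm_def by (rule SUP_upper)
  moreover have "ennreal ?I \<le> Linf_norm (matrix_op t (2 ^ A + m) ?g)"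
  proof -
    \<comment> \<open>On this interval every Walsh function of index below \<open>2 ^ Suc A\<close>
      is 1, so the image is constant there; its positive measure makes that constant visible to the
      essential supremum.\<close>
    let ?J = "{0..<1 / 2 ^ Suc A :: real}"
    have val: "matrix_op t (2 ^ A + m) ?g u = ?I" if "u \<in> ?J" for u
    proof -
      have "(1::real) / 2 ^ Suc A \<le> 1"
        by (simp add: divide_le_eq del: power_Suc)
      moreover have "0 \<le> u" "u < 1 / 2 ^ Suc A"
        using that by simp_all
      ultimately have "u \<in> {0..<1}"
        unfolding atLeastLessThan_iff by linarith
      then have "walsh_dirichlet (2 ^ Suc A) u = 2 ^ Suc A"
        using walsh_dirichlet_pow2_indicator[of u "Suc A"] that by (simp del: power_Suc)
      then have zero: "\<forall>i<Suc A. xdigit u i = 0"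
        unfolding walsh_dirichlet_pow2 by (simp split: if_splits)
      then have w1: "walsh i u = 1" if "i < 2 ^ Suc A" for i
        using that by (intro walsh_eq_1[of i "Suc A"]) auto
      have "matrix_op t (2 ^ A + m) ?g u = (\<Sum>l<m. ?s l * walsh_partial_sum (m - l) ?h u)"
        unfolding matrix_op_lift[OF h assms] by (simp add: w1)
      also have "\<dots> = (\<Sum>l<m. ?s l * (\<Sum>i<m - l. \<integral>z. ?h z * walsh i z \<partial>mu))"
        using assms by (auto simp: walsh_partial_sum_def walsh_coeff_def w1 intro!: sum.cong)
      also have "\<dots> = (\<integral>z. (\<Sum>l<m. ?s l * (\<Sum>i<m - l. ?h z * walsh i z)) \<partial>mu)"
      proof -
        have int: "integrable mu (\<lambda>z. ?h z * walsh i z)" if "i < m" for i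
          using that assms by (intro dyadic_step_integrable[of A] dyadic_step_mult h dyadic_step_walsh) auto
        then have int2: "integrable mu (\<lambda>z. \<Sum>i<m - l. ?h z * walsh i z)" for l
          by (intro Bochner_Integration.integrable_sum) auto
        show ?thesis
          by (subst Bochner_Integration.integral_sum, use int2 in simp)
            (subst integral_mult_right_zero, subst Bochner_Integration.integral_sum, use int in auto)
      qed
      also have "\<dots> = (\<integral>z. ?h z * ?V z \<partial>mu)"
        unfolding nkernel_scaled ..
      also have "\<dots> = ?I"
        by (simp add: abs_sgn mult.commute)
      finally show ?thesis .
    qed
    show ?thesis
    proof (rule ccontr)
      assume not: "\<not> ennreal ?I \<le> Linf_norm (matrix_op t (2 ^ A + m) ?g)"
      have "AE u in mu. ennreal \<bar>matrix_op t (2 ^ A + m) ?g u\<bar> \<le> Linf_norm (matrix_op t (2 ^ A + m) ?g)"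
        unfolding Linf_norm_def by (rule esssup_AE)
      then have "AE u in mu. u \<notin> ?J"
        by (rule eventually_mono) (use not in \<open>auto simp: val simp del: power_Suc\<close>)
      then have "emeasure mu ?J = 0"
        by (subst AE_iff_measurable[symmetric, where P = "\<lambda>u. u \<notin> ?J"])
          (auto simp: sets_restrict_space_iff simp del: power_Suc intro: order.strict_trans2)
      moreover have "emeasure mu ?J = ennreal (1 / 2 ^ Suc A - 0)"
        by (rule emeasure_mu_interval) (simp_all add: divide_le_eq del: power_Suc)
      ultimately show False by simp
    qed
  qed
  ultimately show ?thesis by (rule order_trans[rotated])
qed

text \<open>On the shell \<open>?J p\<close> the martingale part is constantly
  \<open>2 ^ Suc p\<close> times the difference of two consecutive means; the shell has length
  \<open>2 ^ -(p+1)\<close>, so it contributes exactly \<open>?e p\<close>.\<close>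

lemma integral_martingale_part_ge:
  "(\<Sum>p<A. \<bar>dyadic_mean b p - dyadic_mean b (Suc p)\<bar>) \<le> (\<integral>z. \<bar>martingale_part b A z\<bar> \<partial>mu)"
  and integrable_martingale_part: "integrable mu (\<lambda>z. \<bar>martingale_part b A z\<bar>)"
proof -
  let ?M = "martingale_part b A"
  let ?e = "\<lambda>p. \<bar>dyadic_mean b p - dyadic_mean b (Suc p)\<bar>"
  let ?J = "\<lambda>p. {1 / 2 ^ Suc p..<1 / 2 ^ p :: real}"
  have "dyadic_step A ?M"
    unfolding martingale_part_def
    by (intro dyadic_step_sum dyadic_step_mult dyadic_step_const dyadic_step_diff dyadic_step_dirichlet)
      (auto intro!: power_increasing simp del: power_Suc)
  then show int: "integrable mu (\<lambda>z. \<bar>?M z\<bar>)"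
    by (intro dyadic_step_integrable[of A] dyadic_step_abs)
  have J: "has_bochner_integral mu (\<lambda>z. 2 ^ Suc p * ?e p * indicator (?J p) z) (2 ^ Suc p * ?e p * (1 / 2 ^ p - 1 / 2 ^ Suc p))" for p
    by (intro has_bochner_integral_mult_right has_integral_mu_interval) (auto simp: field_simps)
  have "(\<Sum>p<A. ?e p) = (\<Sum>p<A. 2 ^ Suc p * ?e p * (1 / 2 ^ p - 1 / 2 ^ Suc p))"
    by (intro sum.cong refl) (simp add: field_simps)
  also have "\<dots> = (\<integral>z. (\<Sum>p<A. 2 ^ Suc p * ?e p * indicator (?J p) z) \<partial>mu)"
    using J by (intro has_bochner_integral_integral_eq[symmetric] has_bochner_integral_sum)
  also have "\<dots> \<le> (\<integral>z. \<bar>?M z\<bar> \<partial>mu)"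
  proof (intro integral_mono int)
    show "integrable mu (\<lambda>z. \<Sum>p<A. 2 ^ Suc p * ?e p * indicator (?J p) z)"
      by (intro Bochner_Integration.integrable_sum integrable.intros[OF J])
    fix z assume "z \<in> space mu"
    have digits: "(\<forall>i<p. xdigit z i = 0) \<and> xdigit z p = 1" if z: "z \<in> ?J p" for p
    proof -
      have "xdigit z i = 0" if "i < p" for i
      proof -
        have "(2::real) ^ Suc i \<le> 2 ^ p"
          using that by (intro power_increasing) auto
        then have "2 ^ Suc i * z \<le> 2 ^ p * z"
          using z by (intro mult_right_mono) (auto intro: order_trans[rotated])
        also have "\<dots> < 1"
          using z by (simp add: field_simps)
        finally have "\<lfloor>2 ^ Suc i * z\<rfloor> = 0"
          using z by (auto simp: floor_eq_iff simp del: power_Suc intro!: mult_nonneg_nonneg intro: order_trans[rotated])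
        then show ?thesis
          using int_xdigit[of z i] by simp
      qed
      moreover have "\<lfloor>2 ^ Suc p * z\<rfloor> = 1"
        using z by (simp add: floor_eq_iff field_simps)
      then have "xdigit z p = 1"
        using int_xdigit[of z p] by simp
      ultimately show ?thesis by blast
    qed
    show "(\<Sum>p<A. 2 ^ Suc p * ?e p * indicator (?J p) z) \<le> \<bar>?M z\<bar>"
    proof (cases "\<exists>p<A. z \<in> ?J p")
      case True
      then obtain p where p: "p < A" "z \<in> ?J p" by blast
      \<comment> \<open>The position of the first digit 1 identifies the shell.\<close>
      have uniq: "q = p" if "z \<in> ?J q" for q
        using digits[OF that] digits[OF p(2)] by (metis linorder_neqE_nat zero_neq_one)
      have "(\<Sum>q<A. 2 ^ Suc q * ?e q * indicator (?J q) z) = (\<Sum>q\<in>{p}. 2 ^ Suc q * ?e q * indicator (?J q) z)"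
        using p(1) uniq by (intro sum.mono_neutral_right) (auto simp: indicator_def simp del: atLeastLessThan_iff)
      also have "\<dots> = 2 ^ Suc p * ?e p"
        using p(2) by simp
      also have "\<dots> = \<bar>2 ^ Suc p * (dyadic_mean b p - dyadic_mean b (Suc p))\<bar>"
        by (simp add: abs_mult)
      also have "2 ^ Suc p * (dyadic_mean b p - dyadic_mean b (Suc p)) = ?M z"
        using martingale_part_value[OF p(1), of z b] digits[OF p(2)]
        by (simp add: dyadic_mean_Suc) (simp add: dyadic_mean_def field_simps)
      finally show ?thesis by simp
    next
      case False
      then have "(\<Sum>p<A. 2 ^ Suc p * ?e p * indicator (?J p) z) = 0"
        by (intro sum.neutral) (auto simp: indicator_def simp del: atLeastLessThan_iff)
      then show ?thesis by simp
    qed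
  qed
  finally show "(\<Sum>p<A. ?e p) \<le> (\<integral>z. \<bar>?M z\<bar> \<partial>mu)" .
qed

context averaging_weights
begin

text \<open>The remainder has integral at most \<open>8 = 4 * 2\<close>, from the total mass of
  \<open>tail_coeff\<close> and the integral of each \<open>cyl_kernel\<close>; together with
  \<open>variation_le_dyadic_mean\<close> this gives \<open>27 = 3 + 3 * 8\<close>.\<close>

lemma variation_le_L1:
  assumes "(\<integral>z. \<bar>nkernel s (n mod 2 ^ floor_log n) z\<bar> \<partial>mu) \<le> C"
  shows "variation \<le> 27 + 3 * C"
proof -
  let ?A = "floor_log n"
  let ?V = "\<lambda>z. \<bar>nkernel s (n mod 2 ^ ?A) z\<bar>"
  let ?T = "\<lambda>z. \<Sum>r\<le>?A. tail_coeff s n ?A r * cyl_kernel r z"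
  have V: "integrable mu ?V"
    by (intro dyadic_step_integrable[of ?A] dyadic_step_abs dyadic_step_nkernel) simp
  have T: "integrable mu ?T"
    using integral_cyl_kernel_le(1) by (intro Bochner_Integration.integrable_sum integrable_mult_right)
  have "(\<Sum>p<?A. \<bar>dyadic_mean b p - dyadic_mean b (Suc p)\<bar>) \<le> (\<integral>z. \<bar>martingale_part b ?A z\<bar> \<partial>mu)"
    by (rule integral_martingale_part_ge)
  also have "\<dots> \<le> (\<integral>z. ?V z + ?T z \<partial>mu)"
    using abs_martingale_part_le_nkernel V T
    by (intro integral_mono integrable_martingale_part Bochner_Integration.integrable_add)
  also have "\<dots> = (\<integral>z. ?V z \<partial>mu) + (\<integral>z. ?T z \<partial>mu)"
    using V T by (rule Bochner_Integration.integral_add)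
  also have "(\<integral>z. ?T z \<partial>mu) = (\<Sum>r\<le>?A. tail_coeff s n ?A r * (\<integral>z. cyl_kernel r z \<partial>mu))"
    by (simp only: Bochner_Integration.integral_sum integral_mult_right_zero integrable_mult_right integral_cyl_kernel_le(1))
  also have "\<dots> \<le> (\<Sum>r\<le>?A. tail_coeff s n ?A r * 2)"
    using tail_coeff_nonneg integral_cyl_kernel_le(2) by (intro sum_mono mult_left_mono)
  also have "\<dots> \<le> 8"
    using sum_tail_coeff_le[of ?A] by (simp flip: sum_distrib_right)
  finally show ?thesis
    using variation_le_dyadic_mean assms by linarith
qed

end

section \<open>Dyadic translation\<close>

lemma binary_expansion_digits:
  fixes d :: "nat \<Rightarrow> nat"
  assumes le: "\<And>k. d k \<le> 1" and zeros: "\<And>N. \<exists>k\<ge>N. d k = 0"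
  defines "z \<equiv> (\<Sum>n. real (d n) / 2 ^ (n + 1))"
  shows "xdigit z k = d k" and "z \<in> {0..<1}"
proof -
  \<comment> \<open>\<open>R m\<close> is the tail of the expansion after \<open>m\<close> digits,
    rescaled by \<open>2 ^ m\<close>; a later digit 0 makes it strictly less than 1, so it is the
    fractional part of \<open>2 ^ m * z\<close>.\<close>
  define R where "R m = (\<Sum>n. real (d (n + m)) / 2 ^ (n + 1))" for m
  have geom: "(\<lambda>n. 1 / 2 ^ (n + 1) :: real) sums 1"
    using power_half_series by (simp add: power_divide)
  have term_le: "real (d (n + m)) / 2 ^ (n + 1) \<le> 1 / 2 ^ (n + 1)" for n m
    using le[of "n + m"] by (intro divide_right_mono) auto
  have summ: "summable (\<lambda>n. real (d (n + m)) / 2 ^ (n + 1))" for m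
    by (rule summable_comparison_test'[OF sums_summable[OF geom], of 0]) (use term_le in auto)
  have R_ge: "0 \<le> R m" for m
    unfolding R_def by (intro suminf_nonneg summ) auto
  have R_less: "R m < 1" for m
  proof -
    obtain k where k: "k \<ge> m" "d k = 0"
      using zeros by blast
    have "0 < (\<Sum>n. 1 / 2 ^ (n + 1) - real (d (n + m)) / 2 ^ (n + 1))"
    proof (rule suminf_pos2)
      show "summable (\<lambda>n. 1 / 2 ^ (n + 1) - real (d (n + m)) / 2 ^ (n + 1))"
        by (intro summable_diff summ sums_summable[OF geom])
      show "0 < 1 / 2 ^ (k - m + 1) - real (d (k - m + m)) / 2 ^ (k - m + 1)"
        using k by simp
    qed (use term_le in simp)
    also have "\<dots> = 1 - R m"
      unfolding R_def using suminf_diff[OF sums_summable[OF geom] summ[of m]] sums_unique[OF geom] by simp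
    finally show ?thesis by simp
  qed
  have R_Suc: "2 * R m = real (d m) + R (Suc m)" for m
  proof -
    have "R m = (\<Sum>n. real (d (Suc n + m)) / 2 ^ (Suc n + 1)) + real (d m) / 2"
      unfolding R_def using suminf_split_head[OF summ[of m]] by simp
    also have "(\<Sum>n. real (d (Suc n + m)) / 2 ^ (Suc n + 1)) = (\<Sum>n. (1 / 2) * (real (d (n + Suc m)) / 2 ^ (n + 1)))"
      by (intro suminf_cong) simp
    also have "\<dots> = (1 / 2) * R (Suc m)"
      unfolding R_def by (rule suminf_mult[OF summ])
    finally show ?thesis by simp
  qed
  have "\<exists>M::int. 2 ^ m * z = of_int M + R m" for m
  proof (induction m)
    case 0
    show ?case by (intro exI[of _ 0]) (simp add: z_def R_def)
  next
    case (Suc m)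
    then obtain M :: int where "2 ^ m * z = of_int M + R m" by blast
    then have "2 ^ Suc m * z = of_int (2 * M + int (d m)) + R (Suc m)"
      using R_Suc[of m] by simp
    then show ?case by blast
  qed
  then obtain M :: int where "2 ^ k * z = of_int M + R k" by blast
  then have "2 ^ Suc k * z = of_int (2 * M + int (d k)) + R (Suc k)"
    using R_Suc[of k] by simp
  then have "\<lfloor>2 ^ Suc k * z\<rfloor> = 2 * M + int (d k)"
    using R_ge[of "Suc k"] R_less[of "Suc k"] by (intro floor_unique) auto
  then have "int (xdigit z k) = int (d k) mod 2"
    unfolding int_xdigit by simp
  then show "xdigit z k = d k"
    using le[of k] by simp
  show "z \<in> {0..<1}"
    using R_ge[of 0] R_less[of 0] by (simp add: z_def R_def)
qed

lemma sum_xdigit: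
  assumes "x \<in> {0..<1}"
  shows "(\<Sum>k<n. real (xdigit x k) / 2 ^ (k + 1)) = \<lfloor>2 ^ n * x\<rfloor> / 2 ^ n"
proof (induction n)
  case 0
  have "\<lfloor>x\<rfloor> = 0"
    using assms by (simp add: floor_eq_iff)
  then show ?case by simp
next
  case (Suc n)
  have "real_of_int \<lfloor>2 ^ Suc n * x\<rfloor> = 2 * real_of_int \<lfloor>2 ^ n * x\<rfloor> + real (xdigit x n)"
    by (simp add: floor_pow2_Suc del: power_Suc)
  then show ?case
    using Suc by (simp add: add_divide_distrib del: power_Suc) simp
qed

lemma xdigit_sums:
  assumes "x \<in> {0..<1}"
  shows "(\<lambda>k. real (xdigit x k) / 2 ^ (k + 1)) sums x"
  unfolding sums_def sum_xdigit[OF assms]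
proof (rule tendsto_sandwich)
  have half: "(\<lambda>n. (1 / 2) ^ n :: real) \<longlonglongrightarrow> 0"
    by (rule LIMSEQ_realpow_zero) auto
  show "(\<lambda>n. x - (1 / 2) ^ n) \<longlonglongrightarrow> x"
    using tendsto_diff[OF tendsto_const half, of x] by simp
  show "(\<lambda>n. x) \<longlonglongrightarrow> x" by simp
  show "\<forall>\<^sub>F n in sequentially. x - (1 / 2) ^ n \<le> \<lfloor>2 ^ n * x\<rfloor> / 2 ^ n"
  proof (intro always_eventually allI)
    fix n
    have "(2 ^ n * x - 1) / 2 ^ n \<le> \<lfloor>2 ^ n * x\<rfloor> / 2 ^ n"
      by (intro divide_right_mono) (linarith, simp)
    then show "x - (1 / 2) ^ n \<le> \<lfloor>2 ^ n * x\<rfloor> / 2 ^ n"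
      by (simp add: diff_divide_distrib power_divide)
  qed
  show "\<forall>\<^sub>F n in sequentially. \<lfloor>2 ^ n * x\<rfloor> / 2 ^ n \<le> x"
    by (intro always_eventually allI) (simp add: field_simps)
qed

lemma xdigit_infinitely_many_zeros:
  assumes "x \<in> {0..<1}"
  shows "\<exists>k\<ge>N. xdigit x k = 0"
proof (rule ccontr)
  assume "\<not> ?thesis"
  then have one: "xdigit x k = 1" if "k \<ge> N" for k
    using that xdigit_cases by metis
  let ?c = "real_of_int (\<lfloor>2 ^ N * x\<rfloor> + 1)"
  \<comment> \<open>If only ones followed, the right endpoint of the dyadic interval of
    \<open>x\<close> would never move, and \<open>x\<close> would have to equal that excluded
    endpoint.\<close>
  have floor: "\<lfloor>2 ^ (N + j) * x\<rfloor> + 1 = 2 ^ j * (\<lfloor>2 ^ N * x\<rfloor> + 1)" for j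
  proof (induction j)
    case (Suc j)
    have "\<lfloor>2 ^ (N + Suc j) * x\<rfloor> = 2 * \<lfloor>2 ^ (N + j) * x\<rfloor> + 1"
      unfolding add_Suc_right floor_pow2_Suc by (simp add: one)
    then have "\<lfloor>2 ^ (N + Suc j) * x\<rfloor> + 1 = 2 * (\<lfloor>2 ^ (N + j) * x\<rfloor> + 1)"
      by simp
    then show ?case
      unfolding Suc by simp
  qed simp
  have "?c - 2 ^ N * x \<le> (1 / 2) ^ j" for j
  proof -
    have "2 ^ j * ?c = real_of_int (\<lfloor>2 ^ (N + j) * x\<rfloor> + 1)"
      unfolding floor by simp
    also have "\<dots> \<le> 2 ^ (N + j) * x + 1" by simp
    finally show ?thesis
      by (simp add: field_simps power_add power_divide)
  qed
  then have "?c - 2 ^ N * x \<le> 0"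
    using LIMSEQ_realpow_zero[of "1 / 2"] by (intro LIMSEQ_le_const) auto
  then show False by linarith
qed

text \<open>
  Exactly when this fails, \<open>x \<dotplus> u\<close> need not have the digits that its defining sum displays.
\<close>

definition regular_translate :: "real \<Rightarrow> real \<Rightarrow> bool" where
  "regular_translate x u \<longleftrightarrow> (\<forall>N. \<exists>k\<ge>N. xdigit x k = xdigit u k)"

lemma dotplus_regular:
  assumes "regular_translate x u"
  shows "xdigit (x \<dotplus> u) k = of_bool (xdigit x k \<noteq> xdigit u k)" and "x \<dotplus> u \<in> {0..<1}"
proof -
  have "\<bar>real (xdigit x n) - real (xdigit u n)\<bar> = real (of_bool (xdigit x n \<noteq> xdigit u n))" for n
    using xdigit_cases[of x n] xdigit_cases[of u n] by auto
  then have *: "x \<dotplus> u = (\<Sum>n. real (of_bool (xdigit x n \<noteq> xdigit u n)) / 2 ^ (n + 1))"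
    unfolding dotplus_def by simp
  show "xdigit (x \<dotplus> u) k = of_bool (xdigit x k \<noteq> xdigit u k)" "x \<dotplus> u \<in> {0..<1}"
    unfolding * by (rule binary_expansion_digits; use assms in \<open>auto simp: regular_translate_def\<close>)+
qed

lemma walsh_dotplus:
  assumes "regular_translate x u"
  shows "walsh n (x \<dotplus> u) = walsh n x * walsh n u"
proof -
  have "(-1 :: real) ^ (c * of_bool (xdigit x k \<noteq> xdigit u k)) = (-1) ^ (c * xdigit x k) * (-1) ^ (c * xdigit u k)" for c k
    using xdigit_cases[of x k] xdigit_cases[of u k] by (auto simp flip: power_mult_distrib)
  then show ?thesis
    unfolding walsh_def power_sum dotplus_regular(1)[OF assms] by (simp add: prod.distrib)
qed

text \<open>Such a \<open>u\<close> has, from some \<open>N\<close> on, the digits complementary to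
  those of \<open>x\<close>, so \<open>N\<close> and the integer formed by the first
  \<open>N\<close> digits determine it.\<close>

lemma countable_not_regular: "countable {u \<in> {0..<1}. \<not> regular_translate x u}"
proof (rule countable_subset)
  let ?c = "\<lambda>N. \<Sum>n. (1 - real (xdigit x (n + N))) / 2 ^ (n + N + 1)"
  show "{u \<in> {0..<1}. \<not> regular_translate x u} \<subseteq> range (\<lambda>(N, p::int). p / 2 ^ N + ?c N)"
  proof
    fix u assume "u \<in> {u \<in> {0..<1}. \<not> regular_translate x u}"
    then obtain N where u: "u \<in> {0..<1}" and N: "\<And>k. k \<ge> N \<Longrightarrow> xdigit x k \<noteq> xdigit u k"
      by (auto simp: regular_translate_def)
    have "real (xdigit u (n + N)) = 1 - real (xdigit x (n + N))" for n
      using N[of "n + N"] xdigit_cases[of x "n + N"] xdigit_cases[of u "n + N"] by auto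
    then have "u = ?c N + (\<Sum>k<N. real (xdigit u k) / 2 ^ (k + 1))"
      using suminf_split_initial_segment[OF sums_summable[OF xdigit_sums[OF u]], of N] sums_unique[OF xdigit_sums[OF u]]
      by simp
    then have "u = \<lfloor>2 ^ N * u\<rfloor> / 2 ^ N + ?c N"
      unfolding sum_xdigit[OF u] by simp
    then show "u \<in> range (\<lambda>(N, p::int). p / 2 ^ N + ?c N)"
      by (intro image_eqI[of _ _ "(N, \<lfloor>2 ^ N * u\<rfloor>)"]) auto
  qed
qed simp

lemma xdigit_unit: "xdigit (1 / 2 ^ (i + 1)) k = of_bool (k = i)"
proof -
  have "(\<lambda>n. real (of_bool (n = i)) / 2 ^ (n + 1)) sums (1 / 2 ^ (i + 1))"
  proof -
    have "(\<lambda>n. if n = i then 1 / 2 ^ (n + 1) else 0 :: real) sums (1 / 2 ^ (i + 1))"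
      by (rule sums_single)
    also have "(\<lambda>n. if n = i then 1 / 2 ^ (n + 1) else 0 :: real) = (\<lambda>n. real (of_bool (n = i)) / 2 ^ (n + 1))"
      by auto
    finally show ?thesis .
  qed
  then have *: "1 / 2 ^ (i + 1) = (\<Sum>n. real (of_bool (n = i)) / 2 ^ (n + 1))"
    by (rule sums_unique)
  show ?thesis
    unfolding *
  proof (rule binary_expansion_digits(1))
    fix N
    show "\<exists>k\<ge>N. (of_bool (k = i) :: nat) = 0"
      by (intro exI[of _ "Suc (N + i)"]) simp
  qed simp
qed

text \<open>Both points have the digit 0 in infinitely many common positions. The centres of the
  intervals in the Walsh-Lebesgue sums are therefore always regular translates.\<close>

lemma regular_translate_unit:
  assumes "x \<in> {0..<1}"
  shows "regular_translate x (1 / 2 ^ (i + 1))"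
  unfolding regular_translate_def xdigit_unit
proof
  fix N
  obtain k where "k \<ge> max N (Suc i)" "xdigit x k = 0"
    using xdigit_infinitely_many_zeros[OF assms] by blast
  then show "\<exists>k\<ge>N. xdigit x k = of_bool (k = i)"
    by (intro exI[of _ k]) auto
qed

lemma mem_dyadic_interval: "u \<in> dyadic_interval r y \<longleftrightarrow> \<lfloor>2 ^ r * u\<rfloor> = \<lfloor>2 ^ r * y\<rfloor>"
  unfolding dyadic_interval_def by (auto simp: floor_eq_iff field_simps)

text \<open>Prescribing the first \<open>r\<close> digits of \<open>x \<dotplus> u\<close>
  prescribes those of \<open>u\<close>, which places \<open>u\<close> in the stated
  interval.\<close>

lemma cyl_kernel_dotplus_le:
  assumes "x \<in> {0..<1}" "u \<in> {0..<1}" "regular_translate x u"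
  shows "cyl_kernel r (x \<dotplus> u) \<le> (\<Sum>i\<le>r. 2 ^ i * indicator (dyadic_interval r (x \<dotplus> 1 / 2 ^ (i + 1))) u)"
  unfolding cyl_kernel_def
proof (intro sum_mono mult_left_mono of_bool_le_indicator)
  fix i assume digits: "\<forall>k<r. xdigit (x \<dotplus> u) k = of_bool (k = i)"
  note reg = regular_translate_unit[OF assms(1), of i]
  have "xdigit u k = xdigit (x \<dotplus> 1 / 2 ^ (i + 1)) k" if "k < r" for k
  proof -
    have "(xdigit x k \<noteq> xdigit u k) = (k = i)"
      using digits[rule_format, OF that] unfolding dotplus_regular(1)[OF assms(3)] of_bool_eq_iff .
    then show ?thesis
      unfolding dotplus_regular(1)[OF reg] xdigit_unit
      using xdigit_cases[of x k] xdigit_cases[of u k] by auto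
  qed
  then show "u \<in> dyadic_interval r (x \<dotplus> 1 / 2 ^ (i + 1))"
    unfolding mem_dyadic_interval using dotplus_regular(2)[OF reg] assms(2) by (intro floor_pow2_cong)
qed simp

lemma measurable_xdigit [measurable]: "(\<lambda>x. xdigit x k) \<in> measurable borel (count_space UNIV)"
  unfolding xdigit_def by measurable

lemma measurable_walsh [measurable]: "walsh n \<in> borel_measurable borel"
  unfolding walsh_def by measurable

lemma measurable_walsh_dirichlet [measurable]: "walsh_dirichlet n \<in> borel_measurable borel"
  unfolding walsh_dirichlet_def by measurable

lemma measurable_matrix_kernel [measurable]: "matrix_kernel t n \<in> borel_measurable borel"
  unfolding matrix_kernel_def by measurable

lemma measurable_dotplus [measurable]: "(\<lambda>u. x \<dotplus> u) \<in> borel_measurable borel"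
  unfolding dotplus_def by measurable

section \<open>Integration on the square\<close>

text \<open>The multiplicative form of the translated kernel. It agrees with
  \<open>matrix_kernel\<close> at every regular translate and, unlike \<open>\<dotplus>\<close>,
  lets the integral be computed termwise.\<close>

definition translated_kernel :: "(nat \<Rightarrow> nat \<Rightarrow> real) \<Rightarrow> nat \<Rightarrow> real \<Rightarrow> real \<Rightarrow> real" where
  "translated_kernel t n x u = (\<Sum>k=1..n. t (n - k) n * (\<Sum>j<k. walsh j x * walsh j u))"

lemma matrix_kernel_dotplus:
  "regular_translate x u \<Longrightarrow> matrix_kernel t n (x \<dotplus> u) = translated_kernel t n x u"
  by (simp add: matrix_kernel_def translated_kernel_def walsh_dirichlet_def walsh_dotplus)

lemma measurable_translated_kernel [measurable]: "translated_kernel t n x \<in> borel_measurable borel"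
  unfolding translated_kernel_def by measurable

lemma abs_translated_kernel_le: "\<bar>translated_kernel t n x u\<bar> \<le> (\<Sum>k=1..n. \<bar>t (n - k) n\<bar> * k)"
  unfolding translated_kernel_def
proof (intro order_trans[OF sum_abs] sum_mono)
  fix k
  have "\<bar>\<Sum>j<k. walsh j x * walsh j u\<bar> \<le> (\<Sum>j<k. \<bar>walsh j x * walsh j u\<bar>)"
    by (rule sum_abs)
  then have "\<bar>\<Sum>j<k. walsh j x * walsh j u\<bar> \<le> k"
    by (simp add: abs_mult)
  then show "\<bar>t (n - k) n * (\<Sum>j<k. walsh j x * walsh j u)\<bar> \<le> \<bar>t (n - k) n\<bar> * k"
    by (simp add: abs_mult mult_left_mono)
qed

lemma integrable_walsh: "integrable mu (walsh j)"
  by (rule dyadic_step_integrable[of j]) (intro dyadic_step_walsh, simp)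

text \<open>Each Dirichlet kernel of positive order has integral 1; the weight \<open>t n n\<close>
  is missing because it belongs to order 0.\<close>

lemma integral_translated_kernel:
  assumes "transformation_matrix t"
  shows "(\<integral>u. translated_kernel t n x u \<partial>mu) = 1 - t n n"
proof -
  have "(\<integral>u. translated_kernel t n x u \<partial>mu) =
      (\<Sum>k=1..n. t (n - k) n * (\<Sum>j<k. walsh j x * (\<integral>u. walsh j u \<partial>mu)))"
    unfolding translated_kernel_def
    by (simp only: Bochner_Integration.integral_sum Bochner_Integration.integrable_sum
        integral_mult_right_zero integrable_mult_right integrable_walsh)
  also have "\<dots> = (\<Sum>k=1..n. t (n - k) n)"
  proof (intro sum.cong refl)
    fix k assume "k \<in> {1..n}"
    then have "0 \<in> {..<k}" by simp
    then have "(\<Sum>j<k. walsh j x * of_bool (j = 0)) = (\<Sum>j\<in>{0}. walsh j x * of_bool (j = 0))"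
      by (intro sum.mono_neutral_right) auto
    then show "t (n - k) n * (\<Sum>j<k. walsh j x * (\<integral>u. walsh j u \<partial>mu)) = t (n - k) n"
      unfolding integral_walsh by simp
  qed
  also have "\<dots> = (\<Sum>k<n. t k n)"
    by (intro sum.reindex_bij_witness[of _ "\<lambda>k. n - k" "\<lambda>k. n - k"]) auto
  also have "\<dots> = 1 - t n n"
    using assms unfolding transformation_matrix_def lessThan_Suc_atMost[symmetric] by (auto simp: algebra_simps)
  finally show ?thesis .
qed

lemma sets_times_borel:
  fixes A B :: "real set"
  shows "A \<in> sets borel \<Longrightarrow> B \<in> sets borel \<Longrightarrow> A \<times> B \<in> sets borel"
  unfolding borel_prod[symmetric] by (rule pair_measureI)

lemma sets_square: "unit_I \<times> unit_I \<in> sets borel"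
  by (rule sets_times_borel) simp_all

lemma sets_lebesgue_square: "unit_I \<times> unit_I \<in> sets lebesgue"
  using sets_square by (intro sets_completionI_sets) simp

lemma emeasure_square: "emeasure lborel (unit_I \<times> unit_I) = 1"
  unfolding lborel_prod[symmetric] by (subst lborel.emeasure_pair_measure_Times) (simp_all add: emeasure_lborel_Ico)

lemma finite_measure_mu2: "finite_measure mu2"
proof
  have "emeasure mu2 (space mu2) = 1"
    using emeasure_square sets_square sets_lebesgue_square
    by (simp add: space_restrict_space emeasure_restrict_space)
  then show "emeasure mu2 (space mu2) \<noteq> \<infinity>" by simp
qed

lemma measurable_mu2: "F \<in> borel_measurable borel \<Longrightarrow> F \<in> borel_measurable mu2"
  by (intro measurable_restrict_space1 measurable_completion) simp

lemma
  fixes F :: "real \<Rightarrow> real"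
  assumes [measurable]: "F \<in> borel_measurable borel"
  shows measurable_fst_mu2: "(\<lambda>u. F (fst u)) \<in> borel_measurable mu2"
    and measurable_snd_mu2: "(\<lambda>u. F (snd u)) \<in> borel_measurable mu2"
proof -
  have fst: "(\<lambda>u::real \<times> real. F (fst u)) \<in> borel_measurable (borel \<Otimes>\<^sub>M borel)"
    and snd: "(\<lambda>u::real \<times> real. F (snd u)) \<in> borel_measurable (borel \<Otimes>\<^sub>M borel)"
    by measurable
  show "(\<lambda>u. F (fst u)) \<in> borel_measurable mu2"
    by (rule measurable_mu2[OF fst[unfolded borel_prod]])
  show "(\<lambda>u. F (snd u)) \<in> borel_measurable mu2"
    by (rule measurable_mu2[OF snd[unfolded borel_prod]])
qed

lemma integral_lebesgue_on_borel:
  fixes F :: "'a::euclidean_space \<Rightarrow> real"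
  assumes "F \<in> borel_measurable borel" "S \<in> sets borel"
  shows "(\<integral>u. F u \<partial>lebesgue_on S) = (\<integral>u. indicator S u * F u \<partial>lborel)"
  using assms by (subst integral_restrict_space) (simp_all add: integral_completion)

text \<open>\<open>mu2\<close> is a completed measure; for Borel integrands the integral can be
  moved to the product of two copies of \<open>lborel\<close>, where Fubini applies.\<close>

lemma integral_mu2_product:
  fixes g h :: "real \<Rightarrow> real"
  assumes [measurable]: "g \<in> borel_measurable borel" "h \<in> borel_measurable borel"
    and bounds: "\<And>u. \<bar>g u\<bar> \<le> B" "\<And>u. \<bar>h u\<bar> \<le> C"
  shows "(\<integral>u. g (fst u) * h (snd u) \<partial>mu2) = (\<integral>u. g u \<partial>mu) * (\<integral>u. h u \<partial>mu)"
proof -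
  let ?g = "\<lambda>u. indicator {0..<1} u * g u" and ?h = "\<lambda>u. indicator {0..<1} u * h u"
  let ?F = "\<lambda>u. ?g (fst u) * ?h (snd u)"
  have meas: "?F \<in> borel_measurable (lborel \<Otimes>\<^sub>M lborel)"
    by measurable
  have int: "integrable (lborel \<Otimes>\<^sub>M lborel) ?F"
  proof (rule integrableI_bounded_set[where A = "unit_I \<times> unit_I" and B = "B * C"])
    show "emeasure (lborel \<Otimes>\<^sub>M lborel) (unit_I \<times> unit_I) < \<infinity>"
      unfolding lborel_prod emeasure_square by simp
    have "norm (?F u) \<le> B * C" for u
    proof -
      have "\<bar>g (fst u) * h (snd u)\<bar> \<le> B * C"
        unfolding abs_mult using bounds by (intro mult_mono order_trans[OF abs_ge_zero bounds(1)[of 0]]) auto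
      moreover have "0 \<le> B * C"
        using calculation abs_ge_zero order_trans by blast
      ultimately show ?thesis
        by (auto simp: indicator_def)
    qed
    then show "AE u in lborel \<Otimes>\<^sub>M lborel. u \<in> unit_I \<times> unit_I \<longrightarrow> norm (?F u) \<le> B * C"
      by simp
  qed (use meas in \<open>auto simp: indicator_def\<close>)
  have "(\<integral>u. g (fst u) * h (snd u) \<partial>mu2) = (\<integral>u. indicator (unit_I \<times> unit_I) u * (g (fst u) * h (snd u)) \<partial>lborel)"
    by (rule integral_lebesgue_on_borel[OF _ sets_square]) (unfold borel_prod[symmetric], measurable)
  also have "\<dots> = (\<integral>u. ?F u \<partial>(lborel \<Otimes>\<^sub>M lborel))"
    unfolding lborel_prod by (intro Bochner_Integration.integral_cong refl) (auto simp: indicator_def)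
  also have "\<dots> = (\<integral>a. (\<integral>b. ?g a * ?h b \<partial>lborel) \<partial>lborel)"
    using lborel_pair.integral_fst'[OF int] by simp
  also have "\<dots> = (\<integral>a. ?g a \<partial>lborel) * (\<integral>b. ?h b \<partial>lborel)"
    by simp
  also have "\<dots> = (\<integral>u. g u \<partial>mu) * (\<integral>u. h u \<partial>mu)"
    by (simp add: integral_lebesgue_on_borel)
  finally show ?thesis .
qed

text \<open>The exceptional points lie in two families of countably many lines, each family a null
  set of the plane.\<close>

lemma AE_mu2_regular:
  "AE u in mu2. regular_translate x0 (fst u) \<and> regular_translate x1 (snd u)"
proof -
  let ?E = "\<lambda>x. {u \<in> {0..<1}. \<not> regular_translate x u}"
  have E: "?E x \<in> null_sets lborel" for x
    by (rule countable_imp_null_set_lborel[OF countable_not_regular])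
  have "?E x0 \<times> UNIV \<in> null_sets (lborel \<Otimes>\<^sub>M lborel)"
    using E by (rule lborel.times_in_null_sets1) simp
  moreover have "UNIV \<times> ?E x1 \<in> null_sets (lborel \<Otimes>\<^sub>M lborel)"
    by (rule lborel.times_in_null_sets2) (simp, rule E)
  ultimately have "(?E x0 \<times> UNIV) \<union> (UNIV \<times> ?E x1) \<in> null_sets (lborel :: (real \<times> real) measure)"
    unfolding lborel_prod by (rule null_sets.Un)
  then have "AE u in lebesgue. u \<notin> (?E x0 \<times> UNIV) \<union> (UNIV \<times> ?E x1)"
    by (intro AE_completion AE_not_in)
  then have "AE u in lebesgue. u \<in> unit_I \<times> unit_I \<longrightarrow>
      regular_translate x0 (fst u) \<and> regular_translate x1 (snd u)"
    by (rule eventually_mono) auto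
  then show ?thesis
    using sets_lebesgue_square by (subst AE_restrict_space_iff) simp_all
qed

lemma measurable_dyadic_interval: "dyadic_interval n y \<in> sets borel"
  unfolding dyadic_interval_def by simp

definition cyl_bound :: "nat \<Rightarrow> real \<Rightarrow> real \<Rightarrow> real" where
  "cyl_bound r y u = (\<Sum>i\<le>r. 2 ^ i * indicator (dyadic_interval r (y \<dotplus> 1 / 2 ^ (i + 1))) u)"

context
  fixes f :: "real \<times> real \<Rightarrow> real" and x :: "real \<times> real"
  assumes f: "integrable mu2 f" and x: "x \<in> unit_I \<times> unit_I"
begin

lemma integrable_deviation: "integrable mu2 (\<lambda>u. \<bar>f u - f x\<bar>)"
  using f finite_measure.integrable_const[OF finite_measure_mu2]
  by (intro integrable_abs Bochner_Integration.integrable_diff)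

lemma integrable_deviation_indicator:
  assumes "A \<in> sets borel" "B \<in> sets borel"
  shows "integrable mu2 (\<lambda>u. indicator (A \<times> B) u * \<bar>f u - f x\<bar>)"
proof (rule Bochner_Integration.integrable_bound[OF integrable_deviation])
  have "A \<times> B \<in> sets borel"
    using assms by (rule sets_times_borel)
  then have [measurable]: "(indicator (A \<times> B) :: _ \<Rightarrow> real) \<in> borel_measurable mu2"
    by (intro measurable_mu2 borel_measurable_indicator)
  have [measurable]: "(\<lambda>u. \<bar>f u - f x\<bar>) \<in> borel_measurable mu2"
    using integrable_deviation by (rule borel_measurable_integrable)
  show "(\<lambda>u. indicator (A \<times> B) u * \<bar>f u - f x\<bar>) \<in> borel_measurable mu2"
    by measurable
qed (auto simp: indicator_def)

lemma integral_deviation_indicator_mono: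
  assumes "A \<in> sets borel" "B \<in> sets borel" "A' \<in> sets borel" "B' \<in> sets borel"
    and "A \<inter> {0..<1} \<subseteq> A'" "B \<inter> {0..<1} \<subseteq> B'"
  shows "(LINT s:A \<times> B|mu2. \<bar>f s - f x\<bar>) \<le> (LINT s:A' \<times> B'|mu2. \<bar>f s - f x\<bar>)"
  unfolding set_lebesgue_integral_def real_scaleR_def using assms
  by (intro integral_mono integrable_deviation_indicator) (auto simp: indicator_def space_restrict_space)

lemma integral_deviation_indicator_nonneg: "0 \<le> (LINT s:A|mu2. \<bar>f s - f x\<bar>)"
  unfolding set_lebesgue_integral_def by (rule Bochner_Integration.integral_nonneg) simp

text \<open>Enlarging the first side to the whole unit interval leaves a geometric sum in
  \<open>i0\<close>. For bounded \<open>r\<close> this bounds \<open>WL_W\<close> uniformly in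
  \<open>q\<close>.\<close>

lemma WL_W_le_G1: "WL_W f r q x \<le> 2 * 2 ^ r * WL_G1 f q x"
proof -
  let ?J = "\<lambda>i. dyadic_interval q (snd x \<dotplus> 1 / 2 ^ (i + 1))"
  have "WL_W f r q x \<le> (\<Sum>i0\<le>r. \<Sum>i1\<le>q. 2 ^ (i0 + i1) * (LINT s:unit_I \<times> ?J i1|mu2. \<bar>f s - f x\<bar>))"
    unfolding WL_W_def
    by (intro sum_mono mult_left_mono integral_deviation_indicator_mono measurable_dyadic_interval) auto
  also have "\<dots> = (\<Sum>i0\<le>r. 2 ^ i0 * WL_G1 f q x)"
    unfolding WL_G1_def sum_distrib_left by (simp add: power_add mult_ac)
  also have "\<dots> = (2 * 2 ^ r - 1) * WL_G1 f q x"
    by (simp add: sum_distrib_right[symmetric] lessThan_Suc_atMost[symmetric] sum_gp_strict)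
  also have "\<dots> \<le> 2 * 2 ^ r * WL_G1 f q x"
    unfolding WL_G1_def
    by (intro mult_right_mono sum_nonneg mult_nonneg_nonneg integral_deviation_indicator_nonneg) auto
  finally show ?thesis .
qed

lemma WL_W_le_G0: "WL_W f r q x \<le> 2 * 2 ^ q * WL_G0 f r x"
proof -
  let ?J = "\<lambda>i. dyadic_interval r (fst x \<dotplus> 1 / 2 ^ (i + 1))"
  have "WL_W f r q x \<le> (\<Sum>i0\<le>r. \<Sum>i1\<le>q. 2 ^ (i0 + i1) * (LINT s:?J i0 \<times> unit_I|mu2. \<bar>f s - f x\<bar>))"
    unfolding WL_W_def
    by (intro sum_mono mult_left_mono integral_deviation_indicator_mono measurable_dyadic_interval) auto
  also have "\<dots> = (\<Sum>i1\<le>q. 2 ^ i1 * WL_G0 f r x)"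
    unfolding WL_G0_def sum_distrib_left by (subst sum.swap) (simp add: power_add mult_ac)
  also have "\<dots> = (2 * 2 ^ q - 1) * WL_G0 f r x"
    by (simp add: sum_distrib_right[symmetric] lessThan_Suc_atMost[symmetric] sum_gp_strict)
  also have "\<dots> \<le> 2 * 2 ^ q * WL_G0 f r x"
    unfolding WL_G0_def
    by (intro mult_right_mono sum_nonneg mult_nonneg_nonneg integral_deviation_indicator_nonneg) auto
  finally show ?thesis .
qed

text \<open>Expanding the product of the two sums of indicators reproduces the double sum in
  \<open>WL_W\<close> term by term.\<close>

lemma has_bochner_integral_WL_W:
  "has_bochner_integral mu2 (\<lambda>u. \<bar>f u - f x\<bar> * (cyl_bound r (fst x) (fst u) * cyl_bound q (snd x) (snd u))) (WL_W f r q x)"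
proof -
  let ?A = "\<lambda>i. dyadic_interval r (fst x \<dotplus> 1 / 2 ^ (i + 1))" and ?B = "\<lambda>i. dyadic_interval q (snd x \<dotplus> 1 / 2 ^ (i + 1))"
  have "has_bochner_integral mu2 (\<lambda>u. \<Sum>i0\<le>r. \<Sum>i1\<le>q. 2 ^ (i0 + i1) * (indicator (?A i0 \<times> ?B i1) u * \<bar>f u - f x\<bar>)) (WL_W f r q x)"
    unfolding WL_W_def set_lebesgue_integral_def real_scaleR_def
    by (intro has_bochner_integral_sum has_bochner_integral_mult_right has_bochner_integral_integrable
        integrable_deviation_indicator measurable_dyadic_interval)
  also have "(\<lambda>u. \<Sum>i0\<le>r. \<Sum>i1\<le>q. 2 ^ (i0 + i1) * (indicator (?A i0 \<times> ?B i1) u * \<bar>f u - f x\<bar>)) =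
      (\<lambda>u. \<bar>f u - f x\<bar> * (cyl_bound r (fst x) (fst u) * cyl_bound q (snd x) (snd u)))"
    unfolding cyl_bound_def unfolding sum_product unfolding sum_distrib_left
    by (intro ext sum.cong refl) (simp add: power_add indicator_times mult_ac)
  finally show ?thesis .
qed

end

section \<open>Convergence at Walsh--Lebesgue points\<close>

lemma averaging_weights_transformation_matrix:
  "transformation_matrix t \<Longrightarrow> averaging_weights (\<lambda>l. t l n) n"
  by unfold_locales (auto simp: transformation_matrix_def)

abbreviation kernel_coeff :: "(nat \<Rightarrow> nat \<Rightarrow> real) \<Rightarrow> nat \<Rightarrow> nat \<Rightarrow> real" where
  "kernel_coeff t n \<equiv> averaging_weights.coeff (\<lambda>l. t l n) n"

lemma abs_translated_kernel_le_cyl_bound: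
  assumes "transformation_matrix t" "y \<in> {0..<1}" "u \<in> {0..<1}" "regular_translate y u"
  shows "\<bar>translated_kernel t n y u\<bar> \<le> (\<Sum>r\<le>Suc (floor_log n). kernel_coeff t n r * cyl_bound r y u)"
proof -
  interpret averaging_weights "\<lambda>l. t l n" n
    using assms(1) by (rule averaging_weights_transformation_matrix)
  have "\<bar>translated_kernel t n y u\<bar> = \<bar>nkernel (\<lambda>l. t l n) n (y \<dotplus> u)\<bar>"
    unfolding matrix_kernel_dotplus[OF assms(4), symmetric] matrix_kernel_eq_nkernel ..
  also have "\<dots> \<le> (\<Sum>r\<le>Suc (floor_log n). coeff r * cyl_kernel r (y \<dotplus> u))"
    by (rule abs_nkernel_le)
  also have "\<dots> \<le> (\<Sum>r\<le>Suc (floor_log n). coeff r * cyl_bound r y u)"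
    unfolding cyl_bound_def
    by (intro sum_mono mult_left_mono cyl_kernel_dotplus_le assms coeff_nonneg)
  finally show ?thesis .
qed

text \<open>The error splits into the deviation from \<open>f x\<close> integrated against the
  kernels, which the pointwise bounds turn into sums of \<open>WL_W\<close>, and \<open>f x\<close>
  times the defect of the total mass from 1.\<close>

lemma tensor_op_deviation_le:
  assumes t0: "transformation_matrix t0" and t1: "transformation_matrix t1"
    and f: "integrable mu2 f" and x: "x \<in> {0..<1} \<times> {0..<1}"
  shows "\<bar>tensor_op t0 n t1 m f x - f x\<bar> \<le>
    (\<Sum>r\<le>Suc (floor_log n). \<Sum>q\<le>Suc (floor_log m). kernel_coeff t0 n r * kernel_coeff t1 m q * WL_W f r q x)
    + \<bar>f x\<bar> * (t0 n n + t1 m m)"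
proof -
  let ?K = "\<lambda>u. translated_kernel t0 n (fst x) (fst u)" and ?L = "\<lambda>u. translated_kernel t1 m (snd x) (snd u)"
  let ?c = "kernel_coeff t0 n" and ?d = "kernel_coeff t1 m"
  let ?N = "Suc (floor_log n)" and ?M = "Suc (floor_log m)"
  let ?B = "\<Sum>k=1..n. \<bar>t0 (n - k) n\<bar> * k" and ?C = "\<Sum>k=1..m. \<bar>t1 (m - k) m\<bar> * k"
  have xI: "fst x \<in> {0..<1}" "snd x \<in> {0..<1}"
    using x by auto
  have [measurable]: "?K \<in> borel_measurable mu2" "?L \<in> borel_measurable mu2"
    by (rule measurable_fst_mu2 measurable_snd_mu2, rule measurable_translated_kernel)+
  have [measurable]: "(\<lambda>u. matrix_kernel t0 n (fst x \<dotplus> fst u)) \<in> borel_measurable mu2"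
      "(\<lambda>u. matrix_kernel t1 m (snd x \<dotplus> snd u)) \<in> borel_measurable mu2"
    using measurable_fst_mu2[of "\<lambda>u. matrix_kernel t0 n (fst x \<dotplus> u)"]
      measurable_snd_mu2[of "\<lambda>u. matrix_kernel t1 m (snd x \<dotplus> u)"] by simp_all
  have [measurable]: "f \<in> borel_measurable mu2"
    using f by (rule borel_measurable_integrable)
  have KL_le: "\<bar>?K u * ?L u\<bar> \<le> ?B * ?C" for u
    unfolding abs_mult
    by (intro mult_mono abs_translated_kernel_le sum_nonneg) auto
  have int_KL: "integrable mu2 (\<lambda>u. g u * (?K u * ?L u))" if "integrable mu2 g" for g
  proof (rule Bochner_Integration.integrable_bound[where f = "\<lambda>u. g u * (?B * ?C)"])
    show "integrable mu2 (\<lambda>u. g u * (?B * ?C))"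
      using that by (rule integrable_mult_left)
    have [measurable]: "g \<in> borel_measurable mu2"
      using that by (rule borel_measurable_integrable)
    show "(\<lambda>u. g u * (?K u * ?L u)) \<in> borel_measurable mu2"
      by measurable
    show "AE u in mu2. norm (g u * (?K u * ?L u)) \<le> norm (g u * (?B * ?C))"
      using order_trans[OF KL_le abs_ge_self] by (simp add: abs_mult[of "g _"] mult_left_mono)
  qed
  have int_f: "integrable mu2 (\<lambda>u. (f u - f x) * (?K u * ?L u))"
    using f finite_measure.integrable_const[OF finite_measure_mu2]
    by (intro int_KL Bochner_Integration.integrable_diff)
  have int_1: "integrable mu2 (\<lambda>u. f x * (?K u * ?L u))"
    using finite_measure.integrable_const[OF finite_measure_mu2] by (rule int_KL)
  have "tensor_op t0 n t1 m f x = (\<integral>u. (f u - f x) * (?K u * ?L u) + f x * (?K u * ?L u) \<partial>mu2)"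
    unfolding tensor_op_def
  proof (rule integral_cong_AE)
    show "AE u in mu2. f u * matrix_kernel t0 n (fst x \<dotplus> fst u) * matrix_kernel t1 m (snd x \<dotplus> snd u) =
        (f u - f x) * (?K u * ?L u) + f x * (?K u * ?L u)"
      using AE_mu2_regular[of "fst x" "snd x"]
      by (rule eventually_mono) (simp add: matrix_kernel_dotplus algebra_simps)
  qed measurable
  also have "\<dots> = (\<integral>u. (f u - f x) * (?K u * ?L u) \<partial>mu2) + (\<integral>u. f x * (?K u * ?L u) \<partial>mu2)"
    by (rule Bochner_Integration.integral_add[OF int_f int_1])
  also have "(\<integral>u. f x * (?K u * ?L u) \<partial>mu2) = f x * ((1 - t0 n n) * (1 - t1 m m))"
    using integral_mu2_product[OF measurable_translated_kernel measurable_translated_kernel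
        abs_translated_kernel_le abs_translated_kernel_le]
    by (simp add: integral_translated_kernel t0 t1)
  finally have "tensor_op t0 n t1 m f x - f x =
      (\<integral>u. (f u - f x) * (?K u * ?L u) \<partial>mu2) + f x * ((1 - t0 n n) * (1 - t1 m m) - 1)"
    by (simp add: right_diff_distrib)
  then have "\<bar>tensor_op t0 n t1 m f x - f x\<bar> \<le>
      \<bar>\<integral>u. (f u - f x) * (?K u * ?L u) \<partial>mu2\<bar> + \<bar>f x\<bar> * \<bar>(1 - t0 n n) * (1 - t1 m m) - 1\<bar>"
    by (simp only: abs_mult[symmetric] abs_triangle_ineq)
  \<comment> \<open>Both diagonal entries lie between 0 and 1, so their product is nonnegative and
    at most either of them.\<close>
  also have "\<bar>(1 - t0 n n) * (1 - t1 m m) - 1\<bar> \<le> t0 n n + t1 m m"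
  proof -
    have bound: "0 \<le> t n n \<and> t n n \<le> 1" if "transformation_matrix t" for t :: "nat \<Rightarrow> nat \<Rightarrow> real" and n
    proof -
      interpret averaging_weights "\<lambda>l. t l n" n
        using that by (rule averaging_weights_transformation_matrix)
      have "1 / real (Suc n) \<le> 1" by simp
      then show ?thesis
        using nonneg[of n] le_inverse[of n] by (auto intro: order_trans)
    qed
    have "0 \<le> t0 n n * t1 m m" "t0 n n * t1 m m \<le> t0 n n" "0 \<le> t1 m m"
      using bound[OF t0] bound[OF t1] by (auto simp: mult_left_le)
    then show ?thesis
      using bound[OF t0, of n] by (simp add: algebra_simps abs_le_iff)
  qed
  also have "\<bar>\<integral>u. (f u - f x) * (?K u * ?L u) \<partial>mu2\<bar> \<le> (\<integral>u. \<bar>(f u - f x) * (?K u * ?L u)\<bar> \<partial>mu2)"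
    by (rule integral_abs_bound)
  also have "\<dots> \<le> (\<integral>u. (\<Sum>r\<le>?N. \<Sum>q\<le>?M. ?c r * ?d q *
      (\<bar>f u - f x\<bar> * (cyl_bound r (fst x) (fst u) * cyl_bound q (snd x) (snd u)))) \<partial>mu2)"
  proof (rule integral_mono_AE)
    show "integrable mu2 (\<lambda>u. \<bar>(f u - f x) * (?K u * ?L u)\<bar>)"
      by (rule integrable_abs[OF int_f])
    show "integrable mu2 (\<lambda>u. \<Sum>r\<le>?N. \<Sum>q\<le>?M. ?c r * ?d q *
        (\<bar>f u - f x\<bar> * (cyl_bound r (fst x) (fst u) * cyl_bound q (snd x) (snd u))))"
      by (intro Bochner_Integration.integrable_sum integrable_mult_right integrable.intros[OF has_bochner_integral_WL_W[OF f x]])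
    \<comment> \<open>The pointwise bound needs both coordinates in the unit interval as well as
      regular translates.\<close>
    have "AE u in mu2. u \<in> space mu2"
      by (rule AE_space)
    then show "AE u in mu2. \<bar>(f u - f x) * (?K u * ?L u)\<bar> \<le> (\<Sum>r\<le>?N. \<Sum>q\<le>?M. ?c r * ?d q *
        (\<bar>f u - f x\<bar> * (cyl_bound r (fst x) (fst u) * cyl_bound q (snd x) (snd u))))"
      using AE_mu2_regular[of "fst x" "snd x"]
    proof eventually_elim
      case (elim u)
      then have u: "fst u \<in> {0..<1}" "snd u \<in> {0..<1}"
        by (auto simp: space_restrict_space)
      have "\<bar>?K u\<bar> * \<bar>?L u\<bar> \<le> (\<Sum>r\<le>?N. ?c r * cyl_bound r (fst x) (fst u)) * (\<Sum>q\<le>?M. ?d q * cyl_bound q (snd x) (snd u))"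
        using elim u xI
        by (intro mult_mono' abs_translated_kernel_le_cyl_bound t0 t1) auto
      then have "\<bar>f u - f x\<bar> * (\<bar>?K u\<bar> * \<bar>?L u\<bar>) \<le> \<bar>f u - f x\<bar> *
          ((\<Sum>r\<le>?N. ?c r * cyl_bound r (fst x) (fst u)) * (\<Sum>q\<le>?M. ?d q * cyl_bound q (snd x) (snd u)))"
        by (intro mult_left_mono) auto
      also have "\<dots> = (\<Sum>r\<le>?N. \<Sum>q\<le>?M. ?c r * ?d q *
        (\<bar>f u - f x\<bar> * (cyl_bound r (fst x) (fst u) * cyl_bound q (snd x) (snd u))))"
        unfolding sum_product unfolding sum_distrib_left by (intro sum.cong refl) (simp only: mult_ac)
      finally show ?case
        by (simp only: abs_mult)
    qed
  qed
  also have "\<dots> = (\<Sum>r\<le>?N. \<Sum>q\<le>?M. ?c r * ?d q * WL_W f r q x)"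
    by (intro has_bochner_integral_integral_eq has_bochner_integral_sum has_bochner_integral_mult_right
        has_bochner_integral_WL_W[OF f x])
  finally show ?thesis
    by (simp add: mult_left_mono)
qed

lemma kernel_coeff_tendsto_0:
  assumes t: "transformation_matrix t" and lim: "(\<lambda>a. t 0 (n a)) \<longlonglongrightarrow> 0"
  shows "(\<lambda>a. kernel_coeff t (n a) r) \<longlonglongrightarrow> 0"
proof (rule order_tendstoI)
  fix e :: real assume "e < 0"
  then show "\<forall>\<^sub>F a in sequentially. e < kernel_coeff t (n a) r"
    using averaging_weights.coeff_nonneg[OF averaging_weights_transformation_matrix[OF t]]
    by (intro always_eventually allI) (rule less_le_trans)
next
  fix e :: real assume "0 < e"
  \<comment> \<open>First \<open>M\<close> is fixed so that the term of \<open>coeff_le\<close>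
    without \<open>t 0 (n a)\<close> is below \<open>e\<close>; only then does \<open>a\<close>
    grow.\<close>
  have "(\<lambda>M. 2 * 2 ^ r * (2 * (1 / 2) ^ M)) \<longlonglongrightarrow> (2 * 2 ^ r * (2 * 0) :: real)"
    by (intro tendsto_intros LIMSEQ_realpow_zero) auto
  then have "\<forall>\<^sub>F M in sequentially. 2 * 2 ^ r * (2 * (1 / 2) ^ M) < e"
    using \<open>0 < e\<close> by (intro order_tendstoD(2)) auto
  then obtain M where M: "2 * 2 ^ r * (2 * (1 / 2) ^ M) < e"
    by (auto simp: eventually_sequentially)
  have "(\<lambda>a. 2 * 2 ^ r * ((real M + 2) * t 0 (n a) + 2 / 2 ^ M)) \<longlonglongrightarrow> 2 * 2 ^ r * ((real M + 2) * 0 + 2 / 2 ^ M)"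
    by (intro tendsto_intros lim)
  then have "\<forall>\<^sub>F a in sequentially. 2 * 2 ^ r * ((real M + 2) * t 0 (n a) + 2 / 2 ^ M) < e"
    using M by (intro order_tendstoD(2)) (auto simp: power_divide)
  then show "\<forall>\<^sub>F a in sequentially. kernel_coeff t (n a) r < e"
    by (rule eventually_mono)
      (rule le_less_trans[OF averaging_weights.coeff_le[OF averaging_weights_transformation_matrix[OF t]]])
qed

text \<open>Both test functions lead to the same \<open>L1\<close> bound for the order without its
  leading digit, so the two norm conditions are treated together. For \<open>n = 0\<close> that
  kernel is 0.\<close>

lemma variation_le_op_norm:
  assumes t: "transformation_matrix t" and "op \<le> c" "c < \<infinity>"
    and op: "op = op_norm H1 H1_norm L1_norm (matrix_op t n) \<or> op = op_norm Linf Linf_norm Linf_norm (matrix_op t n)"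
  shows "averaging_weights.variation (\<lambda>l. t l n) n \<le> 27 + 3 * enn2real c"
proof -
  interpret averaging_weights "\<lambda>l. t l n" n
    using t by (rule averaging_weights_transformation_matrix)
  have "(\<integral>z. \<bar>nkernel (\<lambda>l. t l n) (n mod 2 ^ floor_log n) z\<bar> \<partial>mu) \<le> enn2real c"
  proof (cases "n = 0")
    case True
    then show ?thesis by (simp add: nkernel_def)
  next
    case False
    then obtain A m where n: "n = 2 ^ A + m" "m < 2 ^ A" "A = floor_log n"
      by (rule pow2_split)
    then have "n mod 2 ^ floor_log n = m"
      by (metis mod_add_self1 mod_less)
    moreover have "ennreal (\<integral>z. \<bar>nkernel (\<lambda>l. t l n) m z\<bar> \<partial>mu) \<le> op"
      using op integral_nkernel_le_H1[OF n(2), of t] integral_nkernel_le_Linf[OF n(2), of t] n(1) by metis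
    ultimately have "ennreal (\<integral>z. \<bar>nkernel (\<lambda>l. t l n) (n mod 2 ^ floor_log n) z\<bar> \<partial>mu) \<le> c"
      using assms(2) by simp
    then have "enn2real (ennreal (\<integral>z. \<bar>nkernel (\<lambda>l. t l n) (n mod 2 ^ floor_log n) z\<bar> \<partial>mu)) \<le> enn2real c"
      using assms(3) by (intro enn2real_mono) auto
    then show ?thesis
      by (simp add: enn2real_ennreal)
  qed
  then show ?thesis by (rule variation_le_L1)
qed

lemma variation_le_upsilon:
  assumes t: "transformation_matrix t"
  shows "averaging_weights.variation (\<lambda>l. t l n) n \<le> 4 * upsilon n t"
proof -
  interpret averaging_weights "\<lambda>l. t l n" n
    using t by (rule averaging_weights_transformation_matrix)
  show ?thesis
    using variation_le_digit_changes by (auto simp: upsilon_def tau_def ndigit_def split: if_splits)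
qed

lemma sum_kernel_coeff_bounded:
  assumes t: "transformation_matrix t"
    and cond: "(SUP a. op_norm H1 H1_norm L1_norm (matrix_op t (n a))) < \<infinity> \<or>
         (SUP a. op_norm Linf Linf_norm Linf_norm (matrix_op t (n a))) < \<infinity> \<or>
         bdd_above (range (\<lambda>a. upsilon (n a) t))"
  obtains C where "\<And>a. (\<Sum>r\<le>Suc (floor_log (n a)). kernel_coeff t (n a) r) \<le> C"
proof -
  have "\<exists>C. \<forall>a. averaging_weights.variation (\<lambda>l. t l (n a)) (n a) \<le> C"
    using cond
  proof (elim disjE)
    assume "(SUP a. op_norm H1 H1_norm L1_norm (matrix_op t (n a))) < \<infinity>"
    then show ?thesis
      by (intro exI[of _ "27 + 3 * enn2real (SUP a. op_norm H1 H1_norm L1_norm (matrix_op t (n a)))"]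
          allI variation_le_op_norm[OF t SUP_upper]) auto
  next
    assume "(SUP a. op_norm Linf Linf_norm Linf_norm (matrix_op t (n a))) < \<infinity>"
    then show ?thesis
      by (intro exI[of _ "27 + 3 * enn2real (SUP a. op_norm Linf Linf_norm Linf_norm (matrix_op t (n a)))"]
          allI variation_le_op_norm[OF t SUP_upper]) auto
  next
    assume "bdd_above (range (\<lambda>a. upsilon (n a) t))"
    then obtain C where C: "\<And>a. upsilon (n a) t \<le> C"
      by (auto simp: bdd_above_def)
    have "averaging_weights.variation (\<lambda>l. t l (n a)) (n a) \<le> 4 * C" for a
      using variation_le_upsilon[OF t, of "n a"] C[of a] by linarith
    then show ?thesis by blast
  qed
  then obtain C where C: "\<And>a. averaging_weights.variation (\<lambda>l. t l (n a)) (n a) \<le> C"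
    by blast
  show ?thesis
  proof (rule that)
    fix a
    show "(\<Sum>r\<le>Suc (floor_log (n a)). kernel_coeff t (n a) r) \<le> C + 4"
      using averaging_weights.sum_coeff_le[OF averaging_weights_transformation_matrix[OF t], of "n a"] C[of a]
      by linarith
  qed
qed

text \<open>Where both indices are at least \<open>N\<close> the factor \<open>W\<close> is small;
  elsewhere it is merely bounded, but then one of the two coefficients has a low index, and finitely
  many low coefficients can be made small.\<close>

lemma double_sum_le:
  fixes c d :: "nat \<Rightarrow> real" and W :: "nat \<Rightarrow> nat \<Rightarrow> real"
  assumes c: "\<And>r. 0 \<le> c r" and d: "\<And>q. 0 \<le> d q"
    and C: "(\<Sum>r\<le>K. c r) \<le> C" and D: "(\<Sum>q\<le>M. d q) \<le> D"
    and small: "\<And>r q. N \<le> r \<Longrightarrow> N \<le> q \<Longrightarrow> W r q \<le> e"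
    and low: "\<And>r q. r < N \<or> q < N \<Longrightarrow> W r q \<le> L" and nonneg: "0 \<le> e" "0 \<le> L"
  shows "(\<Sum>r\<le>K. \<Sum>q\<le>M. c r * d q * W r q) \<le> e * (C * D) + L * ((\<Sum>r<N. c r) * D + C * (\<Sum>q<N. d q))"
proof -
  have C0: "0 \<le> C" and D0: "0 \<le> D"
    using C D c d by (meson order_trans sum_nonneg)+
  have "(\<Sum>r\<le>K. \<Sum>q\<le>M. c r * d q * W r q) \<le>
      (\<Sum>r\<le>K. \<Sum>q\<le>M. c r * d q * (e + L * of_bool (r < N) + L * of_bool (q < N)))"
  proof (intro sum_mono mult_left_mono mult_nonneg_nonneg c d)
    fix r q
    show "W r q \<le> e + L * of_bool (r < N) + L * of_bool (q < N)"
    proof (cases "r < N \<or> q < N")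
      case True
      then show ?thesis
        using low[OF True] nonneg by auto
    next
      case False
      then show ?thesis
        using small[of r q] by simp
    qed
  qed
  also have "\<dots> = e * ((\<Sum>r\<le>K. c r) * (\<Sum>q\<le>M. d q)) + L * ((\<Sum>r\<le>K. c r * of_bool (r < N)) * (\<Sum>q\<le>M. d q)
      + (\<Sum>r\<le>K. c r) * (\<Sum>q\<le>M. d q * of_bool (q < N)))"
    unfolding sum_product unfolding sum_distrib_left distrib_left sum.distrib
    by (simp only: mult_ac add.assoc)
  also have "\<dots> \<le> e * (C * D) + L * ((\<Sum>r<N. c r) * D + C * (\<Sum>q<N. d q))"
  proof -
    have cut: "(\<Sum>r\<le>K. g r * of_bool (r < N)) \<le> (\<Sum>r<N. g r)" if "\<And>r. 0 \<le> g r" for g :: "nat \<Rightarrow> real" and K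
    proof -
      have "(\<Sum>r\<le>K. g r * of_bool (r < N)) = (\<Sum>r\<in>{..K} \<inter> {..<N}. g r)"
        by (rule sum.mono_neutral_cong_right) auto
      also have "\<dots> \<le> (\<Sum>r<N. g r)"
        using that by (intro sum_mono2) auto
      finally show ?thesis .
    qed
    show ?thesis
      using c d nonneg C0 D0
      by (intro add_mono mult_left_mono mult_mono C D cut) (auto intro!: sum_nonneg mult_nonneg_nonneg)
  qed
  finally show ?thesis .
qed

theorem theorem2:
  fixes T0 T1 :: "nat \<Rightarrow> nat \<Rightarrow> real"
    and n0 n1 :: "nat \<Rightarrow> nat"
    and f :: "real \<times> real \<Rightarrow> real"
    and x :: "real \<times> real"
  assumes "transformation_matrix T0" and "transformation_matrix T1"
    and "strict_mono n0" and "strict_mono n1"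
    and "(SUP a. op_norm H1 H1_norm L1_norm (matrix_op T0 (n0 a))) < \<infinity> \<or>
         (SUP a. op_norm Linf Linf_norm Linf_norm (matrix_op T0 (n0 a))) < \<infinity> \<or>
         bdd_above (range (\<lambda>a. upsilon (n0 a) T0))"
    and "(SUP b. op_norm H1 H1_norm L1_norm (matrix_op T1 (n1 b))) < \<infinity> \<or>
         (SUP b. op_norm Linf Linf_norm Linf_norm (matrix_op T1 (n1 b))) < \<infinity> \<or>
         bdd_above (range (\<lambda>b. upsilon (n1 b) T1))"
    and "(\<lambda>a. T0 0 (n0 a)) \<longlonglongrightarrow> 0" and "(\<lambda>b. T1 0 (n1 b)) \<longlonglongrightarrow> 0"
    and "f \<in> LlnL"
    and "walsh_lebesgue_point f x"
  shows "((\<lambda>(a, b). tensor_op T0 (n0 a) T1 (n1 b) f x) \<longlongrightarrow> f x)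
           (filtercomap (\<lambda>(a, b). min (n0 a) (n1 b)) at_top)"
proof (rule tendstoI)
  fix \<epsilon> :: real assume "0 < \<epsilon>"
  let ?c = "\<lambda>a. kernel_coeff T0 (n0 a)" and ?d = "\<lambda>b. kernel_coeff T1 (n1 b)"
  have f: "integrable mu2 f"
    using assms(9) by (simp add: LlnL_def)
  have x: "x \<in> {0..<1} \<times> {0..<1}"
    using assms(10) by (simp add: walsh_lebesgue_point_def)
  note nonneg0 = averaging_weights.coeff_nonneg[OF averaging_weights_transformation_matrix[OF assms(1)]]
  note nonneg1 = averaging_weights.coeff_nonneg[OF averaging_weights_transformation_matrix[OF assms(2)]]
  obtain C where C: "\<And>a. (\<Sum>r\<le>Suc (floor_log (n0 a)). ?c a r) \<le> C"
    using sum_kernel_coeff_bounded[OF assms(1,5)] by blast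
  obtain D where D: "\<And>b. (\<Sum>q\<le>Suc (floor_log (n1 b)). ?d b q) \<le> D"
    using sum_kernel_coeff_bounded[OF assms(2,6)] by blast
  have C0: "0 \<le> C" and D0: "0 \<le> D"
    using order_trans[OF sum_nonneg C] order_trans[OF sum_nonneg D] nonneg0 nonneg1 by blast+
  \<comment> \<open>The added 1 covers the case \<open>C * D = 0\<close>.\<close>
  define \<delta> where "\<delta> = \<epsilon> / 2 / (C * D + 1)"
  have "0 < C * D + 1"
    using C0 D0 by (simp add: add_nonneg_pos)
  then have \<delta>: "0 < \<delta>" "\<delta> * (C * D) < \<epsilon> / 2"
    using \<open>0 < \<epsilon>\<close> unfolding \<delta>_def by (auto simp: field_simps)
  have "((\<lambda>(r, q). WL_W f r q x) \<longlongrightarrow> 0) (filtercomap (\<lambda>(r, q). min r q) at_top)"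
    using assms(10) by (simp add: walsh_lebesgue_point_def)
  then have "\<forall>\<^sub>F p in filtercomap (\<lambda>(r, q). min r q) at_top. (\<lambda>(r, q). WL_W f r q x) p < \<delta>"
    using \<delta>(1) by (rule order_tendstoD(2))
  then obtain N where N: "\<And>r q. N \<le> r \<Longrightarrow> N \<le> q \<Longrightarrow> WL_W f r q x \<le> \<delta>"
    unfolding eventually_filtercomap_at_top_linorder by (fastforce intro: less_imp_le)
  obtain G1 G0 where G: "\<And>q. WL_G1 f q x \<le> G1" "\<And>r. WL_G0 f r x \<le> G0"
    using assms(10) unfolding walsh_lebesgue_point_def bdd_above_def by blast
  \<comment> \<open>One bound for both low regions; the maximum with 0 keeps it nonnegative, so that
    replacing \<open>2 ^ r\<close> or \<open>2 ^ q\<close> by \<open>2 ^ N\<close> preserves the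
    inequality.\<close>
  define L where "L = 2 * 2 ^ N * max 0 (max G0 G1)"
  have L0: "0 \<le> L"
    by (simp add: L_def)
  have low: "WL_W f r q x \<le> L" if "r < N \<or> q < N" for r q
    using that
  proof
    assume "r < N"
    have "WL_W f r q x \<le> 2 * 2 ^ r * WL_G1 f q x"
      by (rule WL_W_le_G1[OF f x])
    also have "\<dots> \<le> 2 * 2 ^ r * max 0 (max G0 G1)"
      using G(1)[of q] by (intro mult_left_mono) auto
    also have "\<dots> \<le> L"
      unfolding L_def using \<open>r < N\<close> by (intro mult_right_mono mult_left_mono power_increasing) auto
    finally show ?thesis .
  next
    assume "q < N"
    have "WL_W f r q x \<le> 2 * 2 ^ q * WL_G0 f r x"
      by (rule WL_W_le_G0[OF f x])
    also have "\<dots> \<le> 2 * 2 ^ q * max 0 (max G0 G1)"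
      using G(2)[of r] by (intro mult_left_mono) auto
    also have "\<dots> \<le> L"
      unfolding L_def using \<open>q < N\<close> by (intro mult_right_mono mult_left_mono power_increasing) auto
    finally show ?thesis .
  qed
  have diag: "(\<lambda>a. t (n a) (n a)) \<longlonglongrightarrow> 0"
    if t: "transformation_matrix t" and lim: "(\<lambda>a. t 0 (n a)) \<longlonglongrightarrow> 0" for t :: "nat \<Rightarrow> nat \<Rightarrow> real" and n :: "nat \<Rightarrow> nat"
  proof (rule tendsto_sandwich[OF _ _ tendsto_const lim])
    show "\<forall>\<^sub>F a in sequentially. 0 \<le> t (n a) (n a)" "\<forall>\<^sub>F a in sequentially. t (n a) (n a) \<le> t 0 (n a)"
      using averaging_weights.nonneg[OF averaging_weights_transformation_matrix[OF t]]
        averaging_weights.antimono[OF averaging_weights_transformation_matrix[OF t]] by simp_all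
  qed
  \<comment> \<open>The remaining error is a sum of one part depending on \<open>a\<close> alone and
    one depending on \<open>b\<close> alone, so ordinary sequential limits suffice.\<close>
  define E0 where "E0 a = L * D * (\<Sum>r<N. ?c a r) + \<bar>f x\<bar> * T0 (n0 a) (n0 a)" for a
  define E1 where "E1 b = L * C * (\<Sum>q<N. ?d b q) + \<bar>f x\<bar> * T1 (n1 b) (n1 b)" for b
  have "(\<lambda>a. L * D * (\<Sum>r<N. ?c a r) + \<bar>f x\<bar> * T0 (n0 a) (n0 a)) \<longlonglongrightarrow> L * D * (\<Sum>r<N. 0) + \<bar>f x\<bar> * 0"
    by (rule tendsto_add[OF tendsto_mult_left[OF tendsto_sum] tendsto_mult_left])
      (rule kernel_coeff_tendsto_0[OF assms(1,7)], rule diag[OF assms(1,7)])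
  then have "E0 \<longlonglongrightarrow> 0"
    by (simp add: E0_def[abs_def])
  then have "\<forall>\<^sub>F a in sequentially. E0 a < \<epsilon> / 4"
    using \<open>0 < \<epsilon>\<close> by (intro order_tendstoD(2)) auto
  then obtain a0 where a0: "\<And>a. a0 \<le> a \<Longrightarrow> E0 a < \<epsilon> / 4"
    by (auto simp: eventually_sequentially)
  have "(\<lambda>b. L * C * (\<Sum>q<N. ?d b q) + \<bar>f x\<bar> * T1 (n1 b) (n1 b)) \<longlonglongrightarrow> L * C * (\<Sum>q<N. 0) + \<bar>f x\<bar> * 0"
    by (rule tendsto_add[OF tendsto_mult_left[OF tendsto_sum] tendsto_mult_left])
      (rule kernel_coeff_tendsto_0[OF assms(2,8)], rule diag[OF assms(2,8)])
  then have "E1 \<longlonglongrightarrow> 0"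
    by (simp add: E1_def[abs_def])
  then have "\<forall>\<^sub>F b in sequentially. E1 b < \<epsilon> / 4"
    using \<open>0 < \<epsilon>\<close> by (intro order_tendstoD(2)) auto
  then obtain b0 where b0: "\<And>b. b0 \<le> b \<Longrightarrow> E1 b < \<epsilon> / 4"
    by (auto simp: eventually_sequentially)
  have main: "dist (tensor_op T0 (n0 a) T1 (n1 b) f x) (f x) < \<epsilon>"
    if "max (n0 a0) (n1 b0) \<le> min (n0 a) (n1 b)" for a b
  proof -
    \<comment> \<open>Strict monotonicity turns the lower bound on the smaller of the two orders
      back into lower bounds on both indices.\<close>
    have "a0 \<le> a" "b0 \<le> b"
      using that strict_mono_less_eq[OF assms(3)] strict_mono_less_eq[OF assms(4)] by auto
    then have E: "E0 a < \<epsilon> / 4" "E1 b < \<epsilon> / 4"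
      using a0 b0 by auto
    have "\<bar>tensor_op T0 (n0 a) T1 (n1 b) f x - f x\<bar> \<le>
        (\<Sum>r\<le>Suc (floor_log (n0 a)). \<Sum>q\<le>Suc (floor_log (n1 b)). ?c a r * ?d b q * WL_W f r q x)
        + \<bar>f x\<bar> * (T0 (n0 a) (n0 a) + T1 (n1 b) (n1 b))"
      by (rule tensor_op_deviation_le[OF assms(1,2) f x])
    also have "(\<Sum>r\<le>Suc (floor_log (n0 a)). \<Sum>q\<le>Suc (floor_log (n1 b)). ?c a r * ?d b q * WL_W f r q x)
        \<le> \<delta> * (C * D) + L * ((\<Sum>r<N. ?c a r) * D + C * (\<Sum>q<N. ?d b q))"
      using C D N low \<delta>(1) L0 nonneg0 nonneg1 by (intro double_sum_le) auto
    also have "\<delta> * (C * D) + L * ((\<Sum>r<N. ?c a r) * D + C * (\<Sum>q<N. ?d b q))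
        + \<bar>f x\<bar> * (T0 (n0 a) (n0 a) + T1 (n1 b) (n1 b)) = \<delta> * (C * D) + E0 a + E1 b"
      by (simp add: E0_def E1_def algebra_simps)
    finally show ?thesis
      using E \<delta>(2) by (simp add: dist_real_def)
  qed
  show "\<forall>\<^sub>F p in filtercomap (\<lambda>(a, b). min (n0 a) (n1 b)) at_top.
      dist ((\<lambda>(a, b). tensor_op T0 (n0 a) T1 (n1 b) f x) p) (f x) < \<epsilon>"
    unfolding eventually_filtercomap_at_top_linorder
    using main by (intro exI[of _ "max (n0 a0) (n1 b0)"]) auto
qed

end
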